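(* Let $P(a_1,a_2,a_3)$ be a hyperbolic pair of pants with standard orthobasis $\{\alpha,\beta,\gamma\}$, where $(a_1,a_2,a_3):=(\cosh\ell(\alpha),\cosh\ell(\beta),\cosh\ell(\gamma))$, and assume $a_1\le a_2\le a_3$. The following are equivalent: (i) $P(a_1,a_2,a_3)$ is ortho-integral. (ii) $(a_1,a_2,a_3)\in\{(2,2,2),(2,2,5),(2,2,17),(3,3,3),(3,3,7),(3,3,19),(5,5,11)\}$. (iii) For all $i,j,k$ with $\{i,j,k\}=\{1,2,3\}$, $$\left\{a_i,\ \frac{2(a_1^2+a_2^2+a_3^2+2a_1a_2a_3-1)}{a_i^2-1},\ \frac{4(a_ia_j+a_k)^2}{(a_i^2-1)(a_j^2-1)}\right\}\subset\mathbb{N}.$$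
   Context: A hyperbolic pair of pants is a compact sphere with three holes with a hyperbolic metric and three closed geodesic boundary components. An orthogeodesic is a geodesic arc (of positive length, possibly self-intersecting) meeting the boundary perpendicularly at both endpoints. The standard orthobasis of a pair of pants is the set of its three pairwise disjoint simple orthogeodesics, each joining two distinct boundary components (one for each pair); they cut the pair of pants into two isometric right-angled hexagons. Any triple of real numbers $a_1,a_2,a_3>1$ arises as the triple of cosh-lengths of a standard orthobasis of a pair of pants unique up to isometry. A hyperbolic surface is ortho-integral (OI) if $\cosh$ of the length of every orthogeodesic is an integer. $\ell$ denotes length. *)

theory Defs
  imports "HOL-Analysis.Analysis"
begin

section \<open>The hyperbolic plane (hyperboloid model)\<close>

definition mink :: "real^3 \<Rightarrow> real^3 \<Rightarrow> real" where
  "mink x y = x$1 * y$1 + x$2 * y$2 - x$3 * y$3"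

definition hyp_plane :: "(real^3) set" where
  "hyp_plane = {x. mink x x = -1 \<and> x$3 > 0}"

definition hdist :: "real^3 \<Rightarrow> real^3 \<Rightarrow> real" where
  "hdist x y = arcosh (- mink x y)"

text \<open>
  A closed half-plane bounded by a complete geodesic; the bounding geodesic consists of the points
  with vanishing first coordinate.  The subspace topology from \<^typ>\<open>real^3\<close> is the
  topology of \<^const>\<open>hdist\<close>.
\<close>
definition hyp_halfplane :: "(real^3) set" where
  "hyp_halfplane = {x \<in> hyp_plane. x$1 \<ge> 0}"

text \<open>
  For \<open>n\<close> with \<open>mink n n = 1\<close>, the set of \<open>x \<in> hyp_plane\<close> with \<open>mink x n = 0\<close> is a complete
  geodesic with unit normal \<open>n\<close>.  A right-angled hexagon is given by the outward unit normals
  \<open>n 0, ..., n 5\<close> of its sides in cyclic order.  The point \<open>p\<close> below is the vertex shared by two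
  consecutive sides; orthogonality of the two normals says that the angle there is a right angle,
  and the strict inequalities say that \<open>p\<close> is a point of the hexagon on no other side.
\<close>
definition hex_region :: "(nat \<Rightarrow> real^3) \<Rightarrow> (real^3) set" where
  "hex_region n = {x \<in> hyp_plane. \<forall>i<6. mink x (n i) \<le> 0}"

definition hex_side :: "(nat \<Rightarrow> real^3) \<Rightarrow> nat \<Rightarrow> (real^3) set" where
  "hex_side n i = {x \<in> hex_region n. mink x (n i) = 0}"

definition right_angled_hexagon :: "(nat \<Rightarrow> real^3) \<Rightarrow> bool" where
  "right_angled_hexagon n \<longleftrightarrow>
     (\<forall>i<6. let i' = Suc i mod 6 in
        mink (n i) (n i) = 1 \<and> mink (n i) (n i') = 0 \<and>
        (\<exists>p\<in>hyp_plane. mink p (n i) = 0 \<and> mink p (n i') = 0 \<and>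
           (\<forall>j<6. j \<noteq> i \<and> j \<noteq> i' \<longrightarrow> mink p (n j) < 0)))"

section \<open>Hyperbolic surfaces with geodesic boundary\<close>

definition hyp_chart :: "'a::metric_space set \<Rightarrow> 'a set \<Rightarrow> ('a \<Rightarrow> real^3) \<Rightarrow> bool" where
  "hyp_chart P U \<phi> \<longleftrightarrow>
     openin (top_of_set P) U \<and>
     openin (top_of_set hyp_halfplane) (\<phi> ` U) \<and>
     (\<forall>x\<in>U. \<forall>y\<in>U. hdist (\<phi> x) (\<phi> y) = dist x y)"

text \<open>The distance is realised by a path; for compact surfaces this says that it is the
  path metric.\<close>
definition geodesic_metric :: "'a::metric_space set \<Rightarrow> bool" where
  "geodesic_metric P \<longleftrightarrow>
     (\<forall>x\<in>P. \<forall>y\<in>P. \<exists>g. g ` {0..dist x y} \<subseteq> P \<and> g 0 = x \<and> g (dist x y) = y \<and>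
        (\<forall>s\<in>{0..dist x y}. \<forall>t\<in>{0..dist x y}. dist (g s) (g t) = \<bar>s - t\<bar>))"

definition hyperbolic_surface :: "'a::metric_space set \<Rightarrow> bool" where
  "hyperbolic_surface P \<longleftrightarrow>
     geodesic_metric P \<and> (\<forall>p\<in>P. \<exists>U \<phi>. hyp_chart P U \<phi> \<and> p \<in> U)"

definition hyp_boundary :: "'a::metric_space set \<Rightarrow> 'a set" where
  "hyp_boundary P = {p \<in> P. \<exists>U \<phi>. hyp_chart P U \<phi> \<and> p \<in> U \<and> \<phi> p $ 1 = 0}"

text \<open>The unit sphere minus three open caps whose closures are disjoint.\<close>
definition three_holed_sphere :: "(real^3) set" where
  "three_holed_sphere = sphere 0 1 - (\<Union>i. ball (axis i 1) (1/2))"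

text \<open>The charts already force every boundary component to be a geodesic, and by compactness
  a closed one.\<close>
definition hyperbolic_pants :: "'a::metric_space set \<Rightarrow> bool" where
  "hyperbolic_pants P \<longleftrightarrow>
     compact P \<and> P homeomorphic three_holed_sphere \<and> hyperbolic_surface P"

section \<open>Orthogeodesics\<close>

text \<open>An arc is a pair \<open>(l, c)\<close>, where \<open>c\<close> is considered only on the interval \<open>{0..l}\<close>; for
  geodesic arcs \<open>c\<close> has unit speed, so \<open>l\<close> is the length.\<close>
type_synonym 'a arc = "real \<times> (real \<Rightarrow> 'a)"

abbreviation arc_length :: "'a arc \<Rightarrow> real" where
  "arc_length \<equiv> fst"

definition arc_image :: "'a arc \<Rightarrow> 'a set" where
  "arc_image \<gamma> = snd \<gamma> ` {0..arc_length \<gamma>}"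

definition geodesic_arc :: "'a::metric_space set \<Rightarrow> 'a arc \<Rightarrow> bool" where
  "geodesic_arc P = (\<lambda>(l, c). l > 0 \<and> c ` {0..l} \<subseteq> P \<and>
     (\<forall>t\<in>{0..l}. \<exists>e>0. \<forall>s\<in>{0..l} \<inter> ball t e. \<forall>s'\<in>{0..l} \<inter> ball t e.
        dist (c s) (c s') = \<bar>s - s'\<bar>))"

text \<open>
  At parameter \<open>t\<close> the arc is at a boundary point, and its velocity \<open>D\<close>, read in a chart, is
  orthogonal to the boundary: the tangent vectors of \<open>hyp_plane\<close> at a point \<open>q\<close> are the \<open>w\<close> with
  \<open>mink w q = 0\<close>, and those tangent to the bounding geodesic of \<open>hyp_halfplane\<close> satisfy
  in addition \<open>w $ 1 = 0\<close>.
\<close>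
definition perp_to_boundary :: "'a::metric_space set \<Rightarrow> 'a arc \<Rightarrow> real \<Rightarrow> bool" where
  "perp_to_boundary P = (\<lambda>(l, c) t.
     \<exists>U \<phi> D. hyp_chart P U \<phi> \<and> c t \<in> U \<and> \<phi> (c t) $ 1 = 0 \<and>
       ((\<lambda>s. \<phi> (c s)) has_vector_derivative D) (at t within {0..l}) \<and>
       (\<forall>w. w$1 = 0 \<and> mink w (\<phi> (c t)) = 0 \<longrightarrow> mink D w = 0))"

definition orthogeodesic :: "'a::metric_space set \<Rightarrow> 'a arc \<Rightarrow> bool" where
  "orthogeodesic P \<gamma> \<longleftrightarrow>
     geodesic_arc P \<gamma> \<and> perp_to_boundary P \<gamma> 0 \<and> perp_to_boundary P \<gamma> (arc_length \<gamma>)"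

definition simple_arc :: "'a arc \<Rightarrow> bool" where
  "simple_arc \<gamma> \<longleftrightarrow> inj_on (snd \<gamma>) {0..arc_length \<gamma>}"

definition ortho_integral :: "'a::metric_space set \<Rightarrow> bool" where
  "ortho_integral P \<longleftrightarrow> (\<forall>\<gamma>. orthogeodesic P \<gamma> \<longrightarrow> cosh (arc_length \<gamma>) \<in> \<int>)"

section \<open>The standard orthobasis\<close>

definition joins :: "'a arc \<Rightarrow> 'a set \<Rightarrow> 'a set \<Rightarrow> bool" where
  "joins = (\<lambda>(l, c) B B'. (c 0 \<in> B \<and> c l \<in> B') \<or> (c 0 \<in> B' \<and> c l \<in> B))"

text \<open>
  \<open>P\<close> is the union of two isometric copies of one right-angled hexagon, which meet exactly along
  the three arcs; the sides of each copy lie alternately on the arcs and on the boundary.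
  Each hexagon is isometrically embedded for the path metric of \<open>P\<close> itself, because the map
  \<open>P \<rightarrow> hexagon\<close> that folds \<open>P\<close> along the arcs does not increase distances.
\<close>
definition cut_into_hexagons ::
    "'a::metric_space set \<Rightarrow> 'a arc \<Rightarrow> 'a arc \<Rightarrow> 'a arc \<Rightarrow> bool" where
  "cut_into_hexagons P \<alpha> \<beta> \<gamma> \<longleftrightarrow>
     (\<exists>n f f'. right_angled_hexagon n \<and>
        f ` hex_region n \<union> f' ` hex_region n = P \<and>
        f ` hex_region n \<inter> f' ` hex_region n = arc_image \<alpha> \<union> arc_image \<beta> \<union> arc_image \<gamma> \<and>
        (\<forall>h\<in>{f, f'}.
           (\<forall>x\<in>hex_region n. \<forall>y\<in>hex_region n. dist (h x) (h y) = hdist x y) \<and>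
           h ` hex_side n 0 = arc_image \<alpha> \<and>
           h ` hex_side n 2 = arc_image \<beta> \<and>
           h ` hex_side n 4 = arc_image \<gamma> \<and>
           (\<forall>i\<in>{1, 3, 5}. h ` hex_side n i \<subseteq> hyp_boundary P)))"

text \<open>The last clause is automatic for a hyperbolic pair of pants (classically, three such arcs
  always cut it into two isometric right-angled hexagons); it is recorded as part of
  the notion.\<close>
definition standard_orthobasis ::
    "'a::metric_space set \<Rightarrow> 'a arc \<Rightarrow> 'a arc \<Rightarrow> 'a arc \<Rightarrow> bool" where
  "standard_orthobasis P \<alpha> \<beta> \<gamma> \<longleftrightarrow>
     (\<forall>\<eta>\<in>{\<alpha>, \<beta>, \<gamma>}. orthogeodesic P \<eta> \<and> simple_arc \<eta>) \<and>
     arc_image \<alpha> \<inter> arc_image \<beta> = {} \<and>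
     arc_image \<beta> \<inter> arc_image \<gamma> = {} \<and>
     arc_image \<alpha> \<inter> arc_image \<gamma> = {} \<and>
     (\<exists>B1 B2 B3. {B1, B2, B3} = components (hyp_boundary P) \<and>
        B1 \<noteq> B2 \<and> B2 \<noteq> B3 \<and> B1 \<noteq> B3 \<and>
        joins \<alpha> B1 B2 \<and> joins \<beta> B2 B3 \<and> joins \<gamma> B3 B1) \<and>
     cut_into_hexagons P \<alpha> \<beta> \<gamma>"

end

theory Submission
  imports Defs
begin

text \<open>
  Unfolding the two hexagons of \<open>P\<close> along the orthobasis turns an orthogeodesic into the common
  perpendicular of two lines in the orbit of the boundary sides of one hexagon under the group \<open>G\<close>
  generated by the reflections in its other three sides.  With \<open>e\<^sub>1, e\<^sub>2, e\<^sub>3\<close> the unit normals of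
  the boundary sides, the cosh of its length is therefore \<open>- \<langle>e\<^sub>i, g e\<^sub>j\<rangle>\<close> for some \<open>g\<close> in \<open>G\<close>.

  For each of the seven triples the orbit lies in a lattice on which the Minkowski form is integral,
  so \<open>P\<close> is ortho-integral.  Conversely, every reduced palindrome \<open>g\<close> that begins with the
  reflection in the side opposite to \<open>e\<^sub>i\<close> is realised by an orthogeodesic of cosh-length
  \<open>- \<langle>e\<^sub>i, g e\<^sub>i\<rangle>\<close>.  One-letter words show that the second quantity in (iii) is an integer.  The
  alternating words in two reflections give an integer sequence satisfying a linear recurrence whose
  coefficient is the third quantity minus 2; the powers of this coefficient have bounded
  denominators, so it is an integer.

  Finally, the third quantity exceeds 4 and the second exceeds 2, so under (iii) they are at least 5
  and 3, and this leaves finitely many triples.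
\<close>

section \<open>The Minkowski form\<close>

text \<open>No covering space is built. The charts give only local isometries of \<open>P\<close>,
  so the folding map from \<open>P\<close> onto one hexagon takes the place of a developing map:
  near each parameter the fold of a geodesic arc is a word in the reflections applied to one fixed
  geodesic of the plane, and only the word changes along the arc. The metric enters through one
  fact: close to a mirror, points of different copies are as far apart as one of them is from the
  mirror image of the other.

  A common perpendicular yields an orthogeodesic only if its feet lie inside boundary sides and not
  elsewhere on their lines. This is why palindromes are used: such a \<open>g\<close> exchanges the
  two lines and reverses their perpendicular, so one foot has to be checked, and starting with the
  opposite mirror keeps it inside the side. Signs of Minkowski products along reduced words take the
  place of a tiling theorem.

  The lattice is not always the span of the boundary normals: for (2,2,17) and (3,3,19) one
  reflection has coefficients 1/4 and 1/3, and a finer lattice is taken.\<close>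

definition geo :: "real^3 \<Rightarrow> real^3 \<Rightarrow> real \<Rightarrow> real^3" where
  "geo p v s = cosh s *\<^sub>R p + sinh s *\<^sub>R v"

definition reflect :: "real^3 \<Rightarrow> real^3 \<Rightarrow> real^3" where
  "reflect n x = x - (2 * mink x n) *\<^sub>R n"

lemma mink_commute: "mink x y = mink y x"
  by (simp add: mink_def mult.commute)

lemma mink_add [simp]: "mink (x + y) z = mink x z + mink y z" "mink z (x + y) = mink z x + mink z y"
  and mink_diff [simp]: "mink (x - y) z = mink x z - mink y z" "mink z (x - y) = mink z x - mink z y"
  and mink_scaleR [simp]: "mink (r *\<^sub>R x) z = r * mink x z" "mink z (r *\<^sub>R x) = r * mink z x"
  and mink_minus [simp]: "mink (- x) z = - mink x z" "mink z (- x) = - mink z x"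
  and mink_zero [simp]: "mink 0 z = 0" "mink z 0 = 0"
  by (simp_all add: mink_def algebra_simps)

lemma vec3_eqI: "x$1 = y$1 \<Longrightarrow> x$2 = y$2 \<Longrightarrow> x$3 = y$3 \<Longrightarrow> x = (y::real^3)"
  by (simp add: vec_eq_iff forall_3)

lemma continuous_on_mink [continuous_intros]:
  fixes f g :: "'a::topological_space \<Rightarrow> real^3"
  assumes "continuous_on S f" "continuous_on S g"
  shows "continuous_on S (\<lambda>x. mink (f x) (g x))"
  unfolding mink_def using assms by (intro continuous_intros)

text \<open>The complement of a timelike vector is spacelike: scaling by \<open>y$3 * y$3\<close>
  and eliminating \<open>w$3\<close> through orthogonality leaves a positive multiple of the
  Euclidean square of the first two coordinates plus a Lagrange square.\<close>

lemma mink_perp_pos: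
  assumes y: "mink y y < 0" and wy: "mink w y = 0"
  shows "mink w w \<ge> 0" "mink w w = 0 \<Longrightarrow> w = 0"
proof -
  have y3: "y$1 * y$1 + y$2 * y$2 < y$3 * y$3" using y by (simp add: mink_def)
  have w3: "w$1 * y$1 + w$2 * y$2 = w$3 * y$3" using wy by (simp add: mink_def)
  have y3pos: "y$3 * y$3 > 0"
    using y3 sum_squares_ge_zero[of "y$1" "y$2"] by linarith
  let ?e = "y$3 * y$3 - (y$1 * y$1 + y$2 * y$2)"
  have key: "(y$3 * y$3) * mink w w
     = ?e * (w$1 * w$1 + w$2 * w$2) + (w$1 * y$2 - w$2 * y$1)^2"
  proof -
    have "(y$3 * y$3) * mink w w = (y$3 * y$3) * (w$1 * w$1 + w$2 * w$2) - (w$3 * y$3)^2"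
      by (simp add: mink_def algebra_simps power2_eq_square)
    also have "(w$3 * y$3)^2 = (w$1 * y$1 + w$2 * y$2)^2" using w3 by simp
    finally show ?thesis by (simp add: algebra_simps power2_eq_square)
  qed
  have e: "?e > 0" using y3 by simp
  have "(y$3 * y$3) * mink w w \<ge> 0"
    unfolding key using e by (intro add_nonneg_nonneg mult_nonneg_nonneg[of _ "_ + _"]) auto
  with y3pos show "mink w w \<ge> 0" by (simp add: zero_le_mult_iff)
  assume "mink w w = 0"
  with key have "?e * (w$1 * w$1 + w$2 * w$2) + (w$1 * y$2 - w$2 * y$1)^2 = 0" by simp
  moreover have "?e * (w$1 * w$1 + w$2 * w$2) \<ge> 0" using e by (intro mult_nonneg_nonneg[of _ "_ + _"]) auto
  ultimately have "?e * (w$1 * w$1 + w$2 * w$2) = 0"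
    using zero_le_power2[of "w$1 * y$2 - w$2 * y$1"] by linarith
  then have "w$1 * w$1 + w$2 * w$2 = 0" using e by (metis less_irrefl mult_eq_0_iff)
  then have w12: "w$1 = 0" "w$2 = 0" by (auto simp: sum_squares_eq_zero_iff)
  then have "w$3 * y$3 = 0" using w3 by simp
  then have "w$3 = 0" using y3pos by auto
  with w12 show "w = 0" by (intro vec3_eqI) auto
qed

lemma mink_perp_Cauchy_Schwarz:
  assumes y: "mink y y < 0" and "mink v y = 0" "mink w y = 0"
  shows "(mink v w)\<^sup>2 \<le> mink v v * mink w w"
proof (cases "mink w w = 0")
  case True
  then have "w = 0" using mink_perp_pos[OF y assms(3)] by simp
  then show ?thesis by simp
next
  case False
  then have w: "mink w w > 0" using mink_perp_pos(1)[OF y assms(3)] by simp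
  let ?u = "mink w w *\<^sub>R v - mink v w *\<^sub>R w"
  have "mink ?u y = 0" using assms by simp
  from mink_perp_pos(1)[OF y this]
  have "0 \<le> mink w w * (mink v v * mink w w - (mink v w)\<^sup>2)"
    by (simp add: algebra_simps power2_eq_square mink_commute[of w v])
  with w show ?thesis by (simp add: zero_le_mult_iff)
qed

lemma hyp_planeD: "x \<in> hyp_plane \<Longrightarrow> mink x x = -1" "x \<in> hyp_plane \<Longrightarrow> x$3 > 0"
  by (auto simp: hyp_plane_def)

text \<open>The component of \<open>x\<close> orthogonal to \<open>y\<close> has nonnegative square,
  which bounds the product in absolute value; the sign comes from the Euclidean Cauchy-Schwarz
  inequality in the first two coordinates.\<close>

lemma mink_hyp_plane_le:
  assumes "x \<in> hyp_plane" "y \<in> hyp_plane"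
  shows "mink x y \<le> -1"
proof -
  let ?w = "x + mink x y *\<^sub>R y"
  have y: "mink y y < 0" using assms by (simp add: hyp_planeD)
  have "mink ?w y = 0" using assms by (simp add: hyp_planeD)
  from mink_perp_pos(1)[OF y this] have "1 \<le> (mink x y)\<^sup>2"
    using assms by (simp add: hyp_planeD power2_eq_square algebra_simps mink_commute[of y x])
  moreover have "mink x y < 0"
  proof -
    have *: "norm (vector [z$1, z$2] :: real^2) < z$3" if "z \<in> hyp_plane" for z
    proof -
      have "(z$1)^2 + (z$2)^2 < (z$3)^2"
        using hyp_planeD(1)[OF that] by (simp add: mink_def power2_eq_square)
      then have "sqrt ((z$1)^2 + (z$2)^2) < z$3"
        using hyp_planeD(2)[OF that] by (metis abs_of_pos real_sqrt_abs real_sqrt_less_iff)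
      then show ?thesis by (simp add: norm_vec_def L2_set_def sum_2)
    qed
    let ?x = "vector [x$1, x$2] :: real^2" and ?y = "vector [y$1, y$2] :: real^2"
    have "x$1 * y$1 + x$2 * y$2 = ?x \<bullet> ?y" by (simp add: inner_vec_def sum_2)
    also have "\<dots> \<le> norm ?x * norm ?y" by (rule norm_cauchy_schwarz)
    also have "\<dots> < x$3 * y$3"
      using *[OF assms(1)] *[OF assms(2)] by (intro mult_strict_mono') auto
    finally show ?thesis by (simp add: mink_def)
  qed
  ultimately show ?thesis
    by (smt (verit) power2_eq_square mult_minus_left mult_minus_right mult_less_cancel_left2 abs_square_less_1)
qed

text \<open>Selects the sheet of the hyperboloid by the product with one known point, which replaces
  a computation of the third coordinate.\<close>

lemma hyp_planeI:
  assumes "mink x x = -1" "mink x y < 0" "y \<in> hyp_plane"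
  shows "x \<in> hyp_plane"
proof (rule ccontr)
  assume "x \<notin> hyp_plane"
  then have "x$3 \<le> 0" using assms by (auto simp: hyp_plane_def)
  moreover have "x$3 \<noteq> 0"
  proof
    assume "x$3 = 0"
    then have "mink x x = (x$1)\<^sup>2 + (x$2)\<^sup>2" by (simp add: mink_def power2_eq_square)
    then show False using assms(1) by (smt (verit) sum_power2_ge_zero)
  qed
  ultimately have "- x \<in> hyp_plane" using assms by (simp add: hyp_plane_def)
  from mink_hyp_plane_le[OF this assms(3)] assms(2) show False by simp
qed

lemma mink_eq_imp_eq:
  assumes "mink x x = -1" "mink y y = -1" "mink x y = -1"
  shows "x = y"
proof -
  have "mink (x - y) y = 0" "mink (x - y) (x - y) = 0" using assms by (simp_all add: mink_commute)
  moreover have "mink y y < 0" using assms by simp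
  ultimately have "x - y = 0" by (intro mink_perp_pos(2))
  then show ?thesis by simp
qed

lemma cosh_hdist:
  assumes "x \<in> hyp_plane" "y \<in> hyp_plane"
  shows "cosh (hdist x y) = - mink x y"
  using mink_hyp_plane_le[OF assms] by (simp add: hdist_def)

lemma hdist_nonneg: "x \<in> hyp_plane \<Longrightarrow> y \<in> hyp_plane \<Longrightarrow> hdist x y \<ge> 0"
  using mink_hyp_plane_le[of x y] by (simp add: hdist_def arcosh_nonneg_real)

lemma hdist_eqI:
  assumes "- mink x y = cosh d" "d \<ge> 0"
  shows "hdist x y = d"
  using assms by (simp add: hdist_def arcosh_cosh_real)

lemma hdist_commute: "hdist x y = hdist y x"
  by (simp add: hdist_def mink_commute)

lemma hdist_self [simp]: "x \<in> hyp_plane \<Longrightarrow> hdist x x = 0"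
  by (simp add: hdist_def hyp_planeD)

lemma hdist_eq_0_iff:
  assumes "x \<in> hyp_plane" "y \<in> hyp_plane"
  shows "hdist x y = 0 \<longleftrightarrow> x = y"
  using cosh_hdist[OF assms] mink_eq_imp_eq[of x y] assms by (auto simp: hyp_planeD)

lemma sinh_hdist_sq:
  assumes "x \<in> hyp_plane" "y \<in> hyp_plane"
  shows "(sinh (hdist x y))\<^sup>2 = (mink x y)\<^sup>2 - 1"
  using cosh_hdist[OF assms] by (simp add: sinh_square_eq)

text \<open>\<open>?u\<close> and \<open>?v\<close> are the components orthogonal to
  \<open>y\<close>, of lengths \<open>sinh ?A\<close> and \<open>sinh ?B\<close>. Cauchy-Schwarz for
  them is the law of cosines with the cosine of the angle bounded by 1; the extreme case is the
  addition formula for \<open>cosh\<close>.\<close>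

lemma hdist_triangle:
  assumes x: "x \<in> hyp_plane" and y: "y \<in> hyp_plane" and z: "z \<in> hyp_plane"
  shows "hdist x z \<le> hdist x y + hdist y z"
proof -
  let ?u = "x + mink x y *\<^sub>R y" and ?v = "z + mink y z *\<^sub>R y"
  let ?A = "hdist x y" and ?B = "hdist y z"
  have yy: "mink y y < 0" using y by (simp add: hyp_planeD)
  have "mink ?u y = 0" "mink ?v y = 0" using y by (simp_all add: hyp_planeD mink_commute)
  from mink_perp_Cauchy_Schwarz[OF yy this]
  have cs: "(mink ?u ?v)\<^sup>2 \<le> mink ?u ?u * mink ?v ?v" .
  have uu: "mink ?u ?u = (sinh ?A)\<^sup>2" "mink ?v ?v = (sinh ?B)\<^sup>2"
    using x y z unfolding sinh_hdist_sq[OF x y] sinh_hdist_sq[OF y z]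
    by (simp_all add: hyp_planeD power2_eq_square algebra_simps mink_commute)
  have nn: "sinh ?A \<ge> 0" "sinh ?B \<ge> 0" using x y z by (simp_all add: hdist_nonneg)
  have "\<bar>mink ?u ?v\<bar> \<le> sinh ?A * sinh ?B"
    using cs nn unfolding uu by (metis abs_le_square_iff abs_of_nonneg mult_nonneg_nonneg power_mult_distrib)
  moreover have "mink ?u ?v = mink x z + mink x y * mink y z"
    using y by (simp add: hyp_planeD algebra_simps mink_commute)
  ultimately have "- mink x z \<le> mink x y * mink y z + sinh ?A * sinh ?B" by linarith
  then have "cosh (hdist x z) \<le> cosh (?A + ?B)"
    using cosh_hdist x y z by (simp add: cosh_add)
  then show ?thesis using x y z by (simp add: hdist_nonneg cosh_real_nonneg_le_iff)
qed

lemma geo_0 [simp]: "geo p v 0 = p"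
  by (simp add: geo_def)

lemma mink_geo_geo:
  assumes "mink p p = -1" "mink v v = 1" "mink p v = 0"
  shows "mink (geo p v s) (geo p v t) = - cosh (s - t)"
  using assms by (simp add: geo_def cosh_diff algebra_simps mink_commute[of v p])

lemma geo_in_hyp_plane:
  assumes "p \<in> hyp_plane" "mink v v = 1" "mink p v = 0"
  shows "geo p v s \<in> hyp_plane"
proof (rule hyp_planeI[OF _ _ assms(1)])
  have pp: "mink p p = -1" using assms by (simp add: hyp_planeD)
  show "mink (geo p v s) (geo p v s) = -1" using mink_geo_geo[OF pp assms(2,3), of s s] by simp
  have "mink (geo p v s) p = - cosh s" using mink_geo_geo[OF pp assms(2,3), of s 0] by simp
  then show "mink (geo p v s) p < 0" by (simp add: cosh_real_pos)
qed

lemma hdist_geo_geo: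
  assumes "mink p p = -1" "mink v v = 1" "mink p v = 0"
  shows "hdist (geo p v s) (geo p v t) = \<bar>s - t\<bar>"
  using assms by (intro hdist_eqI) (simp_all add: mink_geo_geo)

lemma mink_geo: "mink (geo p v s) x = cosh s * mink p x + sinh s * mink v x"
  by (simp add: geo_def)

text \<open>The linear system for the two differences has determinant \<open>sinh (s - t)\<close> up
  to sign. Used wherever two local descriptions of one arc have to be matched.\<close>

lemma geo_eqD:
  assumes "geo p v s = geo p' v' s" "geo p v t = geo p' v' t" "s \<noteq> t"
  shows "p = p'" "v = v'"
proof -
  let ?a = "p - p'" and ?b = "v - v'"
  have s: "cosh s *\<^sub>R ?a + sinh s *\<^sub>R ?b = 0" and t: "cosh t *\<^sub>R ?a + sinh t *\<^sub>R ?b = 0"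
    using assms by (simp_all add: geo_def algebra_simps)
  have "sinh (s - t) *\<^sub>R ?a
     = cosh s *\<^sub>R 0 + (sinh s * cosh t) *\<^sub>R ?a - (cosh s * sinh t) *\<^sub>R ?a"
    by (simp add: sinh_diff scaleR_diff_left)
  also have "\<dots> = sinh s *\<^sub>R (cosh t *\<^sub>R ?a + sinh t *\<^sub>R ?b) - sinh t *\<^sub>R (cosh s *\<^sub>R ?a + sinh s *\<^sub>R ?b)"
    by (simp add: algebra_simps)
  finally have "sinh (s - t) *\<^sub>R ?a = 0" using s t by simp
  then show p: "p = p'" using assms(3) by simp
  show "v = v'"
  proof (cases "s = 0")
    case True
    then have "sinh t \<noteq> 0" using assms(3) by simp
    then show ?thesis using t p by simp
  next
    case False
    then show ?thesis using s p by simp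
  qed
qed

text \<open>\<open>p\<close> and \<open>v\<close> solve the equations at \<open>a\<close> and
  \<open>b\<close>; the remaining values are then forced. As \<open>S\<close> is any set with two
  points, the lemma serves for intervals and for triples of points alike.\<close>

lemma isometric_imp_geo:
  assumes iso: "\<And>s t. s \<in> S \<Longrightarrow> t \<in> S \<Longrightarrow> hdist (g s) (g t) = \<bar>s - t\<bar>"
    and H: "\<And>s. s \<in> S \<Longrightarrow> g s \<in> hyp_plane"
    and ab: "a \<in> S" "b \<in> S" "a < b"
  obtains p v where "mink p p = -1" "mink v v = 1" "mink p v = 0"
    "\<And>s. s \<in> S \<Longrightarrow> g s = geo p v s"
proof -
  have m: "mink (g s) (g t) = - cosh (s - t)" if "s \<in> S" "t \<in> S" for s t
    using cosh_hdist[OF H H, of s t] iso[of s t] that by simp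
  define D where "D = sinh (b - a)"
  have D: "D > 0" using ab by (simp add: D_def)
  have D': "D = sinh b * cosh a - cosh b * sinh a" by (simp add: D_def sinh_diff)
  define p where "p = (1 / D) *\<^sub>R (sinh b *\<^sub>R g a - sinh a *\<^sub>R g b)"
  define v where "v = (1 / D) *\<^sub>R (cosh a *\<^sub>R g b - cosh b *\<^sub>R g a)"
  have gab: "mink (g a) (g a) = -1" "mink (g b) (g b) = -1"
    "mink (g a) (g b) = - (cosh a * cosh b - sinh a * sinh b)"
    "mink (g b) (g a) = - (cosh a * cosh b - sinh a * sinh b)"
    using m[of a a] m[of b b] m[of a b] m[of b a] ab by (simp_all add: cosh_diff)
  have ca: "cosh a * cosh a = 1 + sinh a * sinh a" and cb: "cosh b * cosh b = 1 + sinh b * sinh b"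
    using cosh_square_eq[of a] cosh_square_eq[of b] by (simp_all add: power2_eq_square)
  have DD: "D * D = sinh b * sinh b + sinh a * sinh a + 2 * (sinh a * sinh a * sinh b * sinh b)
       - 2 * sinh a * sinh b * cosh a * cosh b"
    unfolding D' using ca cb by algebra
  have "D * D * mink p p = - (D * D)"
  proof -
    have "D * D * mink p p = mink (D *\<^sub>R p) (D *\<^sub>R p)" by simp
    also have "D *\<^sub>R p = sinh b *\<^sub>R g a - sinh a *\<^sub>R g b" using D by (simp add: p_def)
    also have "mink \<dots> \<dots> = sinh b * sinh b * mink (g a) (g a) + sinh a * sinh a * mink (g b) (g b)
        - sinh a * sinh b * mink (g a) (g b) - sinh a * sinh b * mink (g b) (g a)"
      by (simp add: algebra_simps)
    also have "\<dots> = - (D * D)" unfolding DD gab by algebra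
    finally show ?thesis .
  qed
  then have pp: "mink p p = -1" using D mult_left_cancel[of "D * D" "mink p p" "-1"] by simp
  have "D * D * mink v v = D * D"
  proof -
    have "D * D * mink v v = mink (D *\<^sub>R v) (D *\<^sub>R v)" by simp
    also have "D *\<^sub>R v = cosh a *\<^sub>R g b - cosh b *\<^sub>R g a" using D by (simp add: v_def)
    also have "mink \<dots> \<dots> = cosh a * cosh a * mink (g b) (g b) + cosh b * cosh b * mink (g a) (g a)
        - cosh a * cosh b * mink (g a) (g b) - cosh a * cosh b * mink (g b) (g a)"
      by (simp add: algebra_simps)
    also have "\<dots> = D * D" unfolding DD gab using ca cb by algebra
    finally show ?thesis .
  qed
  then have vv: "mink v v = 1" using D mult_left_cancel[of "D * D" "mink v v" "1"] by simp
  have "D * D * mink p v = 0"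
  proof -
    have "D * D * mink p v = mink (D *\<^sub>R p) (D *\<^sub>R v)" by simp
    also have "D *\<^sub>R v = cosh a *\<^sub>R g b - cosh b *\<^sub>R g a" using D by (simp add: v_def)
    also have "D *\<^sub>R p = sinh b *\<^sub>R g a - sinh a *\<^sub>R g b" using D by (simp add: p_def)
    also have "mink (sinh b *\<^sub>R g a - sinh a *\<^sub>R g b) (cosh a *\<^sub>R g b - cosh b *\<^sub>R g a)
       = sinh b * cosh a * mink (g a) (g b) - sinh b * cosh b * mink (g a) (g a)
         - sinh a * cosh a * mink (g b) (g b) + sinh a * cosh b * mink (g b) (g a)"
      by (simp add: algebra_simps)
    also have "\<dots> = 0" unfolding gab using ca cb by algebra
    finally show ?thesis .
  qed
  then have pv: "mink p v = 0" using D by simp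
  have "g s = geo p v s" if s: "s \<in> S" for s
  proof (rule mink_eq_imp_eq)
    show "mink (g s) (g s) = -1" using m[OF s s] by simp
    show "mink (geo p v s) (geo p v s) = -1" using mink_geo_geo[OF pp vv pv, of s s] by simp
    \<comment> \<open>Hyperbolic interpolation between the values at \<open>a\<close> and
      \<open>b\<close>. Paired with \<open>g s\<close> it gives \<open>- D\<close> by the addition
      formula for \<open>sinh\<close>.\<close>
    have "D *\<^sub>R geo p v s = sinh (b - s) *\<^sub>R g a + sinh (s - a) *\<^sub>R g b"
      using D by (simp add: geo_def p_def v_def sinh_diff algebra_simps)
    then have "D * mink (g s) (geo p v s) = sinh (b - s) * mink (g s) (g a) + sinh (s - a) * mink (g s) (g b)"
      by (metis mink_add(2) mink_scaleR(2))
    also have "\<dots> = - (sinh (b - s) * cosh (s - a) + sinh (s - a) * cosh (b - s))"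
      using m[OF s ab(1)] m[OF s ab(2)] cosh_minus[of "s - b"] by (simp add: algebra_simps)
    also have "sinh (b - s) * cosh (s - a) + sinh (s - a) * cosh (b - s) = D"
      unfolding D_def using sinh_add[of "b - s" "s - a"] by (simp add: algebra_simps)
    finally show "mink (g s) (geo p v s) = -1"
      using D mult_left_cancel[of D "mink (g s) (geo p v s)" "-1"] by simp
  qed
  then show thesis using that pp vv pv by blast
qed

lemma mink_reflect:
  assumes "mink n n = 1"
  shows "mink (reflect n x) (reflect n y) = mink x y"
  using assms by (simp add: reflect_def algebra_simps mink_commute[of n x] mink_commute[of n y])

lemma mink_reflect_left:
  "mink (reflect n x) y = mink x (reflect n y)"
  by (simp add: reflect_def mink_commute[of n y])

lemma reflect_reflect [simp]:
  assumes "mink n n = 1"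
  shows "reflect n (reflect n x) = x"
  using assms by (simp add: reflect_def algebra_simps)

lemma reflect_perp: "mink x n = 0 \<Longrightarrow> reflect n x = x"
  by (simp add: reflect_def)

lemma reflect_linear:
  "reflect n (x + y) = reflect n x + reflect n y" "reflect n (r *\<^sub>R x) = r *\<^sub>R reflect n x"
  by (simp_all add: reflect_def algebra_simps)

lemma reflect_geo: "reflect n (geo p v s) = geo (reflect n p) (reflect n v) s"
  by (simp add: geo_def reflect_linear)

lemma reflect_in_hyp_plane:
  assumes n: "mink n n = 1" and x: "x \<in> hyp_plane"
  shows "reflect n x \<in> hyp_plane"
proof (rule hyp_planeI[OF _ _ x])
  show "mink (reflect n x) (reflect n x) = -1" using mink_reflect[OF n] x by (simp add: hyp_planeD)
  show "mink (reflect n x) x < 0"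
  proof -
    have "mink (reflect n x) x = - 1 - 2 * (mink x n * mink x n)"
      using x by (simp add: reflect_def hyp_planeD mink_commute[of n x])
    then show ?thesis using zero_le_square[of "mink x n"] by linarith
  qed
qed

lemma hdist_reflect:
  assumes "mink n n = 1"
  shows "hdist (reflect n x) (reflect n y) = hdist x y"
  using mink_reflect[OF assms] by (simp add: hdist_def)

text \<open>The Gram matrix of three vectors determines their determinant up to sign.\<close>
lemma mink_perp_basis_eq_0:
  assumes wa: "mink w a = 0" and wb: "mink w b = 0" and wc: "mink w c = 0"
    and G: "mink a a * (mink b b * mink c c - mink b c * mink b c)
      - mink a b * (mink a b * mink c c - mink b c * mink a c)
      + mink a c * (mink a b * mink b c - mink b b * mink a c) \<noteq> 0"
  shows "w = 0"
proof -
  \<comment> \<open>The Euclidean determinant of \<open>a\<close>, \<open>b\<close>,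
    \<open>c\<close>. The Gram determinant is \<open>- (d * d)\<close> because the form has one
    negative sign; the three identities below are Cramer's rule.\<close>
  define d where "d = a$1 * (b$2 * c$3 - b$3 * c$2) - a$2 * (b$1 * c$3 - b$3 * c$1) + a$3 * (b$1 * c$2 - b$2 * c$1)"
  have "mink a a * (mink b b * mink c c - mink b c * mink b c)
      - mink a b * (mink a b * mink c c - mink b c * mink a c)
      + mink a c * (mink a b * mink b c - mink b b * mink a c) = - (d * d)"
    unfolding d_def mink_def by algebra
  then have d: "d \<noteq> 0" using G by auto
  have "d * w$1 = mink w a * (b$2 * c$3 - b$3 * c$2) - mink w b * (a$2 * c$3 - a$3 * c$2) + mink w c * (a$2 * b$3 - a$3 * b$2)"
    unfolding d_def mink_def by algebra
  then have w1: "w$1 = 0" using wa wb wc d by simp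
  have "d * w$2 = - mink w a * (b$1 * c$3 - b$3 * c$1) + mink w b * (a$1 * c$3 - a$3 * c$1) - mink w c * (a$1 * b$3 - a$3 * b$1)"
    unfolding d_def mink_def by algebra
  then have w2: "w$2 = 0" using wa wb wc d by simp
  have "d * w$3 = - mink w a * (b$1 * c$2 - b$2 * c$1) + mink w b * (a$1 * c$2 - a$2 * c$1) - mink w c * (a$1 * b$2 - a$2 * b$1)"
    unfolding d_def mink_def by algebra
  then have w3: "w$3 = 0" using wa wb wc d by simp
  show ?thesis using w1 w2 w3 by (intro vec3_eqI) auto
qed

lemma mink_orthonormal_expansion:
  assumes "mink p p = -1" "mink u u = 1" "mink v v = 1" "mink p u = 0" "mink p v = 0" "mink u v = 0"
  shows "x = - mink x p *\<^sub>R p + mink x u *\<^sub>R u + mink x v *\<^sub>R v"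
proof -
  let ?w = "x - (- mink x p *\<^sub>R p + mink x u *\<^sub>R u + mink x v *\<^sub>R v)"
  have "?w = 0"
    using assms by (intro mink_perp_basis_eq_0[of _ p u v]) (simp_all add: mink_commute[of u p] mink_commute[of v p] mink_commute[of v u])
  then show ?thesis by simp
qed

section \<open>Right-angled hexagons and the reflections in their sides\<close>

text \<open>\<open>p\<close> and \<open>q\<close> are the ends of the side with normal
  \<open>B\<close>. In the frame \<open>q\<close>, \<open>C\<close>, \<open>B\<close> the vector
  \<open>A\<close> has no \<open>B\<close>-component, so its square gives
  \<open>(mink A C)\<^sup>2 = 1 + (mink A q)\<^sup>2\<close>; pairing with \<open>p\<close> decides
  the sign.\<close>

lemma mink_opposite_perps:
  assumes unit: "mink A A = 1" "mink B B = 1" "mink C C = 1" and perp: "mink A B = 0" "mink B C = 0"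
    and p: "p \<in> hyp_plane" "mink p A = 0" "mink p B = 0" "mink p C < 0"
    and q: "q \<in> hyp_plane" "mink q B = 0" "mink q C = 0" "mink q A < 0"
  shows "mink A C < -1"
proof -
  have A: "A = - mink A q *\<^sub>R q + mink A C *\<^sub>R C"
    using mink_orthonormal_expansion[of q C B A] unit perp q
    by (simp add: hyp_planeD mink_commute[of C B])
  have Aq: "mink A q < 0" using q(4) by (simp add: mink_commute[of A q])
  have "1 = mink A (- mink A q *\<^sub>R q + mink A C *\<^sub>R C)" using A unit by metis
  then have sq: "(mink A C)\<^sup>2 = 1 + (mink A q)\<^sup>2" by (simp add: power2_eq_square)
  have "0 = mink p (- mink A q *\<^sub>R q + mink A C *\<^sub>R C)" using A p by metis
  then have "mink A C * mink p C = mink A q * mink p q" by simp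
  moreover have "mink A q * mink p q > 0"
    using Aq mink_hyp_plane_le[OF p(1) q(1)] by (intro mult_neg_neg) auto
  ultimately have "mink A C * mink p C > 0" by simp
  then have neg: "mink A C < 0" using p(4) by (smt (verit) mult_nonneg_nonpos)
  have "(mink A q)\<^sup>2 > 0" using Aq by simp
  then have "1 < \<bar>mink A C\<bar>\<^sup>2" using sq by simp
  then have "1 < \<bar>mink A C\<bar>" by (metis abs_ge_zero linorder_not_le power_le_one)
  then show ?thesis using neg by simp
qed

text \<open>\<open>A\<close> and \<open>C\<close> span the complement of \<open>B\<close>; the
  coefficients solve the system with their Gram matrix, whose determinant is
  \<open>1 - a\<^sup>2\<close>.\<close>

lemma mink_perp_pair_expansion:
  assumes unit: "mink A A = 1" "mink B B = 1" "mink C C = 1" and perp: "mink A B = 0" "mink B C = 0"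
    and AC: "mink A C = - a" "a > 1"
  shows "X = mink X B *\<^sub>R B - ((mink X C + a * mink X A) / (a\<^sup>2 - 1)) *\<^sub>R C
           - ((mink X A + a * mink X C) / (a\<^sup>2 - 1)) *\<^sub>R A"
proof -
  have a: "a\<^sup>2 - 1 > 0" using AC(2) by (simp add: power2_eq_square less_1_mult)
  let ?y = "(mink X A + a * mink X C) / (a\<^sup>2 - 1)" and ?x = "(mink X C + a * mink X A) / (a\<^sup>2 - 1)"
  let ?w = "X - (mink X B *\<^sub>R B - ?x *\<^sub>R C - ?y *\<^sub>R A)"
  have c: "mink B A = 0" "mink C B = 0" "mink C A = - a" using perp AC by (simp_all add: mink_commute)
  have "a * ?x - ?y = (a * (mink X C + a * mink X A) - (mink X A + a * mink X C)) / (a\<^sup>2 - 1)"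
    by (simp add: diff_divide_distrib)
  also have "a * (mink X C + a * mink X A) - (mink X A + a * mink X C) = (a\<^sup>2 - 1) * mink X A"
    by (simp add: algebra_simps power2_eq_square)
  finally have 1: "a * ?x - ?y = mink X A" using a by simp
  have "a * ?y - ?x = (a * (mink X A + a * mink X C) - (mink X C + a * mink X A)) / (a\<^sup>2 - 1)"
    by (simp add: diff_divide_distrib)
  also have "a * (mink X A + a * mink X C) - (mink X C + a * mink X A) = (a\<^sup>2 - 1) * mink X C"
    by (simp add: algebra_simps power2_eq_square)
  finally have 2: "a * ?y - ?x = mink X C" using a by simp
  have "?w = 0"
  proof (rule mink_perp_basis_eq_0[of _ A B C])
    have "mink ?w A = mink X A - (a * ?x - ?y)" using unit c by simp
    then show "mink ?w A = 0" unfolding 1 by simp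
    have "mink ?w C = mink X C - (a * ?y - ?x)" using unit perp AC by simp
    then show "mink ?w C = 0" unfolding 2 by simp
    show "mink ?w B = 0" using unit perp c by simp
  next
    show "mink A A * (mink B B * mink C C - mink B C * mink B C)
      - mink A B * (mink A B * mink C C - mink B C * mink A C)
      + mink A C * (mink A B * mink B C - mink B B * mink A C) \<noteq> 0"
      using unit perp AC a by (simp add: power2_eq_square)
  qed
  then show ?thesis by simp
qed

text \<open>In the expansion of \<open>X\<close> the coefficients \<open>x\<close> and
  \<open>y\<close> are positive. The point \<open>r\<close>, on the line of \<open>X\<close> and
  inside the other half-planes, forces \<open>z < 0\<close>, and the square of \<open>X\<close>
  forces the absolute value of \<open>z\<close> above 1.\<close>

lemma mink_common_perp_opposite:
  assumes unit: "mink A A = 1" "mink B B = 1" "mink C C = 1" "mink X X = 1" and perp: "mink A B = 0" "mink B C = 0"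
    and neg: "mink A C < -1" "mink X A < -1" "mink X C < -1"
    and r: "mink r X = 0" "mink r A < 0" "mink r B < 0" "mink r C < 0"
  shows "mink X B < -1"
proof -
  define a where "a = - mink A C"
  define x where "x = - (mink X C + a * mink X A) / (a\<^sup>2 - 1)"
  define y where "y = - (mink X A + a * mink X C) / (a\<^sup>2 - 1)"
  define z where "z = mink X B"
  have a1: "a > 1" using neg by (simp add: a_def)
  have a: "a > 1" "a\<^sup>2 - 1 > 0" using a1 less_1_mult[OF a1 a1] by (simp_all add: power2_eq_square)
  have am: "a * mink X A < 0" "a * mink X C < 0"
    using a neg by (auto intro!: mult_pos_neg)
  have xy: "x > 0" "y > 0" using a am neg by (auto simp: x_def y_def divide_less_0_iff intro!: divide_neg_pos)
  have "(mink X C + a * mink X A) / (a\<^sup>2 - 1) = - x" "(mink X A + a * mink X C) / (a\<^sup>2 - 1) = - y"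
    by (simp_all add: x_def y_def minus_divide_left)
  then have X: "X = z *\<^sub>R B + x *\<^sub>R C + y *\<^sub>R A"
    using mink_perp_pair_expansion[OF unit(1-3) perp, of a X] a1 by (simp add: a_def z_def)
  have "0 = mink r (z *\<^sub>R B + x *\<^sub>R C + y *\<^sub>R A)" using X r by metis
  then have "z * mink r B = - (x * mink r C) - y * mink r A" by simp
  moreover have "x * mink r C < 0" "y * mink r A < 0" using xy r by (auto intro: mult_pos_neg)
  ultimately have "z * mink r B > 0" by linarith
  then have z0: "z < 0" using r by (simp add: zero_less_mult_iff)
  have "1 = mink X (z *\<^sub>R B + x *\<^sub>R C + y *\<^sub>R A)" using X unit by metis
  then have "z\<^sup>2 = 1 - x * mink X C - y * mink X A" by (simp add: z_def power2_eq_square)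
  moreover have "x * mink X C < 0" "y * mink X A < 0" using xy neg by (auto intro!: mult_pos_neg)
  ultimately have "1 < \<bar>z\<bar>\<^sup>2" by simp
  then have "1 < \<bar>z\<bar>" by (metis abs_ge_zero linorder_not_le power_le_one)
  then show ?thesis using z0 by (simp add: z_def)
qed

text \<open>A side, parametrised from its vertex \<open>p\<close>; \<open>A\<close> and \<open>C\<close> are the normals of the two adjacent sides.\<close>
lemma side_parametrisation:
  assumes unit: "mink A A = 1" "mink B B = 1" "mink C C = 1" and perp: "mink A B = 0" "mink B C = 0"
    and p: "p \<in> hyp_plane" "mink p A = 0" "mink p B = 0" "mink p C < 0"
    and L: "mink A C = - cosh L" "L > 0"
  shows "geo p (- A) s \<in> hyp_plane" "mink (geo p (- A) s) B = 0"
    "mink (geo p (- A) s) A = - sinh s" "mink (geo p (- A) s) C = sinh (s - L)"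
    "x \<in> hyp_plane \<Longrightarrow> mink x B = 0 \<Longrightarrow> mink x A \<le> 0 \<Longrightarrow> mink x C \<le> 0 \<Longrightarrow>
      \<exists>s\<in>{0..L}. x = geo p (- A) s"
proof -
  have exp: "y = - mink y p *\<^sub>R p + mink y A *\<^sub>R A" if "mink y B = 0" for y
    using mink_orthonormal_expansion[of p A B y] unit perp p that by (simp add: hyp_planeD)
  have sq: "(mink y p)\<^sup>2 = (mink y A)\<^sup>2 - mink y y" if "mink y B = 0" for y
  proof -
    have "mink y y = mink y (- mink y p *\<^sub>R p + mink y A *\<^sub>R A)" using exp[OF that] by metis
    then show ?thesis by (simp add: power2_eq_square)
  qed
  have "(mink C p)\<^sup>2 = (cosh L)\<^sup>2 - 1"
    using sq[of C] perp unit L by (simp add: mink_commute[of C B] mink_commute[of C A])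
  also have "\<dots> = (sinh L)\<^sup>2" by (simp add: sinh_square_eq)
  finally have "\<bar>mink p C\<bar> = \<bar>sinh L\<bar>" by (simp add: power2_eq_iff mink_commute[of C p] abs_eq_iff)
  then have pC: "mink p C = - sinh L" using p(4) L by simp
  show "geo p (- A) s \<in> hyp_plane" using p unit by (intro geo_in_hyp_plane) auto
  show "mink (geo p (- A) s) B = 0" using p perp by (simp add: mink_geo)
  show "mink (geo p (- A) s) A = - sinh s" using p unit by (simp add: mink_geo)
  have gC: "mink (geo p (- A) s) C = sinh (s - L)" for s
    using pC L by (simp add: mink_geo sinh_diff)
  then show "mink (geo p (- A) s) C = sinh (s - L)" .
  assume x: "x \<in> hyp_plane" "mink x B = 0" "mink x A \<le> 0" "mink x C \<le> 0"
  define s where "s = arsinh (- mink x A)"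
  have s1: "sinh s = - mink x A" by (simp add: s_def)
  then have "sinh s \<ge> 0" using x(3) by linarith
  then have "s \<ge> 0" by (simp only: sinh_real_nonneg_iff)
  with s1 have s: "sinh s = - mink x A" "s \<ge> 0" by blast+
  have "(cosh s)\<^sup>2 = (mink x p)\<^sup>2" using sq[OF x(2)] x s(1) by (simp add: cosh_square_eq hyp_planeD)
  then have "\<bar>mink x p\<bar> = \<bar>cosh s\<bar>" by (metis power2_abs power2_eq_iff_nonneg abs_ge_zero)
  then have "mink x p = - cosh s" using mink_hyp_plane_le[OF x(1) p(1)] by simp
  then have xs: "x = geo p (- A) s" using exp[OF x(2)] s by (simp add: geo_def)
  then have "sinh (s - L) \<le> 0" using x(4) gC by simp
  then show "\<exists>s\<in>{0..L}. x = geo p (- A) s" using s xs by auto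
qed

text \<open>Half-planes are convex: the point at \<open>t\<close> is a combination of the two ends
  with the nonnegative weights \<open>sinh (b - t)\<close> and \<open>sinh (t - a)\<close>, divided
  by \<open>sinh (b - a)\<close>.\<close>

lemma mink_le_0_between:
  assumes "mink (geo p v a) m \<le> 0" "mink (geo p v b) m \<le> 0" "a \<le> t" "t \<le> b"
  shows "mink (geo p v t) m \<le> 0"
proof (cases "a = b")
  case True then show ?thesis using assms by simp
next
  case False
  then have ab: "sinh (b - a) > 0" using assms by simp
  have i1: "cosh t * sinh (b - a) = sinh (b - t) * cosh a + sinh (t - a) * cosh b"
    and i2: "sinh t * sinh (b - a) = sinh (b - t) * sinh a + sinh (t - a) * sinh b"
    unfolding sinh_diff by (simp_all add: algebra_simps)
  have "sinh (b - a) * mink (geo p v t) m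
    = (cosh t * sinh (b - a)) * mink p m + (sinh t * sinh (b - a)) * mink v m"
    by (simp add: mink_geo algebra_simps)
  also have "\<dots> = sinh (b - t) * mink (geo p v a) m + sinh (t - a) * mink (geo p v b) m"
    unfolding i1 i2 by (simp add: mink_geo algebra_simps)
  also have "\<dots> \<le> 0" using assms
    by (intro add_nonpos_nonpos mult_nonneg_nonpos) auto
  finally show ?thesis using ab by (simp add: mult_le_0_iff)
qed

lemma geo_joining:
  assumes x: "x \<in> hyp_plane" and y: "y \<in> hyp_plane" and "x \<noteq> y"
  obtains v where "mink v v = 1" "mink x v = 0" "geo x v (hdist x y) = y" "hdist x y > 0"
proof -
  let ?d = "hdist x y"
  have d: "?d > 0" using hdist_eq_0_iff[OF x y] hdist_nonneg[OF x y] assms by simp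
  define v where "v = (1 / sinh ?d) *\<^sub>R (y + mink x y *\<^sub>R x)"
  have sd: "sinh ?d > 0" using d by simp
  have sv: "sinh ?d *\<^sub>R v = y + mink x y *\<^sub>R x" using sd by (simp add: v_def)
  have "(sinh ?d)\<^sup>2 * mink v v = mink (sinh ?d *\<^sub>R v) (sinh ?d *\<^sub>R v)" by (simp add: power2_eq_square)
  also have "\<dots> = (sinh ?d)\<^sup>2 * 1"
    unfolding sv sinh_hdist_sq[OF x y] using x y
    by (simp add: hyp_planeD algebra_simps power2_eq_square mink_commute[of y x])
  finally have "mink v v = 1" using sd by simp
  moreover have "mink x v = 0" using x by (simp add: v_def hyp_planeD)
  moreover have "geo x v ?d = y" using cosh_hdist[OF x y] sv by (simp add: geo_def)
  ultimately show thesis using d by (intro that)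
qed

text \<open>\<open>u\<close> and \<open>v\<close> lie in the tangent plane at \<open>x\<close>,
  where Cauchy-Schwarz holds. Read contrapositively, lines whose normals have product below -1 do
  not meet.\<close>

lemma disjoint_geodesics:
  assumes "x \<in> hyp_plane" "mink x u = 0" "mink x v = 0" "mink u u = 1" "mink v v = 1"
  shows "\<bar>mink u v\<bar> \<le> 1"
proof -
  have "(mink u v)\<^sup>2 \<le> 1"
    using mink_perp_Cauchy_Schwarz[of x u v] assms by (simp add: hyp_planeD mink_commute)
  then show ?thesis by (simp add: abs_square_le_1)
qed

text \<open>The even sides of the hexagon are its sides on the orthobasis, the odd ones lie on the boundary.\<close>
definition mirrors :: "nat set" where "mirrors = {0, 2, 4}"
definition cuffs :: "nat set" where "cuffs = {1, 3, 5}"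
abbreviation opp :: "nat \<Rightarrow> nat" where "opp i \<equiv> (i + 3) mod 6"

lemma mirrors_lt_6: "s \<in> mirrors \<Longrightarrow> s < 6" and cuffs_lt_6: "j \<in> cuffs \<Longrightarrow> j < 6"
  and mirror_neq_cuff: "s \<in> mirrors \<Longrightarrow> j \<in> cuffs \<Longrightarrow> s \<noteq> j"
  by (auto simp: mirrors_def cuffs_def)

locale hexagon =
  fixes n :: "nat \<Rightarrow> real^3"
  assumes hexagon: "right_angled_hexagon n"
begin

abbreviation "H \<equiv> hex_region n"

definition vtx :: "nat \<Rightarrow> real^3" where
  "vtx i = (SOME p. p \<in> hyp_plane \<and> mink p (n i) = 0 \<and> mink p (n (Suc i mod 6)) = 0 \<and>
           (\<forall>j<6. j \<noteq> i \<and> j \<noteq> Suc i mod 6 \<longrightarrow> mink p (n j) < 0))"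

lemma unit: "i < 6 \<Longrightarrow> mink (n i) (n i) = 1"
  and adjacent: "i < 6 \<Longrightarrow> mink (n i) (n (Suc i mod 6)) = 0"
  using hexagon by (auto simp: right_angled_hexagon_def Let_def)

lemma vtx:
  assumes "i < 6"
  shows "vtx i \<in> hyp_plane" "mink (vtx i) (n i) = 0" "mink (vtx i) (n (Suc i mod 6)) = 0"
    "j < 6 \<Longrightarrow> j \<noteq> i \<Longrightarrow> j \<noteq> Suc i mod 6 \<Longrightarrow> mink (vtx i) (n j) < 0"
proof -
  have "\<exists>p. p \<in> hyp_plane \<and> mink p (n i) = 0 \<and> mink p (n (Suc i mod 6)) = 0 \<and>
           (\<forall>j<6. j \<noteq> i \<and> j \<noteq> Suc i mod 6 \<longrightarrow> mink p (n j) < 0)"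
    using hexagon assms by (auto simp: right_angled_hexagon_def Let_def)
  from someI_ex[OF this]
  show "vtx i \<in> hyp_plane" "mink (vtx i) (n i) = 0" "mink (vtx i) (n (Suc i mod 6)) = 0"
    "j < 6 \<Longrightarrow> j \<noteq> i \<Longrightarrow> j \<noteq> Suc i mod 6 \<Longrightarrow> mink (vtx i) (n j) < 0"
    unfolding vtx_def by auto
qed

lemma less_6_cases: "i < 6 \<longleftrightarrow> i \<in> {0, 1, 2, 3, 4, 5::nat}"
  by auto

lemma two_apart:
  assumes "i < 6"
  shows "mink (n i) (n ((i + 2) mod 6)) < -1"
proof -
  have "\<exists>j<6. \<exists>k<6. j = Suc i mod 6 \<and> k = Suc j mod 6 \<and> k = (i + 2) mod 6 \<and> k \<noteq> i \<and> k \<noteq> j \<and> i \<noteq> j"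
    using assms by (auto simp: less_6_cases)
  then obtain j k where jk: "j < 6" "k < 6" "j = Suc i mod 6" "k = Suc j mod 6" "k = (i + 2) mod 6"
    "k \<noteq> i" "k \<noteq> j" "i \<noteq> j" by blast
  show ?thesis unfolding jk(5)[symmetric]
    using jk(6-8)
    by (intro mink_opposite_perps[OF unit[OF assms] unit[OF jk(1)] unit[OF jk(2)], of "vtx i" "vtx j"]
      adjacent[OF assms, folded jk(3)] adjacent[OF jk(1), folded jk(4)] vtx(1)[OF assms] vtx(1)[OF jk(1)]
      vtx(2)[OF assms] vtx(2)[OF jk(1)] vtx(3)[OF assms, folded jk(3)] vtx(3)[OF jk(1), folded jk(4)]
      vtx(4)[OF assms jk(2), folded jk(3)] vtx(4)[OF jk(1) assms, folded jk(4)]) auto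
qed

text \<open>The two neighbours \<open>a\<close>, \<open>b\<close> of the opposite side
  \<open>c\<close> are each two steps from side \<open>i\<close> and from one another, so
  \<open>two_apart\<close> supplies all products needed; \<open>vtx i\<close> is the required point
  on side \<open>i\<close>.\<close>

lemma three_apart:
  assumes "i < 6"
  shows "mink (n i) (n (opp i)) < -1"
proof -
  define c where "c = opp i"
  define a b where "a = (i + 2) mod 6" and "b = (i + 4) mod 6"
  have "i \<in> {0, 1, 2, 3, 4, 5}" using assms by (simp only: less_6_cases)
  then have "a < 6 \<and> b < 6 \<and> c < 6 \<and> b = (a + 2) mod 6 \<and> c = Suc a mod 6 \<and>
     b = Suc c mod 6 \<and> i = (b + 2) mod 6 \<and>
     i \<noteq> a \<and> i \<noteq> b \<and> i \<noteq> c \<and> a \<noteq> c \<and> b \<noteq> c \<and> Suc i mod 6 \<notin> {a, b, c}"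
    unfolding a_def b_def c_def by (elim insertE emptyE) simp_all
  with a_def have abd: "a < 6" "b < 6" "c < 6" "b = (a + 2) mod 6" "c = Suc a mod 6"
     "b = Suc c mod 6" "i = (b + 2) mod 6" "a = (i + 2) mod 6" and
     ne: "i \<noteq> a" "i \<noteq> b" "i \<noteq> c" "a \<noteq> c" "b \<noteq> c" "Suc i mod 6 \<notin> {a, b, c}"
    by blast+
  have "mink (n i) (n c) < -1"
  proof (rule mink_common_perp_opposite[of "n a" "n c" "n b" "n i" "vtx i"])
    show "mink (n a) (n a) = 1" "mink (n c) (n c) = 1" "mink (n b) (n b) = 1" "mink (n i) (n i) = 1"
      by (intro unit abd assms)+
    show "mink (n a) (n c) = 0" "mink (n c) (n b) = 0"
      using adjacent[OF abd(1), folded abd(5)] adjacent[OF abd(3), folded abd(6)] by blast+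
    show "mink (n a) (n b) < - 1" using two_apart[OF abd(1), folded abd(4)] .
    show "mink (n i) (n a) < - 1" using two_apart[OF assms, folded abd(8)] .
    show "mink (n i) (n b) < - 1" using two_apart[OF abd(2), folded abd(7)] by (simp add: mink_commute[of "n i" "n b"])
    show "mink (vtx i) (n i) = 0" "mink (vtx i) (n a) < 0" "mink (vtx i) (n b) < 0" "mink (vtx i) (n c) < 0"
      using vtx(2)[OF assms] vtx(4)[OF assms abd(1)] vtx(4)[OF assms abd(2)] vtx(4)[OF assms abd(3)] ne by auto
  qed
  then show ?thesis by (simp add: c_def)
qed

lemma gram_opp: "i < 6 \<Longrightarrow> mink (n i) (n (opp i)) < -1"
  by (rule three_apart)

lemma gram_two_apart: "i < 6 \<Longrightarrow> k = (i + 2) mod 6 \<Longrightarrow> mink (n i) (n k) < -1 \<and> mink (n k) (n i) < -1"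
  using two_apart[of i] mink_commute[of "n k" "n i"] by simp

lemma gram_mirrors:
  assumes "s \<in> mirrors" "s' \<in> mirrors" "s \<noteq> s'"
  shows "mink (n s) (n s') < -1"
proof -
  have "mink (n 0) (n 2) < -1 \<and> mink (n 2) (n 0) < -1" "mink (n 2) (n 4) < -1 \<and> mink (n 4) (n 2) < -1"
    "mink (n 4) (n 0) < -1 \<and> mink (n 0) (n 4) < -1"
    by (rule gram_two_apart; simp)+
  then show ?thesis using assms by (auto simp: mirrors_def cuffs_def)
qed

lemma gram_cuffs:
  assumes "j \<in> cuffs" "j' \<in> cuffs" "j \<noteq> j'"
  shows "mink (n j) (n j') < -1"
proof -
  have "mink (n 1) (n 3) < -1 \<and> mink (n 3) (n 1) < -1" "mink (n 3) (n 5) < -1 \<and> mink (n 5) (n 3) < -1"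
    "mink (n 5) (n 1) < -1 \<and> mink (n 1) (n 5) < -1"
    by (rule gram_two_apart; simp)+
  then show ?thesis using assms by (auto simp: mirrors_def cuffs_def)
qed

lemma gram_adjacent':
  "i < 6 \<Longrightarrow> k = Suc i mod 6 \<Longrightarrow> mink (n i) (n k) = 0 \<and> mink (n k) (n i) = 0"
  using adjacent[of i] mink_commute[of "n k" "n i"] by simp

lemma gram_adjacent:
  assumes "s \<in> mirrors" "j \<in> cuffs" "j \<noteq> opp s"
  shows "mink (n s) (n j) = 0"
proof -
  have "mink (n 0) (n 1) = 0 \<and> mink (n 1) (n 0) = 0" "mink (n 1) (n 2) = 0 \<and> mink (n 2) (n 1) = 0"
    "mink (n 2) (n 3) = 0 \<and> mink (n 3) (n 2) = 0" "mink (n 3) (n 4) = 0 \<and> mink (n 4) (n 3) = 0"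
    "mink (n 4) (n 5) = 0 \<and> mink (n 5) (n 4) = 0" "mink (n 5) (n 0) = 0 \<and> mink (n 0) (n 5) = 0"
    by (rule gram_adjacent'; simp)+
  then show ?thesis using assms by (auto simp: mirrors_def cuffs_def)
qed

lemma gram_nonpos:
  assumes "i < 6" "j < 6" "i \<noteq> j"
  shows "mink (n i) (n j) \<le> 0"
proof -
  have "j = Suc i mod 6 \<or> i = Suc j mod 6 \<or> j = (i + 2) mod 6 \<or> i = (j + 2) mod 6 \<or> j = opp i"
    using assms by (auto simp: less_6_cases)
  then consider "Suc i mod 6 = j" | "Suc j mod 6 = i" | "(i + 2) mod 6 = j" | "(j + 2) mod 6 = i" | "opp i = j"
    by blast
  then show ?thesis
  proof cases
    case 1 then show ?thesis using adjacent[OF assms(1)] by simp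
  next
    case 2 then show ?thesis using adjacent[OF assms(2)] by (simp add: mink_commute[of "n i" "n j"])
  next
    case 3 then show ?thesis using two_apart[OF assms(1)] by simp
  next
    case 4 then show ?thesis using two_apart[OF assms(2)] by (simp add: mink_commute[of "n i" "n j"])
  next
    case 5 then show ?thesis using three_apart[OF assms(1)] by simp
  qed
qed

lemma H_D: "x \<in> H \<Longrightarrow> x \<in> hyp_plane" "x \<in> H \<Longrightarrow> i < 6 \<Longrightarrow> mink x (n i) \<le> 0"
  by (auto simp: hex_region_def)

lemma H_I: "x \<in> hyp_plane \<Longrightarrow> (\<And>i. i < 6 \<Longrightarrow> mink x (n i) \<le> 0) \<Longrightarrow> x \<in> H"
  by (auto simp: hex_region_def)

lemma vtx_in_H: "i < 6 \<Longrightarrow> vtx i \<in> H"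
  by (rule H_I) (use vtx in \<open>auto, metis less_le order_refl\<close>)

lemma H_geo_between:
  assumes "geo p v a \<in> H" "geo p v b \<in> H" "a \<le> t" "t \<le> b" "geo p v t \<in> hyp_plane"
  shows "geo p v t \<in> H"
  using assms mink_le_0_between[of p v a _ b t] by (intro H_I) (auto dest: H_D)

lemma nonadjacent_disjoint:
  assumes "x \<in> hyp_plane" "i < 6" "j < 6" "mink (n i) (n j) < -1" "mink x (n i) = 0"
  shows "mink x (n j) \<noteq> 0"
  using disjoint_geodesics[of x "n i" "n j"] assms unit by auto

text \<open>The correction is a product of two nonpositive numbers, so reflecting in a mirror pushes
  the hexagon further into every other half-plane.\<close>

lemma reflect_H_nonpos:
  assumes "y \<in> H" "s \<in> mirrors" "j < 6" "j \<noteq> s"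
  shows "mink (reflect (n s) y) (n j) \<le> mink y (n j)"
proof -
  have "s < 6" using assms by (simp add: mirrors_lt_6)
  then have "mink y (n s) * mink (n s) (n j) \<ge> 0"
    using assms by (intro mult_nonpos_nonpos gram_nonpos H_D) auto
  then show ?thesis by (simp add: reflect_def)
qed

text \<open>Indices are cyclic: \<open>(i + 5) mod 6\<close> is the side before \<open>i\<close>. A
  side is the common perpendicular of its two neighbours, so the product of their normals gives its
  length; side \<open>i\<close> runs from \<open>vtx ((i + 5) mod 6)\<close> to
  \<open>vtx i\<close>.\<close>

definition side_len :: "nat \<Rightarrow> real" where
  "side_len i = arcosh (- mink (n ((i + 5) mod 6)) (n (Suc i mod 6)))"

definition side_path :: "nat \<Rightarrow> real \<Rightarrow> real^3" where
  "side_path i = geo (vtx ((i + 5) mod 6)) (- n ((i + 5) mod 6))"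

text \<open>The last clause says that on the line of a side only the two neighbouring inequalities
  matter: they cut out the segment between two vertices, which lies in \<open>H\<close> by
  convexity.\<close>

lemma side_geometry:
  assumes i: "i < 6"
  shows "side_len i > 0" "cosh (side_len i) = - mink (n ((i + 5) mod 6)) (n (Suc i mod 6))"
    "hex_side n i = side_path i ` {0..side_len i}"
    "side_path i 0 = vtx ((i + 5) mod 6)" "side_path i (side_len i) = vtx i"
    "hdist (side_path i s) (side_path i t) = \<bar>s - t\<bar>"
    "x \<in> hyp_plane \<Longrightarrow> mink x (n i) = 0 \<Longrightarrow> mink x (n ((i + 5) mod 6)) \<le> 0 \<Longrightarrow> mink x (n (Suc i mod 6)) \<le> 0 \<Longrightarrow> x \<in> H"
proof -
  obtain a c where ac: "a = (i + 5) mod 6" "c = Suc i mod 6" by blast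
  have lt: "a < 6" "c < 6" and ne: "a \<noteq> i" "c \<noteq> i" "a \<noteq> c" and succ: "Suc a mod 6 = i" "(a + 2) mod 6 = c"
    using i unfolding ac by (auto simp: less_6_cases)
  have m: "mink (n a) (n c) < -1" using two_apart[OF lt(1)] unfolding succ .
  have L: "side_len i > 0" "cosh (side_len i) = - mink (n a) (n c)"
    using m by (simp_all add: side_len_def flip: ac)
  have va: "vtx a \<in> hyp_plane" "mink (vtx a) (n a) = 0" "mink (vtx a) (n i) = 0" "mink (vtx a) (n c) < 0"
    using vtx(1-3)[OF lt(1)] vtx(4)[OF lt(1,2)] ne unfolding succ by simp_all
  have vi: "vtx i \<in> hyp_plane" "mink (vtx i) (n i) = 0" "mink (vtx i) (n c) = 0" "mink (vtx i) (n a) < 0"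
    using vtx(1-3)[OF i, folded ac] vtx(4)[OF i lt(1), folded ac] ne by simp_all
  have AC: "mink (n a) (n c) = - cosh (side_len i)" using L(2) by simp
  have sp_def: "side_path i = geo (vtx a) (- n a)" by (simp add: side_path_def ac)
  have nn: "mink (n a) (n i) = 0" "mink (n i) (n c) = 0"
    using adjacent[OF lt(1)] adjacent[OF i] unfolding succ ac(2) by simp_all
  note sp = side_parametrisation[OF unit[OF lt(1)] unit[OF i] unit[OF lt(2)] nn va AC L(1), folded sp_def]
  have s0: "side_path i 0 = vtx a" by (simp add: sp_def)
  have s1: "side_path i (side_len i) = vtx i"
  proof -
    obtain s where s: "s \<in> {0..side_len i}" "vtx i = side_path i s"
      using sp(5)[OF vi(1,2)] vi(3,4) by auto
    then have "sinh (s - side_len i) = 0" using sp(4)[of s] vi(3) by simp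
    then show ?thesis using s by simp
  qed
  have inH: "side_path i s \<in> H" if "s \<in> {0..side_len i}" for s
    unfolding sp_def using that s0 s1 sp(1)[of s] vtx_in_H[OF i] vtx_in_H[OF lt(1)]
    by (intro H_geo_between[of _ _ 0 "side_len i" s]) (auto simp: sp_def)
  show "hdist (side_path i s) (side_path i t) = \<bar>s - t\<bar>"
    unfolding sp_def using va unit[OF lt(1)] by (intro hdist_geo_geo) (auto simp: hyp_planeD)
  show "hex_side n i = side_path i ` {0..side_len i}"
  proof
    show "hex_side n i \<subseteq> side_path i ` {0..side_len i}"
    proof
      fix x assume "x \<in> hex_side n i"
      then have "\<exists>s\<in>{0..side_len i}. x = side_path i s"
        using H_D lt by (intro sp(5)) (auto simp: hex_side_def)
      then show "x \<in> side_path i ` {0..side_len i}" by auto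
    qed
    show "side_path i ` {0..side_len i} \<subseteq> hex_side n i"
      using inH sp(2) by (auto simp: hex_side_def)
  qed
  show "x \<in> H" if "x \<in> hyp_plane" "mink x (n i) = 0" "mink x (n ((i + 5) mod 6)) \<le> 0" "mink x (n (Suc i mod 6)) \<le> 0"
    using sp(5)[OF that[folded ac]] inH by auto
  show "side_len i > 0" "cosh (side_len i) = - mink (n ((i + 5) mod 6)) (n (Suc i mod 6))"
    "side_path i 0 = vtx ((i + 5) mod 6)" "side_path i (side_len i) = vtx i"
    using L s0 s1 unfolding ac by simp_all
qed

text \<open>\<open>foldr\<close> applies the head of the word last, so prefixes of \<open>w\<close>
  name the tiles passed on the way from the base hexagon to its image under
  \<open>act w\<close>.\<close>

definition act :: "nat list \<Rightarrow> real^3 \<Rightarrow> real^3" where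
  "act w v = foldr (\<lambda>s. reflect (n s)) w v"

lemma act_simps [simp]: "act [] v = v" "act (s # w) v = reflect (n s) (act w v)"
  "act (u @ w) v = act u (act w v)"
  by (simp_all add: act_def)

lemma mink_act: "set w \<subseteq> mirrors \<Longrightarrow> mink (act w x) (act w y) = mink x y"
  by (induction w) (auto simp: mink_reflect unit mirrors_lt_6)

lemma act_rev: "set w \<subseteq> mirrors \<Longrightarrow> act (rev w) (act w x) = x"
  by (induction w arbitrary: x) (auto simp: unit mirrors_lt_6)

lemma act_rev': "set w \<subseteq> mirrors \<Longrightarrow> act w (act (rev w) x) = x"
  using act_rev[of "rev w"] by simp

lemma mink_act_left: "set w \<subseteq> mirrors \<Longrightarrow> mink (act w x) y = mink x (act (rev w) y)"
  using mink_act[of w x "act (rev w) y"] act_rev'[of w y] by simp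

lemma act_linear: "act w (x + y) = act w x + act w y" "act w (r *\<^sub>R x) = r *\<^sub>R act w x"
  by (induction w) (simp_all add: reflect_linear)

lemma act_geo: "act w (geo p v s) = geo (act w p) (act w v) s"
  by (simp add: geo_def act_linear)

lemma reduced_word_exists:
  assumes "set w \<subseteq> mirrors"
  shows "\<exists>w'. distinct_adj w' \<and> set w' \<subseteq> mirrors \<and> (\<forall>x. act w' x = act w x)"
  using assms
proof (induction w)
  case Nil
  then show ?case by (intro exI[of _ "[]"]) auto
next
  case (Cons s w)
  then obtain w' where w': "distinct_adj w'" "set w' \<subseteq> mirrors" "\<And>x. act w' x = act w x" by auto
  show ?case
  proof (cases "w' \<noteq> [] \<and> hd w' = s")
    case True
    then obtain u where u: "w' = s # u" by (metis list.collapse)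
    have "mink (n s) (n s) = 1" using Cons.prems by (intro unit mirrors_lt_6) auto
    then have "act u x = act (s # w) x" for x using w'(3)[of x] u by (metis act_simps(2) reflect_reflect)
    then show ?thesis using u w' by (intro exI[of _ u]) (auto simp: distinct_adj_Cons)
  next
    case False
    then show ?thesis using w' Cons.prems
      by (intro exI[of _ "s # w'"]) (auto simp: distinct_adj_Cons)
  qed
qed

text \<open>The reflection representation of the universal Coxeter group on three generators: as all
  products of distinct generating normals are below \<open>-1\<close>, a reduced word moves the chamber
  to the far side of the mirror of its first letter.\<close>
lemma act_reduced_signs:
  assumes "w \<noteq> []" "distinct_adj w" "set w \<subseteq> mirrors" "\<And>s. s \<in> mirrors \<Longrightarrow> mink v (n s) \<le> 0"
    and "mink v (n (last w)) \<le> - k" "k \<ge> 0"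
  shows "mink (act w v) (n (hd w)) \<ge> k \<and>
    (\<forall>s\<in>mirrors. s \<noteq> hd w \<longrightarrow> mink (act w v) (n s) \<le> - mink (act w v) (n (hd w)))"
  using assms(1-3,5)
proof (induction w)
  case (Cons s w)
  have s: "s \<in> mirrors" "s < 6" using Cons.prems by (auto simp: mirrors_lt_6)
  define z where "z = act w v"
  have r: "mink (act (s # w) v) (n s') = mink z (n s') - 2 * (mink z (n s) * mink (n s) (n s'))" for s'
    by (simp add: reflect_def z_def)
  have rs: "mink (act (s # w) v) (n s) = - mink z (n s)" using r[of s] unit[OF s(2)] by simp
  \<comment> \<open>Before the letter \<open>s\<close> is applied, every product except the one with
    \<open>hd w\<close> is at most \<open>- mink z (n (hd w))\<close>. Since \<open>s\<close>
    differs from \<open>hd w\<close>, this covers \<open>s\<close> itself.\<close>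
  have main: "mink z (n s) \<le> - k \<and> (\<forall>s'\<in>mirrors. s' \<noteq> s \<longrightarrow> mink z (n s') \<le> - mink z (n s))"
  proof (cases "w = []")
    case True
    then show ?thesis using Cons.prems assms(4) s \<open>k \<ge> 0\<close> by (force simp: z_def)
  next
    case False
    let ?h = "hd w"
    have h: "?h \<in> mirrors" "?h \<noteq> s" using False Cons.prems by (cases w; auto)+
    have IH: "mink z (n ?h) \<ge> k" "\<And>s. s \<in> mirrors \<Longrightarrow> s \<noteq> ?h \<Longrightarrow> mink z (n s) \<le> - mink z (n ?h)"
      using Cons.IH[OF False] Cons.prems False unfolding z_def by (auto simp: distinct_adj_Cons)
    show ?thesis using IH h s \<open>k \<ge> 0\<close> by (smt (verit, best))
  qed
  \<comment> \<open>As the product of the two normals is below -1, the reflection subtracts at least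
    \<open>- 2 * mink z (n s)\<close>, which outweighs the possible
    \<open>- mink z (n s)\<close>.\<close>
  have "mink (act (s # w) v) (n s') \<le> mink z (n s)" if s': "s' \<in> mirrors" "s' \<noteq> s" for s'
  proof -
    have "mink z (n s) * mink (n s) (n s') \<ge> - mink z (n s)"
      using mult_left_mono_neg[of "mink (n s) (n s')" "-1" "mink z (n s)"] gram_mirrors[OF s(1) s'(1)] s' main \<open>k \<ge> 0\<close>
      by simp
    then show ?thesis using r[of s'] main s' by (smt (verit, best))
  qed
  then show ?case using main rs by simp
qed simp

text \<open>Each further letter subtracts twice the product of two nonpositive numbers: the sign of
  \<open>mink (act w v) (n s)\<close> is known because \<open>s\<close> does not repeat the first
  letter of \<open>w\<close>.\<close>

lemma act_reduced_le:
  assumes "distinct_adj w" "set w \<subseteq> mirrors" "\<And>s. s \<in> mirrors \<Longrightarrow> mink v (n s) \<le> 0"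
    "\<And>s. s \<in> mirrors \<Longrightarrow> mink y (n s) \<le> 0"
  shows "mink (act w v) y \<le> mink v y"
  using assms(1,2)
proof (induction w)
  case (Cons s w)
  have s: "s \<in> mirrors" using Cons.prems by auto
  have "mink (act w v) (n s) \<le> 0"
  proof (cases "w = []")
    case True then show ?thesis using assms(3) s by simp
  next
    case False
    have w: "distinct_adj w" "set w \<subseteq> mirrors" "hd w \<noteq> s"
      using Cons.prems False by (auto simp: distinct_adj_Cons)
    have "last w \<in> mirrors" using False w by (auto dest: last_in_set)
    then have "mink v (n (last w)) \<le> - 0" using assms(3) by simp
    from act_reduced_signs[OF False w(1,2) assms(3) this] w(3) s show ?thesis by fastforce
  qed
  moreover have "mink (n s) y \<le> 0" using assms(4)[OF s] by (simp add: mink_commute)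
  ultimately have "mink (act w v) (n s) * mink (n s) y \<ge> 0" by (rule mult_nonpos_nonpos)
  moreover have "mink (act w v) y \<le> mink v y" using Cons by (auto simp: distinct_adj_Cons)
  ultimately show ?case by (simp add: reflect_def)
qed simp

lemma cuff_mirror_nonpos: "j \<in> cuffs \<Longrightarrow> s \<in> mirrors \<Longrightarrow> mink (n j) (n s) \<le> 0"
  by (intro gram_nonpos cuffs_lt_6 mirrors_lt_6 mirror_neq_cuff[symmetric])

text \<open>The base hexagon lies on the inner side of every line in the orbit of the cuffs. This is
  what later keeps a perpendicular within the unfolded surface.\<close>

lemma H_act_cuff_nonpos:
  assumes "y \<in> H" "j \<in> cuffs" "set u \<subseteq> mirrors"
  shows "mink y (act u (n j)) \<le> 0"
proof -
  obtain w where w: "distinct_adj w" "set w \<subseteq> mirrors" "act w (n j) = act u (n j)"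
    using reduced_word_exists[OF assms(3)] by blast
  have "mink (act w (n j)) y \<le> mink (n j) y"
    using assms by (intro act_reduced_le w(1,2) cuff_mirror_nonpos H_D mirrors_lt_6)
  also have "\<dots> \<le> 0" using assms H_D[of y] cuffs_lt_6 by (simp add: mink_commute)
  finally show ?thesis using w(3) by (simp add: mink_commute)
qed

end

section \<open>Two glued hexagons\<close>

lemma closed_hyp_plane: "closed hyp_plane"
proof -
  have eq: "hyp_plane = {x. mink x x = -1} \<inter> {x. x$3 \<ge> 0}"
  proof (intro equalityI subsetI)
    fix x :: "real^3" assume x: "x \<in> {x. mink x x = -1} \<inter> {x. x$3 \<ge> 0}"
    have "x$3 \<noteq> 0"
    proof
      assume "x$3 = 0"
      then have "mink x x = (x$1)\<^sup>2 + (x$2)\<^sup>2" by (simp add: mink_def power2_eq_square)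
      then show False using x by (smt (verit) IntD1 mem_Collect_eq sum_power2_ge_zero)
    qed
    then show "x \<in> hyp_plane" using x by (auto simp: hyp_plane_def)
  qed (auto simp: hyp_plane_def)
  have "closed {x. mink x x = -1}"
    by (intro closed_Collect_eq continuous_intros)
  moreover have "closed {x::real^3. x$3 \<ge> 0}"
    by (intro closed_Collect_le continuous_intros)
  ultimately show ?thesis unfolding eq by (rule closed_Int)
qed

text \<open>\<open>d\<close> measures how far \<open>q\<close> is inside the light cone, and
  \<open>- mink x q\<close> is at least \<open>x$3 * d\<close>; a bounded third coordinate bounds
  the other two.\<close>

lemma bounded_hyp_ball:
  assumes q: "q \<in> hyp_plane"
  shows "bounded {x \<in> hyp_plane. - mink x q \<le> K}"
proof -
  have *: "norm (vector [z$1, z$2] :: real^2) = sqrt ((z$1)\<^sup>2 + (z$2)\<^sup>2)" for z :: "real^3"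
    by (simp add: norm_vec_def L2_set_def sum_2)
  have sq: "(z$1)\<^sup>2 + (z$2)\<^sup>2 < (z$3)\<^sup>2" if "z \<in> hyp_plane" for z
    using hyp_planeD(1)[OF that] by (simp add: mink_def power2_eq_square)
  have lt: "sqrt ((z$1)\<^sup>2 + (z$2)\<^sup>2) < z$3" if "z \<in> hyp_plane" for z
    using sq[OF that] hyp_planeD(2)[OF that] by (metis abs_of_pos real_sqrt_abs real_sqrt_less_iff)
  define d where "d = q$3 - sqrt ((q$1)\<^sup>2 + (q$2)\<^sup>2)"
  have d: "d > 0" using lt[OF q] by (simp add: d_def)
  have "norm x \<le> 3 * (K / d)" if x: "x \<in> hyp_plane" "- mink x q \<le> K" for x
  proof -
    have "x$1 * q$1 + x$2 * q$2 = (vector [x$1, x$2] :: real^2) \<bullet> vector [q$1, q$2]"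
      by (simp add: inner_vec_def sum_2)
    also have "\<dots> \<le> sqrt ((x$1)\<^sup>2 + (x$2)\<^sup>2) * sqrt ((q$1)\<^sup>2 + (q$2)\<^sup>2)"
      unfolding *[symmetric] by (rule norm_cauchy_schwarz)
    also have "\<dots> \<le> x$3 * sqrt ((q$1)\<^sup>2 + (q$2)\<^sup>2)"
      using lt[OF x(1)] by (intro mult_right_mono) auto
    finally have "x$3 * d \<le> K" using x(2) by (simp add: mink_def d_def algebra_simps)
    then have x3: "x$3 \<le> K / d" using d by (simp add: field_simps)
    have p: "x$3 > 0" using x by (simp add: hyp_planeD)
    have s: "(x$1)\<^sup>2 < (x$3)\<^sup>2" "(x$2)\<^sup>2 < (x$3)\<^sup>2"
      using sq[OF x(1)] zero_le_power2[of "x$1"] zero_le_power2[of "x$2"] by linarith+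
    have "\<bar>x$1\<bar> \<le> x$3" "\<bar>x$2\<bar> \<le> x$3"
      using p power2_le_imp_le[of "\<bar>x$1\<bar>" "x$3"] power2_le_imp_le[of "\<bar>x$2\<bar>" "x$3"] s by auto
    moreover have "norm x \<le> \<bar>x$1\<bar> + \<bar>x$2\<bar> + \<bar>x$3\<bar>"
      using norm_le_l1_cart[of x] by (simp add: sum_3)
    ultimately show ?thesis using x3 p by linarith
  qed
  then show ?thesis by (auto simp: bounded_iff)
qed

lemma closed_hex_region: "closed (hex_region n)"
proof -
  have "hex_region n = hyp_plane \<inter> (\<Inter>i\<in>{..<6}. {x. mink x (n i) \<le> 0})"
    by (auto simp: hex_region_def)
  then show ?thesis
    by (auto intro!: closed_Int closed_hyp_plane closed_INT closed_Collect_le continuous_intros)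
qed

lemma closed_hex_side: "closed (hex_side n i)"
proof -
  have "hex_side n i = hex_region n \<inter> {x. mink x (n i) = 0}"
    by (auto simp: hex_side_def)
  then show ?thesis
    by (auto intro!: closed_Int closed_hex_region closed_Collect_eq continuous_intros)
qed

text \<open>The Boolean names the copy, so \<open>\<not> b\<close> is the other one.
  \<open>agree\<close> is pointwise and thus stronger than the equality of side images in
  \<open>cut_into_hexagons\<close>; it is derived in
  \<open>glued_hexagons_of_orthobasis\<close>.\<close>

locale glued_hexagons = hexagon n for n +
  fixes P :: "'a::metric_space set" and h :: "bool \<Rightarrow> real^3 \<Rightarrow> 'a"
  assumes geodesic: "geodesic_metric P"
    and cover: "h b ` hex_region n \<union> h (\<not> b) ` hex_region n = P"
    and meet: "h b ` hex_region n \<inter> h (\<not> b) ` hex_region n \<subseteq> h b ` (\<Union>s\<in>mirrors. hex_side n s)"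
    and iso: "x \<in> hex_region n \<Longrightarrow> y \<in> hex_region n \<Longrightarrow> dist (h b x) (h b y) = hdist x y"
    and agree: "s \<in> mirrors \<Longrightarrow> x \<in> hex_side n s \<Longrightarrow> h b x = h (\<not> b) x"
begin

lemma h_in_P: "x \<in> H \<Longrightarrow> h b x \<in> P"
  using cover[of b] by auto

lemma P_E:
  assumes "p \<in> P"
  obtains x b where "x \<in> H" "p = h b x"
  using cover[of True] assms by blast

lemma side_D: "x \<in> hex_side n s \<Longrightarrow> x \<in> H" "x \<in> hex_side n s \<Longrightarrow> mink x (n s) = 0"
  by (auto simp: hex_side_def)

lemma h_inj: "x \<in> H \<Longrightarrow> y \<in> H \<Longrightarrow> h b x = h b y \<Longrightarrow> x = y"
  using iso[of x y b] hdist_eq_0_iff[of x y] by (auto dest: H_D)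

lemma h_other_D:
  assumes "x \<in> H" "y \<in> H" "h b x = h (\<not> b) y"
  shows "x = y" "\<exists>s\<in>mirrors. x \<in> hex_side n s"
proof -
  have "h b x \<in> h b ` (\<Union>s\<in>mirrors. hex_side n s)" using meet[of b] assms by blast
  then obtain z s where z: "s \<in> mirrors" "z \<in> hex_side n s" "h b x = h b z" by auto
  then have "z = x" using h_inj assms side_D by metis
  then show "\<exists>s\<in>mirrors. x \<in> hex_side n s" using z by auto
  have "h b x = h (\<not> b) x" using agree[OF z(1,2)] unfolding \<open>z = x\<close> .
  then have "h (\<not> b) x = h (\<not> b) y" using assms(3) by metis
  then show "x = y" using h_inj assms by blast
qed

lemma continuous_on_h: "continuous_on H (h b)"
  unfolding continuous_on_sequentially
proof (intro allI ballI impI)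
  fix x a assume xa: "a \<in> H" "(\<forall>k. x k \<in> H) \<and> x \<longlonglongrightarrow> a"
  have "(\<lambda>k. - mink (x k) a) \<longlonglongrightarrow> - mink a a"
    unfolding mink_def using xa(2) by (intro tendsto_intros) auto
  then have "(\<lambda>k. - mink (x k) a) \<longlonglongrightarrow> 1" using xa(1) H_D(1)[of a] by (simp add: hyp_planeD)
  moreover have "- mink (x k) a \<ge> 1" for k
    using mink_hyp_plane_le[OF H_D(1)[of "x k"] H_D(1)[OF xa(1)]] xa(2) by simp
  ultimately have "(\<lambda>k. arcosh (- mink (x k) a)) \<longlonglongrightarrow> arcosh 1"
    by (intro tendsto_arcosh_strong) auto
  then have "(\<lambda>k. dist (h b (x k)) (h b a)) \<longlonglongrightarrow> 0"
    using xa by (simp add: iso hdist_def)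
  then show "(h b \<circ> x) \<longlonglongrightarrow> h b a" by (subst tendsto_dist_iff) (simp add: comp_def)
qed

text \<open>A convergent sequence is bounded and \<open>h b\<close> is isometric, so the preimages
  stay in one closed hyperbolic ball, which is compact.\<close>

lemma closed_h_image:
  assumes "closed S" "S \<subseteq> H"
  shows "closed (h b ` S)"
  unfolding closed_sequential_limits
proof (intro allI impI)
  fix y l assume y: "(\<forall>k. y k \<in> h b ` S) \<and> y \<longlonglongrightarrow> l"
  then have "\<forall>k. \<exists>x. x \<in> S \<and> y k = h b x" by blast
  then obtain x where x: "\<And>k. x k \<in> S" "\<And>k. y k = h b (x k)" by metis
  have "bounded (range y)" using y convergent_imp_bounded by blast
  then obtain K where K: "\<And>k. dist (y 0) (y k) \<le> K" unfolding bounded_any_center[of _ "y 0"] by auto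
  let ?T = "S \<inter> {z \<in> hyp_plane. - mink z (x 0) \<le> cosh K}"
  have xH: "x k \<in> H" for k using x assms by auto
  have "x k \<in> ?T" for k
  proof -
    have "hdist (x k) (x 0) \<le> K" using K[of k] iso[OF xH[of 0] xH[of k], of b] x by (simp add: hdist_commute)
    then have "cosh (hdist (x k) (x 0)) \<le> cosh K"
      using hdist_nonneg[OF H_D(1)[OF xH] H_D(1)[OF xH]] by (intro cosh_real_nonneg_le_iff[THEN iffD2]) (auto intro: order_trans)
    then show ?thesis using x xH H_D by (simp add: cosh_hdist)
  qed
  moreover have "compact ?T"
  proof -
    have "closed ?T"
    proof -
      have "?T = S \<inter> hyp_plane \<inter> {z. - mink z (x 0) \<le> cosh K}" by auto
      then show ?thesis
        by (auto intro!: closed_Int assms closed_hyp_plane closed_Collect_le continuous_intros)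
    qed
    then show ?thesis
      using bounded_hyp_ball[OF H_D(1)[OF xH[of 0]]] compact_eq_bounded_closed bounded_Int by blast
  qed
  then have "closed (h b ` ?T)"
    using assms by (intro compact_imp_closed compact_continuous_image
      continuous_on_subset[OF continuous_on_h]) blast+
  ultimately have "l \<in> h b ` ?T"
    using y x(2) unfolding closed_sequential_limits by blast
  then show "l \<in> h b ` S" by auto
qed

text \<open>A path realising the distance is connected and covered by the two closed copies, so it
  passes through a common point, and common points lie on mirrors.\<close>

lemma dist_through_mirror:
  assumes x: "x \<in> H" and y: "y \<in> H"
  obtains s z where "s \<in> mirrors" "z \<in> hex_side n s"
    "dist (h b x) (h (\<not> b) y) = hdist x z + hdist z y"
proof -
  let ?d = "dist (h b x) (h (\<not> b) y)"
  obtain g where g: "g ` {0..?d} \<subseteq> P" "g 0 = h b x" "g ?d = h (\<not> b) y"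
    and gd: "\<And>s t. s \<in> {0..?d} \<Longrightarrow> t \<in> {0..?d} \<Longrightarrow> dist (g s) (g t) = \<bar>s - t\<bar>"
    using geodesic h_in_P[OF x] h_in_P[OF y] unfolding geodesic_metric_def by metis
  have "continuous_on {0..?d} g"
    unfolding continuous_on_iff using gd by (metis dist_real_def abs_minus_commute)
  then have conn: "connected (g ` {0..?d})" by (intro connected_continuous_image) auto
  have cl: "closed (h b' ` H)" for b' by (intro closed_h_image closed_hex_region) auto
  have "0 \<in> {0..?d}" "?d \<in> {0..?d}" by auto
  then have "h b x \<in> g ` {0..?d}" "h (\<not> b) y \<in> g ` {0..?d}" using g(2,3) by (metis image_eqI)+
  then have "h b ` H \<inter> g ` {0..?d} \<noteq> {}" "h (\<not> b) ` H \<inter> g ` {0..?d} \<noteq> {}" using x y by blast+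
  moreover have "g ` {0..?d} \<subseteq> h b ` H \<union> h (\<not> b) ` H" using g(1) cover[of b] by simp
  ultimately have "h b ` H \<inter> h (\<not> b) ` H \<inter> g ` {0..?d} \<noteq> {}"
    using connected_closedD[OF conn _ _ cl cl] by blast
  then obtain q where q: "q \<in> h b ` H" "q \<in> h (\<not> b) ` H" "q \<in> g ` {0..?d}" by (metis IntE equals0I)
  obtain z where z: "q = h b z" "z \<in> H" using q(1) by (rule imageE)
  obtain z' where z': "q = h (\<not> b) z'" "z' \<in> H" using q(2) by (rule imageE)
  obtain t where t0: "q = g t" "t \<in> {0..?d}" using q(3) by (rule imageE)
  have t: "t \<in> {0..?d}" "g t = h b z" "g t = h (\<not> b) z'" "z \<in> H" "z' \<in> H"
    using z z' t0 by metis+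
  then have "z = z'" "\<exists>s\<in>mirrors. z \<in> hex_side n s" using h_other_D[of z z' b] by auto
  then obtain s where s: "s \<in> mirrors" "z \<in> hex_side n s" by auto
  have "hdist x z = t" using gd[of 0 t] t g iso[OF x t(4), of b] by auto
  moreover have "hdist z y = ?d - t" using gd[of t ?d] t g iso[OF t(5) y, of "\<not> b"] \<open>z = z'\<close> by auto
  ultimately show thesis using s that by simp
qed

text \<open>The segment from \<open>x\<close> to the mirror image of \<open>y\<close> meets the
  mirror at some \<open>z\<close>. Both ends satisfy the other five inequalities, so
  \<open>z\<close> is on the side itself and the two halves give a path in \<open>P\<close>.\<close>

lemma dist_le_reflect:
  assumes x: "x \<in> H" and y: "y \<in> H" and s: "s \<in> mirrors"
  shows "dist (h b x) (h (\<not> b) y) \<le> hdist x (reflect (n s) y)"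
proof -
  let ?y = "reflect (n s) y"
  have s6: "s < 6" and us: "mink (n s) (n s) = 1" using s by (auto simp: mirrors_lt_6 unit)
  have xh: "x \<in> hyp_plane" and yh: "y \<in> hyp_plane" and Yh: "?y \<in> hyp_plane"
    using x y us by (auto dest: H_D intro: reflect_in_hyp_plane)
  have "\<exists>z\<in>hex_side n s. hdist x z + hdist z ?y = hdist x ?y"
  proof (cases "x = ?y")
    case True
    then have "mink x (n s) = - mink y (n s)" using us by (simp add: reflect_def)
    then have "mink x (n s) = 0" using H_D(2)[OF x s6] H_D(2)[OF y s6] by linarith
    then have "x \<in> hex_side n s" using x by (simp add: hex_side_def)
    then show ?thesis using True xh by (intro bexI[of _ x]) auto
  next
    case False
    then obtain v where v: "mink v v = 1" "mink x v = 0" "geo x v (hdist x ?y) = ?y" "hdist x ?y > 0"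
      using geo_joining[OF xh Yh] by blast
    let ?d = "hdist x ?y"
    have "mink ?y (n s) = - mink y (n s)" using us by (simp add: reflect_def)
    then have "mink (geo x v ?d) (n s) \<ge> 0" using v H_D(2)[OF y s6] by simp
    moreover have "mink (geo x v 0) (n s) \<le> 0" using H_D(2)[OF x s6] by simp
    moreover have "continuous_on {0..?d} (\<lambda>t. mink (geo x v t) (n s))"
      unfolding geo_def by (intro continuous_intros)
    ultimately obtain t where t: "0 \<le> t" "t \<le> ?d" "mink (geo x v t) (n s) = 0"
      using IVT'[of "\<lambda>t. mink (geo x v t) (n s)" 0 0 ?d] v(4) by auto
    have "geo x v t \<in> H"
    proof (rule H_I)
      show "geo x v t \<in> hyp_plane" using xh v by (intro geo_in_hyp_plane) auto
      fix i :: nat assume i: "i < 6"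
      show "mink (geo x v t) (n i) \<le> 0"
      proof (cases "i = s")
        case False
        then have "mink ?y (n i) \<le> 0" using reflect_H_nonpos[OF y s i] H_D(2)[OF y i] by simp
        then show ?thesis using t v H_D(2)[OF x i]
          by (intro mink_le_0_between[of x v 0 "n i" ?d t]) auto
      qed (use t in simp)
    qed
    then have "geo x v t \<in> hex_side n s" using t by (simp add: hex_side_def)
    moreover have "hdist (geo x v 0) (geo x v t) + hdist (geo x v t) (geo x v ?d) = ?d"
      using t v xh by (subst (1 2) hdist_geo_geo) (auto simp: hyp_planeD)
    ultimately show ?thesis using v by auto
  qed
  then obtain z where z: "z \<in> hex_side n s" "hdist x z + hdist z ?y = hdist x ?y" by auto
  have "hdist z ?y = hdist z y"
    using hdist_reflect[OF us, of z y] reflect_perp[OF side_D(2)[OF z(1)]] by simp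
  moreover have "dist (h b x) (h (\<not> b) y) \<le> dist (h b x) (h b z) + dist (h b z) (h (\<not> b) y)"
    by (rule dist_triangle)
  ultimately show ?thesis
    using z iso[OF x side_D(1)[OF z(1)], of b] iso[OF side_D(1)[OF z(1)] y, of "\<not> b"] agree[OF s z(1), of b] by simp
qed

text \<open>The mirror here is the one crossed by a shortest path and depends on \<open>x\<close>
  and \<open>y\<close>; the next lemma makes it uniform near a mirror point.\<close>

lemma dist_ge_reflect:
  assumes x: "x \<in> H" and y: "y \<in> H"
  shows "\<exists>s\<in>mirrors. hdist x (reflect (n s) y) \<le> dist (h b x) (h (\<not> b) y)"
proof -
  obtain s z where z: "s \<in> mirrors" "z \<in> hex_side n s"
    "dist (h b x) (h (\<not> b) y) = hdist x z + hdist z y" using dist_through_mirror[OF x y] .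
  have us: "mink (n s) (n s) = 1" using z by (auto simp: mirrors_lt_6 unit)
  have "hdist z (reflect (n s) y) = hdist z y"
    using hdist_reflect[OF us, of z y] reflect_perp[OF side_D(2)[OF z(2)]] by simp
  moreover have "hdist x (reflect (n s) y) \<le> hdist x z + hdist z (reflect (n s) y)"
    using x y side_D(1)[OF z(2)] us by (intro hdist_triangle reflect_in_hyp_plane) (auto dest: H_D)
  ultimately show ?thesis using z by auto
qed

lemma dist_eq_reflect_near:
  assumes c: "c \<in> H" and s: "s \<in> mirrors" and cs: "mink c (n s) = 0"
  shows "\<exists>e>0. \<forall>x\<in>H. \<forall>y\<in>H. \<forall>b. hdist x c < e \<longrightarrow> hdist y c < e \<longrightarrow>
    dist (h b x) (h (\<not> b) y) = hdist x (reflect (n s) y)"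
proof -
  have ch: "c \<in> hyp_plane" using c by (rule H_D)
  have us: "mink (n s) (n s) = 1" if "s \<in> mirrors" for s using that by (auto simp: mirrors_lt_6 unit)
  have r: "reflect (n s) c \<in> hyp_plane" if "s \<in> mirrors" for s
    using us[OF that] ch by (rule reflect_in_hyp_plane)
  \<comment> \<open>If another mirror \<open>s'\<close> were used, the triangle inequality would
    move \<open>c\<close> under its reflection by less than \<open>e + 2 * e + e\<close>, hence the
    division by 4. The value 1 at \<open>s\<close> imposes nothing beyond positivity.\<close>
  define E where "E s' = (if s' = s then 1 else hdist c (reflect (n s') c) / 4)" for s'
  have E: "E s' > 0" if s': "s' \<in> mirrors" for s'
  proof (cases "s' = s")
    case False
    then have "mink c (n s') \<noteq> 0"
      using nonadjacent_disjoint[OF ch, of s s'] gram_mirrors[OF s s'] cs s s' by (simp add: mirrors_lt_6)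
    then have "reflect (n s') c \<noteq> c" using us[OF s'] by (auto simp: reflect_def)
    then show ?thesis
      using hdist_eq_0_iff[OF ch r[OF s']] hdist_nonneg[OF ch r[OF s']] False by (auto simp: E_def)
  qed (simp add: E_def)
  define e where "e = Min (E ` mirrors)"
  have fin: "finite (E ` mirrors)" "E ` mirrors \<noteq> {}" by (auto simp: mirrors_def)
  have e: "e > 0" using E fin by (simp add: e_def)
  have eE: "e \<le> E s'" if "s' \<in> mirrors" for s' using that fin by (simp add: e_def)
  show ?thesis
  proof (intro exI[of _ e] conjI ballI allI impI e)
    fix x y b assume x: "x \<in> H" and y: "y \<in> H" and d: "hdist x c < e" "hdist y c < e"
    have xh: "x \<in> hyp_plane" and yh: "y \<in> hyp_plane" using x y by (auto dest: H_D)
    obtain s' where s': "s' \<in> mirrors" "hdist x (reflect (n s') y) \<le> dist (h b x) (h (\<not> b) y)"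
      using dist_ge_reflect[OF x y] by blast
    have near: "dist (h b x) (h (\<not> b) y) \<le> hdist x c + hdist y c"
    proof -
      have "dist (h b x) (h (\<not> b) y) \<le> dist (h b x) (h b c) + dist (h b c) (h (\<not> b) y)"
        by (rule dist_triangle)
      then show ?thesis
        using agree[OF s, of c b] c cs iso[OF x c, of b] iso[OF c y, of "\<not> b"]
        by (simp add: hex_side_def hdist_commute)
    qed
    have "s' = s"
    proof (rule ccontr)
      assume ne: "s' \<noteq> s"
      let ?R = "reflect (n s')"
      have Ry: "?R y \<in> hyp_plane" using us[OF s'(1)] yh by (rule reflect_in_hyp_plane)
      have "hdist c (?R c) \<le> hdist c x + hdist x (?R c)"
        using ch xh r[OF s'(1)] by (rule hdist_triangle)
      also have "hdist x (?R c) \<le> hdist x (?R y) + hdist (?R y) (?R c)"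
        using xh Ry r[OF s'(1)] by (rule hdist_triangle)
      also have "hdist (?R y) (?R c) = hdist y c" using us[OF s'(1)] by (rule hdist_reflect)
      finally have "hdist c (?R c) < 4 * e"
        using d near s'(2) hdist_commute[of c x] by simp
      then show False using eE[OF s'(1)] ne by (simp add: E_def)
    qed
    then show "dist (h b x) (h (\<not> b) y) = hdist x (reflect (n s) y)"
      using s'(2) dist_le_reflect[OF x y s, of b] by simp
  qed
qed

text \<open>Identifies the two copies. The choice is unambiguous on \<open>P\<close> because points
  common to both copies come from the same point of \<open>H\<close>.\<close>

definition fold_hex :: "'a \<Rightarrow> real^3" where
  "fold_hex p = (SOME x. x \<in> H \<and> (\<exists>b. p = h b x))"

lemma fold_h [simp]:
  assumes "x \<in> H"
  shows "fold_hex (h b x) = x"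
proof -
  have "fold_hex (h b x) \<in> H \<and> (\<exists>b'. h b x = h b' (fold_hex (h b x)))"
    unfolding fold_hex_def by (rule someI[of _ x]) (use assms in blast)
  then obtain b' where b': "fold_hex (h b x) \<in> H" "h b x = h b' (fold_hex (h b x))" by blast
  show ?thesis
  proof (cases "b' = b")
    case True
    then show ?thesis using h_inj[OF assms b'(1), of b] b'(2) by simp
  next
    case False
    then have "h b x = h (\<not> b) (fold_hex (h b x))" using b'(2) by (cases b; cases b') auto
    then show ?thesis using h_other_D(1)[OF assms b'(1), of b] by simp
  qed
qed

lemma fold_in_H: "p \<in> P \<Longrightarrow> fold_hex p \<in> H"
  by (elim P_E) simp

text \<open>Unfolds the two hexagons across the mirror \<open>s\<close>, keeping the copy \<open>b\<close> in place.\<close>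
definition unfold :: "bool \<Rightarrow> nat \<Rightarrow> 'a \<Rightarrow> real^3" where
  "unfold b s p = (if p \<in> h b ` H then fold_hex p else reflect (n s) (fold_hex p))"

lemma unfold_h [simp]: "x \<in> H \<Longrightarrow> unfold b s (h b x) = x"
  by (simp add: unfold_def)

lemma unfold_h_other:
  assumes "x \<in> H" "s \<in> mirrors" "mink x (n s) = 0 \<or> h (\<not> b) x \<notin> h b ` H"
  shows "unfold b s (h (\<not> b) x) = reflect (n s) x"
  using assms by (auto simp: unfold_def reflect_perp)

text \<open>A metric chart with values in the whole plane, valid on a ball around \<open>p\<close>.
  If \<open>p\<close> lies on no mirror, the ball stays in copy \<open>b\<close> and
  \<open>s\<close> is only a dummy.\<close>

definition chart_at :: "'a \<Rightarrow> real \<Rightarrow> bool \<Rightarrow> nat \<Rightarrow> bool" where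
  "chart_at p e b s \<longleftrightarrow> e > 0 \<and> s \<in> mirrors \<and> p \<in> h b ` H \<and>
     (\<forall>q\<in>P \<inter> ball p e. \<forall>q'\<in>P \<inter> ball p e. hdist (unfold b s q) (unfold b s q') = dist q q') \<and>
     (mink (fold_hex p) (n s) = 0 \<or>
       (\<forall>q\<in>P \<inter> ball p e. q \<in> h b ` H) \<and> (\<forall>s'\<in>mirrors. mink (fold_hex p) (n s') < 0))"

lemma unfold_in_hyp_plane: "p \<in> P \<Longrightarrow> s \<in> mirrors \<Longrightarrow> unfold b s p \<in> hyp_plane"
  using fold_in_H[of p] by (auto simp: unfold_def mirrors_lt_6 unit intro!: reflect_in_hyp_plane dest: H_D)

text \<open>On a mirror, \<open>dist_eq_reflect_near\<close> compares points of different copies.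
  Off the mirrors, the other copy is a closed set missing \<open>p\<close>, so a small ball avoids
  it.\<close>

lemma chart_at_exists:
  assumes "p \<in> P"
  shows "\<exists>e b s. chart_at p e b s"
proof -
  obtain c b where c: "c \<in> H" "p = h b c" using assms by (elim P_E)
  show ?thesis
  proof (cases "\<exists>s\<in>mirrors. mink c (n s) = 0")
    case True
    then obtain s where s: "s \<in> mirrors" "mink c (n s) = 0" by blast
    have us: "mink (n s) (n s) = 1" using s by (auto simp: mirrors_lt_6 unit)
    have pc: "p = h b' c" for b'
      using agree[OF s(1), of c b] c s by (cases "b' = b") (auto simp: hex_side_def)
    obtain e where e: "e > 0" and E: "\<And>x y b. x \<in> H \<Longrightarrow> y \<in> H \<Longrightarrow> hdist x c < e \<Longrightarrow> hdist y c < e \<Longrightarrow>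
      dist (h b x) (h (\<not> b) y) = hdist x (reflect (n s) y)"
      using dist_eq_reflect_near[OF c(1) s] by blast
    have "hdist (unfold b s q) (unfold b s q') = dist q q'"
      if q: "q \<in> P \<inter> ball p e" and q': "q' \<in> P \<inter> ball p e" for q q'
    proof -
      obtain x b1 where x: "x \<in> H" "q = h b1 x" using q by (auto elim: P_E)
      obtain y b2 where y: "y \<in> H" "q' = h b2 y" using q' by (auto elim: P_E)
      have d: "hdist x c < e" "hdist y c < e"
        using q q' x y iso[OF x(1) c(1), of b1] iso[OF y(1) c(1), of b2] pc[of b1] pc[of b2]
        by (auto simp: dist_commute)
      have r: "hdist (reflect (n s) x) y = hdist x (reflect (n s) y)"
        using hdist_reflect[OF us, of x "reflect (n s) y"] us by simp
      consider "q \<in> h b ` H" "q' \<in> h b ` H" | "q \<in> h b ` H" "q' \<notin> h b ` H"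
        | "q \<notin> h b ` H" "q' \<in> h b ` H" | "q \<notin> h b ` H" "q' \<notin> h b ` H" by blast
      then show ?thesis
      proof cases
        case 1
        then show ?thesis using iso by auto
      next
        case 2
        then have "q = h b x" "b2 = (\<not> b)" using x y h_other_D fold_h by (auto, metis)
        then show ?thesis using 2 E[OF x(1) y(1) d, of b] x y by (simp add: unfold_def)
      next
        case 3
        then have "q' = h b y" "b1 = (\<not> b)" using x y fold_h by (auto, metis)
        then show ?thesis using 3 E[OF x(1) y(1) d, of "\<not> b"] x y r by (simp add: unfold_def)
      next
        case 4
        then have "b1 = (\<not> b)" "b2 = (\<not> b)" using x y by auto
        then show ?thesis using 4 iso[OF x(1) y(1), of "\<not> b"] x y hdist_reflect[OF us, of x y]
          by (simp add: unfold_def)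
      qed
    qed
    then have "chart_at p e b s" using e s c by (auto simp: chart_at_def)
    then show ?thesis by blast
  next
    case False
    have "p \<notin> h (\<not> b) ` H" using False c h_other_D(2)[OF c(1)] by (auto simp: hex_side_def)
    moreover have "closed (h (\<not> b) ` H)" by (intro closed_h_image closed_hex_region) auto
    ultimately obtain e where e: "e > 0" "ball p e \<inter> h (\<not> b) ` H = {}"
      by (metis open_contains_ball_eq open_Compl ComplI disjoint_eq_subset_Compl)
    then have in_b: "q \<in> h b ` H" if "q \<in> P \<inter> ball p e" for q using that cover[of b] by blast
    have "hdist (unfold b 0 q) (unfold b 0 q') = dist q q'"
      if q: "q \<in> P \<inter> ball p e" and q': "q' \<in> P \<inter> ball p e" for q q'
      using in_b[OF q] in_b[OF q'] iso by auto
    moreover have "mink c (n s) < 0" if "s \<in> mirrors" for s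
      using H_D(2)[OF c(1) mirrors_lt_6[OF that]] False that by (simp add: less_le)
    ultimately have "chart_at p e b 0"
      using e in_b c unfolding chart_at_def by (auto simp: mirrors_def)
    then show ?thesis by blast
  qed
qed

end

section \<open>Geodesic arcs in the unfolding charts\<close>

lemma geo_has_vector_derivative:
  "((\<lambda>s. geo p v s) has_vector_derivative (sinh t *\<^sub>R p + cosh t *\<^sub>R v)) (at t within S)"
  unfolding geo_def by (auto intro!: derivative_eq_intros)

lemma continuous_on_geo [continuous_intros]: "continuous_on S (\<lambda>s. geo p v s)"
  unfolding geo_def by (intro continuous_intros)

lemma eventually_mink_geo_neg:
  assumes "mink p m < 0"
  shows "\<forall>\<^sub>F s in nhds 0. mink (geo p v s) m < 0"
proof -
  have "continuous_on UNIV (\<lambda>s. mink (geo p v s) m)" by (intro continuous_intros)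
  then have "isCont (\<lambda>s. mink (geo p v s) m) 0" by (simp add: continuous_on_eq_continuous_at)
  then have "((\<lambda>s. mink (geo p v s) m) \<longlongrightarrow> mink (geo p v 0) m) (nhds 0)"
    unfolding isCont_def by (rule iffD1[OF tendsto_at_iff_tendsto_nhds[of "\<lambda>s. mink (geo p v s) m" 0]])
  then show ?thesis using assms by (intro order_tendstoD(2)) auto
qed

text \<open>The second factor is the velocity at \<open>t\<close> paired with \<open>m\<close>, so
  after a zero the sign of the product is governed by the side of \<open>t\<close> alone: the
  geodesic crosses the line once or lies in it.\<close>

lemma mink_geo_zero_at:
  assumes "mink (geo p v t) m = 0"
  shows "mink (geo p v u) m = sinh (u - t) * (sinh t * mink p m + cosh t * mink v m)"
proof -
  have z: "cosh t * mink p m = - (sinh t * mink v m)" using assms by (simp add: mink_geo)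
  have "(sinh u * cosh t - cosh u * sinh t) * (sinh t * mink p m + cosh t * mink v m)
     = cosh u * mink p m + sinh u * mink v m"
    using z cosh_square_eq[of t, unfolded power2_eq_square] by algebra
  then show ?thesis by (simp add: mink_geo sinh_diff)
qed

lemma geo_flip:
  "geo p v (l - u) = geo (cosh l *\<^sub>R p + sinh l *\<^sub>R v) (- (sinh l *\<^sub>R p + cosh l *\<^sub>R v)) u"
  by (simp add: geo_def cosh_diff sinh_diff algebra_simps)

lemma geodesic_arc_iff:
  "geodesic_arc P (l, c) \<longleftrightarrow> l > 0 \<and> c ` {0..l} \<subseteq> P \<and>
     (\<forall>t\<in>{0..l}. \<exists>e>0. \<forall>s\<in>{0..l} \<inter> ball t e. \<forall>s'\<in>{0..l} \<inter> ball t e. dist (c s) (c s') = \<bar>s - s'\<bar>)"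
  by (simp add: geodesic_arc_def)

lemma geodesic_arc_local:
  assumes "geodesic_arc P (l, c)" "t \<in> {0..l}"
  shows "\<exists>e>0. \<forall>s s'. s \<in> {0..l} \<inter> ball t e \<longrightarrow> s' \<in> {0..l} \<inter> ball t e \<longrightarrow> dist (c s) (c s') = \<bar>s - s'\<bar>"
proof -
  have "\<exists>e>0. \<forall>s\<in>{0..l} \<inter> ball t e. \<forall>s'\<in>{0..l} \<inter> ball t e. dist (c s) (c s') = \<bar>s - s'\<bar>"
    using assms(1)[unfolded geodesic_arc_iff] assms(2) by (elim conjE bspec)
  then show ?thesis unfolding Ball_def by (elim exE conjE) (intro exI conjI; simp)
qed

lemma geodesic_arc_reverse:
  assumes "geodesic_arc P (l, c)"
  shows "geodesic_arc P (l, \<lambda>t. c (l - t))"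
  unfolding geodesic_arc_iff
proof (intro conjI ballI)
  show "l > 0" using assms by (simp add: geodesic_arc_iff)
  have "(\<lambda>t. l - t) ` {0..l} \<subseteq> {0..l}" by auto
  then show "(\<lambda>t. c (l - t)) ` {0..l} \<subseteq> P" using assms by (auto simp: geodesic_arc_iff)
  fix t assume t: "t \<in> {0..l}"
  then have lt: "l - t \<in> {0..l}" by auto
  obtain e where e: "e > 0" "\<forall>s s'. s \<in> {0..l} \<inter> ball (l - t) e \<longrightarrow> s' \<in> {0..l} \<inter> ball (l - t) e \<longrightarrow> dist (c s) (c s') = \<bar>s - s'\<bar>"
    using geodesic_arc_local[OF assms lt] by (elim exE conjE)
  have "dist (c (l - s)) (c (l - s')) = \<bar>s - s'\<bar>" if "s \<in> {0..l} \<inter> ball t e" "s' \<in> {0..l} \<inter> ball t e" for s s'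
    using e(2)[rule_format, of "l - s" "l - s'"] that by (auto simp: dist_real_def abs_minus_commute)
  then show "\<exists>e>0. \<forall>s\<in>{0..l} \<inter> ball t e. \<forall>s'\<in>{0..l} \<inter> ball t e. dist (c (l - s)) (c (l - s')) = \<bar>s - s'\<bar>"
    using e(1) by blast
qed

text \<open>Reversal sends \<open>{0..l}\<close> to itself and the velocity to its negative. It
  reduces every question about the end of an arc to its start.\<close>

lemma perp_to_boundary_reverse:
  assumes "perp_to_boundary P (l, c) t"
  shows "perp_to_boundary P (l, \<lambda>t. c (l - t)) (l - t)"
proof -
  obtain U \<phi> D where D: "hyp_chart P U \<phi>" "c t \<in> U" "\<phi> (c t) $ 1 = 0"
    "((\<lambda>s. \<phi> (c s)) has_vector_derivative D) (at t within {0..l})"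
    "\<forall>w. w$1 = 0 \<and> mink w (\<phi> (c t)) = 0 \<longrightarrow> mink D w = 0"
    using assms by (auto simp: perp_to_boundary_def)
  have im: "(\<lambda>s. l - s) ` {0..l} = {0..l}" by (auto simp: image_iff intro!: bexI[of _ "l - _"])
  have "((\<lambda>s. \<phi> (c s)) \<circ> (\<lambda>s. l - s) has_vector_derivative (- 1) *\<^sub>R D) (at (l - t) within {0..l})"
  proof (rule vector_diff_chain_within)
    show "((\<lambda>s. l - s) has_vector_derivative - 1) (at (l - t) within {0..l})"
      by (auto intro!: derivative_eq_intros)
    show "((\<lambda>s. \<phi> (c s)) has_vector_derivative D) (at (l - (l - t)) within (\<lambda>s. l - s) ` {0..l})"
      using D(4) im by simp
  qed
  then have "((\<lambda>s. \<phi> (c (l - s))) has_vector_derivative - D) (at (l - t) within {0..l})"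
    by (simp add: comp_def)
  then show ?thesis using D unfolding perp_to_boundary_def by (auto intro!: exI[of _ U] exI[of _ \<phi>] exI[of _ "- D"])
qed

context glued_hexagons
begin

text \<open>Copy \<open>b\<close> is unfolded to the nonpositive side of the mirror and the other
  copy to the nonnegative side, so the sign tells which fold to undo; on the mirror both answers
  agree.\<close>

lemma fold_hex_unfold:
  assumes "p \<in> P" "s \<in> mirrors"
  shows "mink (unfold b s p) (n s) \<le> 0 \<Longrightarrow> fold_hex p = unfold b s p"
    "mink (unfold b s p) (n s) \<ge> 0 \<Longrightarrow> fold_hex p = reflect (n s) (unfold b s p)"
proof -
  have us: "mink (n s) (n s) = 1" using assms by (auto simp: mirrors_lt_6 unit)
  have f: "mink (fold_hex p) (n s) \<le> 0" using H_D(2)[OF fold_in_H[OF assms(1)] mirrors_lt_6[OF assms(2)]] .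
  have m: "mink (reflect (n s) x) (n s) = - mink x (n s)" for x using us by (simp add: reflect_def)
  show "fold_hex p = unfold b s p" if "mink (unfold b s p) (n s) \<le> 0"
  proof (cases "p \<in> h b ` H")
    case False
    then have "mink (fold_hex p) (n s) = 0" using that f m by (simp add: unfold_def)
    then show ?thesis by (simp add: unfold_def reflect_perp)
  qed (simp add: unfold_def)
  show "fold_hex p = reflect (n s) (unfold b s p)" if "mink (unfold b s p) (n s) \<ge> 0"
  proof (cases "p \<in> h b ` H")
    case True
    then have "mink (fold_hex p) (n s) = 0" using that f by (simp add: unfold_def)
    then show ?thesis by (simp add: unfold_def reflect_perp)
  next
    case False
    then show ?thesis using us by (simp add: unfold_def)
  qed
qed

lemma geodesic_arc_in_chart:
  assumes arc: "geodesic_arc P (l, c)" and t: "t \<in> {0..l}"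
  obtains e b s p v where "e > 0" "chart_at (c t) e b s"
    "mink p p = -1" "mink v v = 1" "mink p v = 0"
    "\<And>u. u \<in> {0..l} \<inter> ball t e \<Longrightarrow> c u \<in> P \<inter> ball (c t) e \<and> unfold b s (c u) = geo p v u"
    "\<And>u u'. u \<in> {0..l} \<inter> ball t e \<Longrightarrow> u' \<in> {0..l} \<inter> ball t e \<Longrightarrow> dist (c u) (c u') = \<bar>u - u'\<bar>"
proof -
  have l: "l > 0" and cP: "c ` {0..l} \<subseteq> P" using arc by (auto simp: geodesic_arc_iff)
  obtain e1 where e1: "e1 > 0" "\<forall>s s'. s \<in> {0..l} \<inter> ball t e1 \<longrightarrow> s' \<in> {0..l} \<inter> ball t e1 \<longrightarrow> dist (c s) (c s') = \<bar>s - s'\<bar>"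
    using geodesic_arc_local[OF arc t] by (elim exE conjE)
  obtain e2 b s where e2: "chart_at (c t) e2 b s" using chart_at_exists cP t by blast
  define e where "e = min e1 e2"
  have e: "e > 0" "e \<le> e1" "e \<le> e2" using e1 e2 by (auto simp: e_def chart_at_def)
  have ch: "chart_at (c t) e b s" using e2 e unfolding chart_at_def by fastforce
  let ?S = "{0..l} \<inter> ball t e"
  have iso1: "dist (c u) (c u') = \<bar>u - u'\<bar>" if "u \<in> ?S" "u' \<in> ?S" for u u'
    using that e e1(2)[rule_format, of u u'] by auto
  have tS: "t \<in> ?S" using t e by simp
  have cS: "c u \<in> P \<inter> ball (c t) e" if "u \<in> ?S" for u
    using iso1[OF tS that] that cP by (auto simp: dist_real_def)
  have s: "s \<in> mirrors" using ch by (simp add: chart_at_def)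
  have iso2: "hdist (unfold b s (c u)) (unfold b s (c u')) = \<bar>u - u'\<bar>" if "u \<in> ?S" "u' \<in> ?S" for u u'
    using ch cS[OF that(1)] cS[OF that(2)] iso1[OF that] unfolding chart_at_def by fastforce
  obtain x y where xy: "x \<in> ?S" "y \<in> ?S" "x < y"
  proof (cases "t < l")
    case True
    have m: "min (t + e / 2) l \<in> ?S" using True e t by (auto simp: dist_real_def min_def)
    show ?thesis using True e by (intro that[OF tS m]) auto
  next
    case False
    have m: "max (t - e / 2) 0 \<in> ?S" using False e t l by (auto simp: dist_real_def max_def)
    show ?thesis using False e t l by (intro that[OF m tS]) auto
  qed
  have hp: "unfold b s (c u) \<in> hyp_plane" if "u \<in> ?S" for u
    using unfold_in_hyp_plane s cS[OF that] by blast
  obtain p v where pv: "mink p p = -1" "mink v v = 1" "mink p v = 0" "\<And>u. u \<in> ?S \<Longrightarrow> unfold b s (c u) = geo p v u"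
    using isometric_imp_geo[of ?S "\<lambda>u. unfold b s (c u)", OF iso2 hp xy] by metis
  show thesis using that[OF e(1) ch pv(1-3)] pv(4) cS iso1 by blast
qed

text \<open>In a chart the arc is one geodesic, and it can change sides of the mirror only at
  \<open>t\<close>. So its fold is one word up to \<open>t\<close> and another after it, each empty
  or the single letter \<open>s\<close>.\<close>

lemma fold_hex_arc_germ:
  assumes arc: "geodesic_arc P (l, c)" and t: "t \<in> {0..l}"
  obtains e p v w1 w2 where "e > 0" "set w1 \<subseteq> mirrors" "set w2 \<subseteq> mirrors"
    "\<And>u. u \<in> {0..l} \<inter> ball t e \<Longrightarrow> fold_hex (c u) = act (if u \<le> t then w1 else w2) (geo p v u)"
proof -
  obtain e b s p v where e: "e > 0" "chart_at (c t) e b s" and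
    pv: "\<And>u. u \<in> {0..l} \<inter> ball t e \<Longrightarrow> c u \<in> P \<inter> ball (c t) e \<and> unfold b s (c u) = geo p v u"
    using geodesic_arc_in_chart[OF arc t] by metis
  have s: "s \<in> mirrors" using e by (simp add: chart_at_def)
  consider "mink (fold_hex (c t)) (n s) = 0" | "\<forall>q\<in>P \<inter> ball (c t) e. q \<in> h b ` H"
    using e unfolding chart_at_def by blast
  then show thesis
  proof cases
    case 1
    \<comment> \<open>The velocity at \<open>t\<close> paired with the normal of the mirror; its
      sign decides on which side of \<open>t\<close> the reflection is applied.\<close>
    let ?K = "sinh t * mink p (n s) + cosh t * mink v (n s)"
    have "unfold b s (c t) = fold_hex (c t)" using e by (simp add: chart_at_def unfold_def)
    then have "mink (geo p v t) (n s) = 0" using 1 pv[of t] t e(1) by simp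
    note k = mink_geo_zero_at[OF this]
    have f: "fold_hex (c u) = (if sinh (u - t) * ?K \<le> 0 then geo p v u else reflect (n s) (geo p v u))"
      "sinh (u - t) * ?K \<ge> 0 \<Longrightarrow> fold_hex (c u) = reflect (n s) (geo p v u)"
      if "u \<in> {0..l} \<inter> ball t e" for u
      using fold_hex_unfold[of "c u" s b] pv[OF that] s k[of u] by auto
    show thesis
    proof (cases "?K \<ge> 0")
      case True
      have "fold_hex (c u) = act (if u \<le> t then [] else [s]) (geo p v u)" if "u \<in> {0..l} \<inter> ball t e" for u
      proof (cases "u \<le> t")
        case 2: True
        then have "sinh (u - t) * ?K \<le> 0" using True by (intro mult_nonpos_nonneg) auto
        then show ?thesis using f(1)[OF that] 2 by simp
      next
        case 2: False
        then have "sinh (u - t) * ?K \<ge> 0" using True by (intro mult_nonneg_nonneg) auto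
        then show ?thesis using f(2)[OF that] 2 by simp
      qed
      then show thesis using that[of e "[]" "[s]" p v] e s by simp
    next
      case False
      have "fold_hex (c u) = act (if u \<le> t then [s] else []) (geo p v u)" if "u \<in> {0..l} \<inter> ball t e" for u
      proof (cases "u \<le> t")
        case 2: True
        then have "sinh (u - t) * ?K \<ge> 0" using False by (intro mult_nonpos_nonpos) auto
        then show ?thesis using f(2)[OF that] 2 by simp
      next
        case 2: False
        then have "sinh (u - t) * ?K \<le> 0" using False by (intro mult_nonneg_nonpos) auto
        then show ?thesis using f(1)[OF that] 2 by simp
      qed
      then show thesis using that[of e "[s]" "[]" p v] e s by simp
    qed
  next
    case 2
    have "fold_hex (c u) = act (if u \<le> t then [] else []) (geo p v u)" if "u \<in> {0..l} \<inter> ball t e" for u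
      using pv[OF that] 2 by (auto simp: unfold_def)
    then show thesis using that[of e "[]" "[]" p v] e by simp
  qed
qed

text \<open>Away from the cuffs \<open>P\<close> has no boundary: every direction can be followed
  forwards and backwards. With negative \<open>t\<close> this extends an arc beyond its starting
  point.\<close>

lemma geodesic_in_chart_image:
  assumes ch: "chart_at o' e b s" and p: "p = unfold b s o'" "mink v v = 1" "mink p v = 0"
    and inner: "\<And>j. j \<in> cuffs \<Longrightarrow> mink p (n j) < 0"
  shows "\<forall>\<^sub>F t in nhds 0. \<exists>a\<in>P. unfold b s a = geo p v t \<and> dist a o' = \<bar>t\<bar>"
proof -
  obtain x where x: "x \<in> H" "o' = h b x" using ch by (auto simp: chart_at_def)
  have px: "p = x" "fold_hex o' = x" using x p by auto
  have s: "s \<in> mirrors" using ch by (simp add: chart_at_def)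
  have us: "mink (n s) (n s) = 1" using s by (auto simp: mirrors_lt_6 unit)
  have hp: "geo p v t \<in> hyp_plane" for t using x(1) p px by (intro geo_in_hyp_plane) (auto dest: H_D)
  have d: "hdist (geo p v t) x = \<bar>t\<bar>" for t
    using hdist_geo_geo[of p v t 0] H_D(1)[OF x(1)] p px by (simp add: hyp_planeD)
  have i6: "i < 6 \<Longrightarrow> i \<in> cuffs \<or> i \<in> mirrors" for i by (auto simp: cuffs_def mirrors_def)
  consider "mink x (n s) = 0" | "\<forall>s'\<in>mirrors. mink x (n s') < 0"
    using ch px unfolding chart_at_def by auto
  then show ?thesis
  proof cases
    case 2
    have "\<forall>\<^sub>F t in nhds 0. \<forall>i\<in>{..<6}. mink (geo p v t) (n i) < 0"
      using 2 inner px i6 by (intro eventually_ball_finite ballI eventually_mink_geo_neg) auto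
    then show ?thesis
    proof eventually_elim
      case (elim t)
      then have "geo p v t \<in> H" using hp by (intro H_I) (auto simp: less_imp_le)
      then show ?case using x iso[of "geo p v t" x b] d
        by (intro bexI[of _ "h b (geo p v t)"]) (auto intro: h_in_P)
    qed
  next
    case 1
    have neg: "mink x (n i) < 0" if "i < 6" "i \<noteq> s" for i
    proof (cases "i \<in> cuffs")
      case False
      then have "i \<in> mirrors" using i6 that by blast
      then have "mink x (n i) \<noteq> 0"
        using nonadjacent_disjoint[OF H_D(1)[OF x(1)], of s i] gram_mirrors[OF s] that 1 s by (simp add: mirrors_lt_6)
      then show ?thesis using H_D(2)[OF x(1) that(1)] by simp
    qed (use inner px in simp)
    have rx: "reflect (n s) x = x" using 1 by (rule reflect_perp)
    have "\<forall>\<^sub>F t in nhds 0. \<forall>i\<in>{..<6} - {s}. mink (geo p v t) (n i) < 0 \<and> mink (geo p (reflect (n s) v) t) (n i) < 0"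
      using neg px by (intro eventually_ball_finite ballI eventually_conj eventually_mink_geo_neg) auto
    then show ?thesis
    proof eventually_elim
      case (elim t)
      \<comment> \<open>The sought point is \<open>?y\<close> in copy \<open>b\<close> before the
        mirror, and the mirror image \<open>?z\<close> in the other copy beyond it.\<close>
      let ?y = "geo p v t" and ?z = "geo p (reflect (n s) v) t"
      have z: "?z = reflect (n s) ?y" using rx px by (simp add: reflect_geo)
      show ?case
      proof (cases "mink ?y (n s) \<le> 0")
        case True
        have "?y \<in> H"
        proof (rule H_I[OF hp])
          fix i :: nat assume "i < 6"
          then show "mink ?y (n i) \<le> 0" using elim True by (cases "i = s") (auto simp: less_imp_le)
        qed
        then show ?thesis using x iso[of ?y x b] d
          by (intro bexI[of _ "h b ?y"]) (auto intro: h_in_P)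
      next
        case False
        have zs: "mink ?z (n s) < 0" using False us unfolding z by (simp add: reflect_def)
        have zH: "?z \<in> H"
        proof (rule H_I)
          show "?z \<in> hyp_plane" unfolding z using us hp by (rule reflect_in_hyp_plane)
          fix i :: nat assume "i < 6"
          then show "mink ?z (n i) \<le> 0" using elim zs by (cases "i = s") (auto simp: less_imp_le)
        qed
        have "h (\<not> b) ?z \<notin> h b ` H"
        proof
          assume "h (\<not> b) ?z \<in> h b ` H"
          then obtain s' where "s' \<in> mirrors" "?z \<in> hex_side n s'"
            using h_other_D[of _ ?z b] zH by (metis imageE)
          then have s': "s' \<in> mirrors" "mink ?z (n s') = 0" by (auto simp: hex_side_def)
          have "s' = s \<or> mink ?z (n s') < 0" using elim mirrors_lt_6[OF s'(1)] by blast
          then show False using zs s'(2) by auto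
        qed
        then have "unfold b s (h (\<not> b) ?z) = ?y"
          using zH s us unfolding z by (subst unfold_h_other) auto
        moreover have "o' = h (\<not> b) x" using agree[OF s, of x b] x 1 by (simp add: hex_side_def)
        then have "dist (h (\<not> b) ?z) o' = hdist ?z x" using iso[OF zH x(1), of "\<not> b"] by simp
        moreover have "hdist ?z x = \<bar>t\<bar>" using hdist_reflect[OF us, of ?y x] rx d[of t] unfolding z by simp
        ultimately show ?thesis using zH by (intro bexI[of _ "h (\<not> b) ?z"]) (auto intro: h_in_P)
      qed
    qed
  qed
qed

lemma unfold_cuff_nonpos:
  assumes "a \<in> P" "s \<in> mirrors" "j \<in> cuffs"
  shows "mink (unfold b s a) (n j) \<le> 0"
proof -
  have "mink (reflect (n s) (fold_hex a)) (n j) \<le> mink (fold_hex a) (n j)"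
    using assms by (intro reflect_H_nonpos fold_in_H) (auto simp: cuffs_lt_6 dest: mirror_neq_cuff)
  then show ?thesis
    using H_D(2)[OF fold_in_H[OF assms(1)] cuffs_lt_6[OF assms(3)]] by (simp add: unfold_def)
qed

end

text \<open>In the half-plane chart the arc is a geodesic. Orthogonality to the boundary leaves two
  unit velocities, and staying in the half-plane selects the inward one.\<close>

lemma perp_velocity:
  assumes arc: "geodesic_arc P (l, c)" and U: "hyp_chart P U \<phi>" "c 0 \<in> U" "\<phi> (c 0) $ 1 = 0"
    and D: "((\<lambda>s. \<phi> (c s)) has_vector_derivative D) (at 0 within {0..l})"
      "\<forall>w. w$1 = 0 \<and> mink w (\<phi> (c 0)) = 0 \<longrightarrow> mink D w = 0"
  shows "\<exists>e>0. \<forall>u\<in>{0..l}. u < e \<longrightarrow> c u \<in> U \<and> \<phi> (c u) = geo (\<phi> (c 0)) (axis 1 1) u"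
proof -
  have l: "l > 0" and cP: "c ` {0..l} \<subseteq> P" using arc by (auto simp: geodesic_arc_iff)
  obtain e1 where e1: "e1 > 0" "\<forall>s s'. s \<in> {0..l} \<inter> ball 0 e1 \<longrightarrow> s' \<in> {0..l} \<inter> ball 0 e1 \<longrightarrow> dist (c s) (c s') = \<bar>s - s'\<bar>"
    using geodesic_arc_local[OF arc, of 0] l by auto
  obtain e2 where e2: "e2 > 0" "ball (c 0) e2 \<inter> P \<subseteq> U"
    using U unfolding hyp_chart_def openin_contains_ball by blast
  define e where "e = min e1 e2"
  let ?S = "{0..l} \<inter> ball 0 e"
  have e: "e > 0" "e \<le> e1" "e \<le> e2" using e1 e2 by (auto simp: e_def)
  have iso1: "dist (c u) (c u') = \<bar>u - u'\<bar>" if "u \<in> ?S" "u' \<in> ?S" for u u'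
    using that e e1(2)[rule_format, of u u'] by auto
  have z: "0 \<in> ?S" using l e by simp
  have cU: "c u \<in> U" if "u \<in> ?S" for u
  proof -
    have "dist (c 0) (c u) < e2" using iso1[OF z that] that e by (auto simp: dist_real_def)
    moreover have "c u \<in> P" using cP that by auto
    ultimately show ?thesis using e2(2) by auto
  qed
  let ?q = "\<phi> (c 0)"
  have Uh: "\<phi> x \<in> hyp_plane" "\<phi> x $ 1 \<ge> 0" if "x \<in> U" for x
    using U(1) that unfolding hyp_chart_def openin_subtopology hyp_halfplane_def by auto
  have iso2: "hdist (\<phi> (c u)) (\<phi> (c u')) = \<bar>u - u'\<bar>" if "u \<in> ?S" "u' \<in> ?S" for u u'
    using U(1) cU[OF that(1)] cU[OF that(2)] iso1[OF that] unfolding hyp_chart_def by simp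
  have m: "min (e / 2) l \<in> ?S" "0 < min (e / 2) l" using e l by (auto simp: dist_real_def min_def)
  obtain p v where pv: "mink p p = -1" "mink v v = 1" "mink p v = 0" "\<And>u. u \<in> ?S \<Longrightarrow> \<phi> (c u) = geo p v u"
    using isometric_imp_geo[of ?S "\<lambda>u. \<phi> (c u)", OF iso2 Uh(1)[OF cU] z m] by metis
  have pq: "p = ?q" using pv(4)[OF z] by simp
  have "((\<lambda>s. \<phi> (c s)) has_vector_derivative v) (at 0 within {0..l})"
  proof (rule has_vector_derivative_transform_within)
    show "((\<lambda>s. geo p v s) has_vector_derivative v) (at 0 within {0..l})"
      using geo_has_vector_derivative[of p v 0 "{0..l}"] by simp
    show "0 < e" "0 \<in> {0..l}" using e l by auto
    show "geo p v x = \<phi> (c x)" if "x \<in> {0..l}" "dist x 0 < e" for x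
      using pv(4)[of x] that by (simp add: dist_commute)
  qed
  from vector_derivative_unique_within[OF _ this D(1)]
  have vD: "v = D" using l by (simp add: at_within_Icc_at_right)
  have q: "?q \<in> hyp_plane" using Uh U by blast
  \<comment> \<open>Tangent at \<open>?q\<close> of the line bounding the half-plane, as
    \<open>?q\<close> has first coordinate 0.\<close>
  define w :: "real^3" where "w = vector [0, ?q$3, ?q$2]"
  have w: "w$1 = 0" "w$2 = ?q$3" "w$3 = ?q$2" by (simp_all add: w_def)
  have qq: "?q$3 * ?q$3 = 1 + ?q$2 * ?q$2" using hyp_planeD(1)[OF q] U(3) by (simp add: mink_def)
  have "mink w ?q = 0" using w U(3) by (simp add: mink_def)
  then have "mink v w = 0" using D(2) w(1) unfolding vD by blast
  then have vw: "v$2 * ?q$3 - v$3 * ?q$2 = 0" by (simp add: mink_def w)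
  have vq: "v$2 * ?q$2 - v$3 * ?q$3 = 0" using pv(3) pq U(3) by (simp add: mink_def algebra_simps)
  have "v$2 = 0" "v$3 = 0" using vw vq qq by algebra+
  moreover have "v$1 * v$1 = 1" using pv(2) calculation by (simp add: mink_def)
  moreover have "v$1 \<ge> 0"
  proof -
    let ?u = "min (e / 2) l"
    have "\<phi> (c ?u) $ 1 = sinh ?u * v$1" using pv(4)[OF m(1)] pq U(3) by (simp add: geo_def)
    moreover have "sinh ?u > 0" using m by simp
    ultimately show ?thesis using Uh(2)[OF cU[OF m(1)]] by (metis mult_pos_neg not_le)
  qed
  ultimately have "v$1 = 1" using power2_eq_1_iff[of "v$1"] by (auto simp: power2_eq_square)
  then have v: "v = axis 1 1" using \<open>v$2 = 0\<close> \<open>v$3 = 0\<close> by (intro vec3_eqI) (auto simp: axis_def)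
  show ?thesis
  proof (intro exI[of _ e] conjI ballI impI)
    fix u assume "u \<in> {0..l}" "u < e"
    then have "u \<in> ?S" by (auto simp: dist_real_def)
    then show "c u \<in> U" "\<phi> (c u) = geo ?q (axis 1 1) u" using cU pv(4) pq v by auto
  qed (rule e)
qed

section \<open>Lengths of orthogeodesics\<close>

context glued_hexagons
begin

text \<open>Transfers perpendicularity from the arbitrary half-plane chart of the definition to the
  unfolding. The charts are related only through distances, so everything is read off from isometric
  triples of points and one comparison of right angles.\<close>

lemma arc_start_on_cuff:
  assumes arc: "geodesic_arc P (l, c)" and perp: "perp_to_boundary P (l, c) 0"
  obtains e p w j where "e > 0" "j \<in> cuffs" "p \<in> hyp_plane" "mink p (n j) = 0" "set w \<subseteq> mirrors"
    "\<And>u. u \<in> {0..l} \<Longrightarrow> u < e \<Longrightarrow> fold_hex (c u) = act w (geo p (- n j) u)"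
proof -
  have l: "l > 0" and cP: "c ` {0..l} \<subseteq> P" using arc by (auto simp: geodesic_arc_iff)
  have "0 \<in> {0..l}" using l by simp
  from geodesic_arc_in_chart[OF arc this]
  obtain e1 b s p v where e1: "e1 > 0" and ch: "chart_at (c 0) e1 b s" and pv: "mink p p = -1" "mink v v = 1" "mink p v = 0"
    and g: "\<And>u. u \<in> {0..l} \<inter> ball 0 e1 \<Longrightarrow> c u \<in> P \<inter> ball (c 0) e1 \<and> unfold b s (c u) = geo p v u"
    and iso1: "\<And>u u'. u \<in> {0..l} \<inter> ball 0 e1 \<Longrightarrow> u' \<in> {0..l} \<inter> ball 0 e1 \<Longrightarrow> dist (c u) (c u') = \<bar>u - u'\<bar>"
    by metis
  obtain U \<phi> D where U: "hyp_chart P U \<phi>" "c 0 \<in> U" "\<phi> (c 0) $ 1 = 0"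
    and D: "((\<lambda>s. \<phi> (c s)) has_vector_derivative D) (at 0 within {0..l})"
      "\<forall>w. w$1 = 0 \<and> mink w (\<phi> (c 0)) = 0 \<longrightarrow> mink D w = 0"
    using perp by (auto simp: perp_to_boundary_def)
  define q where "q = \<phi> (c 0)"
  obtain e2 where e2: "e2 > 0" "\<forall>u\<in>{0..l}. u < e2 \<longrightarrow> c u \<in> U \<and> \<phi> (c u) = geo q (axis 1 1) u"
    using perp_velocity[OF arc U D] unfolding q_def by blast
  obtain e3 where e3: "e3 > 0" "ball (c 0) e3 \<inter> P \<subseteq> U"
    using U unfolding hyp_chart_def openin_contains_ball by blast
  have UP: "U \<subseteq> P" using U(1) unfolding hyp_chart_def openin_subtopology by auto
  have Uh: "\<phi> x \<in> hyp_plane" "\<phi> x $ 1 \<ge> 0" if "x \<in> U" for x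
    using U(1) that unfolding hyp_chart_def openin_subtopology hyp_halfplane_def by auto
  have Uiso: "hdist (\<phi> x) (\<phi> y) = dist x y" if "x \<in> U" "y \<in> U" for x y
    using U(1) that unfolding hyp_chart_def by blast
  define e where "e = min e1 (min e2 e3)"
  have e: "e > 0" "e \<le> e1" "e \<le> e2" "e \<le> e3" using e1 e2 e3 by (auto simp: e_def)
  define u1 where "u1 = min (e / 2) l"
  have u1: "u1 > 0" "u1 < e" "u1 \<in> {0..l}" using e l by (auto simp: u1_def min_def)
  have c0P: "c 0 \<in> P" using cP l by auto
  have s: "s \<in> mirrors" using ch by (simp add: chart_at_def)
  have p0: "p = unfold b s (c 0)" using g[of 0] e1 l by simp
  have ph: "p \<in> hyp_plane" using unfold_in_hyp_plane[OF c0P s] p0 by simp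
  have pf: "p = fold_hex (c 0)" using ch p0 by (simp add: chart_at_def unfold_def)
  have q: "q \<in> hyp_plane" "q$1 = 0" using Uh U by (auto simp: q_def)
  have ge: "unfold b s (c u) = geo p v u" "\<phi> (c u) = geo q (axis 1 1) u" "c u \<in> U" "c u \<in> P \<inter> ball (c 0) e1"
    if "u \<in> {0..l}" "u < e" for u
    using that e g[of u] e2(2) by auto
  have chiso: "hdist (unfold b s x) (unfold b s y) = dist x y" if "x \<in> P \<inter> ball (c 0) e1" "y \<in> P \<inter> ball (c 0) e1" for x y
    using ch that unfolding chart_at_def by blast
  have "\<exists>j\<in>cuffs. mink p (n j) = 0"
  proof (rule ccontr)
    assume "\<not> (\<exists>j\<in>cuffs. mink p (n j) = 0)"
    then have "mink p (n j) < 0" if "j \<in> cuffs" for j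
      using H_D(2)[OF fold_in_H[OF c0P] cuffs_lt_6[OF that]] that pf by (metis less_le)
    from geodesic_in_chart_image[OF ch p0 pv(2,3) this]
    obtain d where d: "d > 0" "\<And>t. dist t 0 < d \<Longrightarrow> \<exists>a\<in>P. unfold b s a = geo p v t \<and> dist a (c 0) = \<bar>t\<bar>"
      unfolding eventually_nhds_metric by blast
    \<comment> \<open>If the start were on no cuff, the arc could be prolonged backwards to
      \<open>a\<close>. The points at \<open>t\<close>, 0 and \<open>u1\<close> are isometric to a
      line, so \<open>\<phi> a\<close> has first coordinate \<open>sinh t < 0\<close>, outside the
      half-plane.\<close>
    define t where "t = - min (d / 2) (e / 2)"
    have t: "t < 0" "\<bar>t\<bar> < d" "\<bar>t\<bar> < e" using d(1) e(1) by (auto simp: t_def min_def)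
    then obtain a where a: "a \<in> P" "unfold b s a = geo p v t" "dist a (c 0) = \<bar>t\<bar>" using d(2)[of t] by (auto simp: dist_real_def)
    have aU: "a \<in> U" using e3(2) a t e by (auto simp: dist_commute)
    have aB: "a \<in> P \<inter> ball (c 0) e1" using a t e by (auto simp: dist_commute)
    define k where "k u = (if u = t then \<phi> a else \<phi> (c u))" for u
    let ?S = "{t, 0, u1}"
    have k: "k t = \<phi> a" "k 0 = \<phi> (c 0)" "k u1 = \<phi> (c u1)" using t u1 by (auto simp: k_def)
    have u0: "0 \<in> {0..l}" "0 < e" using l e by auto
    have d1: "dist a (c u) = \<bar>t - u\<bar>" if "u \<in> {0..l}" "u < e" for u
      using chiso[OF aB ge(4)[OF that]] a(2) ge(1)[OF that] hdist_geo_geo[OF pv, of t u] by simp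
    have d2: "dist (c u) (c u') = \<bar>u - u'\<bar>" if "u \<in> {0..l}" "u < e" "u' \<in> {0..l}" "u' < e" for u u'
      using chiso[OF ge(4)[OF that(1,2)] ge(4)[OF that(3,4)]] ge(1)[OF that(1,2)] ge(1)[OF that(3,4)] hdist_geo_geo[OF pv, of u u'] by simp
    have iso: "hdist (k x) (k y) = \<bar>x - y\<bar>" if "x \<in> ?S" "y \<in> ?S" for x y
    proof -
      have "hdist (\<phi> a) (\<phi> (c 0)) = \<bar>t - 0\<bar>" "hdist (\<phi> a) (\<phi> (c u1)) = \<bar>t - u1\<bar>" "hdist (\<phi> (c 0)) (\<phi> (c u1)) = \<bar>0 - u1\<bar>"
        using Uiso aU ge(3) d1 d2 u0 u1 by auto
      moreover have "hdist (\<phi> z) (\<phi> z) = 0" if "z \<in> U" for z using Uh[OF that] by simp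
      ultimately show ?thesis using that aU ge(3) u0 u1 k by (auto simp: hdist_commute abs_minus_commute)
    qed
    have kh: "k x \<in> hyp_plane" if "x \<in> ?S" for x using that aU Uh ge(3) u0 u1 k by auto
    obtain p' v' where p': "\<And>x. x \<in> ?S \<Longrightarrow> k x = geo p' v' x"
      using isometric_imp_geo[of ?S k 0 u1, OF iso kh] u1 by blast
    have "geo p' v' 0 = geo q (axis 1 1) 0" "geo p' v' u1 = geo q (axis 1 1) u1"
      using p'[of 0] p'[of u1] k ge(2)[of 0] ge(2)[of u1] u0 u1 by auto
    then have "p' = q" "v' = axis 1 1" using geo_eqD[of p' v' 0 q "axis 1 1" u1] u1 by auto
    then have "\<phi> a = geo q (axis 1 1) t" using p'[of t] k by simp
    then have "\<phi> a $ 1 = sinh t" using q by (simp add: geo_def axis_def)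
    then show False using Uh(2)[OF aU] t by simp
  qed
  then obtain j where j: "j \<in> cuffs" "mink p (n j) = 0" by blast
  have uj: "mink (n j) (n j) = 1" using j by (simp add: unit cuffs_lt_6)
  \<comment> \<open>Unit tangent of the bounding line at \<open>q\<close>. Both directions along it
    stay in the half-plane, hence in the open image of \<open>U\<close> for small
    parameters.\<close>
  define E :: "real^3" where "E = vector [0, q$3, q$2]"
  have E: "E$1 = 0" "E$2 = q$3" "E$3 = q$2" by (simp_all add: E_def)
  have qq: "q$3 * q$3 = 1 + q$2 * q$2" using hyp_planeD(1)[OF q(1)] q(2) by (simp add: mink_def)
  have EE: "mink E E = 1" "mink q E = 0" using E qq q(2) by (auto simp: mink_def)
  have Eh: "geo q E u \<in> hyp_halfplane" for u
    using geo_in_hyp_plane[OF q(1) EE, of u] q(2) E by (simp add: hyp_halfplane_def geo_def)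
  obtain V where V: "open V" "\<phi> ` U = hyp_halfplane \<inter> V" using U(1) unfolding hyp_chart_def openin_open by blast
  have "open ((\<lambda>u. geo q E u) -` V)"
    using V(1) by (intro open_vimage continuous_on_geo)
  moreover have "0 \<in> (\<lambda>u. geo q E u) -` V" using V(2) U(2) by (auto simp: q_def)
  ultimately obtain d where d: "d > 0" "ball 0 d \<subseteq> (\<lambda>u. geo q E u) -` V" by (meson open_contains_ball)
  define d' where "d' = min d e / 2"
  have d': "d' > 0" "d' < d" "d' < e" using d(1) e(1) by (auto simp: d'_def min_def)
  let ?S = "{-d', 0, d'}"
  have "\<exists>x\<in>U. \<phi> x = geo q E u" if "u \<in> ?S" for u
  proof -
    have "u \<in> ball 0 d" using that d' d by auto
    then have "geo q E u \<in> hyp_halfplane \<inter> V" using d(2) Eh by blast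
    then show ?thesis unfolding V(2)[symmetric] by auto
  qed
  then obtain x where x: "\<And>u. u \<in> ?S \<Longrightarrow> x u \<in> U \<and> \<phi> (x u) = geo q E u" by metis
  have qE: "mink q q = -1" "mink E E = 1" "mink q E = 0" using hyp_planeD(1)[OF q(1)] EE by auto
  have x0: "x 0 = c 0"
  proof -
    have "dist (x 0) (c 0) = hdist (\<phi> (x 0)) (\<phi> (c 0))" using Uiso[of "x 0" "c 0"] x[of 0] U(2) by simp
    also have "\<dots> = 0" using x[of 0] q(1) by (simp add: q_def)
    finally show ?thesis by simp
  qed
  have xiso: "dist (x u) (x u') = \<bar>u - u'\<bar>" if "u \<in> ?S" "u' \<in> ?S" for u u'
    using Uiso[of "x u" "x u'"] x[OF that(1)] x[OF that(2)] hdist_geo_geo[OF qE, of u u'] by simp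
  have xB: "x u \<in> P \<inter> ball (c 0) e1" if "u \<in> ?S" for u
    using xiso[of 0 u] that x[OF that] UP x0 d' e by auto
  have hiso: "hdist (unfold b s (x u)) (unfold b s (x u')) = \<bar>u - u'\<bar>" if "u \<in> ?S" "u' \<in> ?S" for u u'
    using chiso[OF xB[OF that(1)] xB[OF that(2)]] xiso[OF that] by simp
  have hh: "unfold b s (x u) \<in> hyp_plane" if "u \<in> ?S" for u
    using unfold_in_hyp_plane[OF _ s] xB[OF that] by blast
  obtain p' T where T: "mink p' p' = -1" "mink T T = 1" "mink p' T = 0" "\<And>u. u \<in> ?S \<Longrightarrow> unfold b s (x u) = geo p' T u"
    using isometric_imp_geo[of ?S "\<lambda>u. unfold b s (x u)" 0 d', OF hiso hh] d' by blast
  have pp: "p' = p" using T(4)[of 0] x0 p0 by simp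
  have nonpos: "mink (geo p T u) (n j) \<le> 0" if "u \<in> ?S" for u
  proof -
    have "mink (unfold b s (x u)) (n j) \<le> 0" using xB[OF that] by (intro unfold_cuff_nonpos s j(1)) auto
    then show ?thesis using T(4)[OF that] pp by metis
  qed
  \<comment> \<open>\<open>T\<close> is the boundary direction seen in the unfolding. Moving either
    way from a point of the cuff never crosses it, so \<open>T\<close> is tangent to the
    cuff.\<close>
  have "sinh d' * mink T (n j) \<le> 0" "- (sinh d' * mink T (n j)) \<le> 0"
    using nonpos[of d'] nonpos[of "-d'"] j(2) by (simp_all add: mink_geo)
  then have Tj: "mink T (n j) = 0" using d' by simp
  \<comment> \<open>One distance between the arc and the boundary, measured in both charts: the law
    of cosines shows that the right angle is preserved.\<close>
  have "mink T v = 0"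
  proof -
    have axE: "mink (axis 1 1) E = 0" "mink q (axis 1 1) = 0" using E q by (simp_all add: mink_def axis_def)
    have u1': "u1 \<in> {0..l}" "u1 < e" using u1 by auto
    have "hdist (\<phi> (c u1)) (\<phi> (x d')) = hdist (unfold b s (c u1)) (unfold b s (x d'))"
      using Uiso[of "c u1" "x d'"] chiso[OF ge(4)[OF u1'] xB[of d']] ge(3)[OF u1'] x[of d'] by simp
    then have "hdist (geo q (axis 1 1) u1) (geo q E d') = hdist (geo p v u1) (geo p T d')"
      using ge(1,2)[OF u1'] x[of d'] T(4)[of d'] pp by simp
    moreover have hp: "geo q (axis 1 1) u1 \<in> hyp_plane" "geo q E d' \<in> hyp_plane" "geo p v u1 \<in> hyp_plane" "geo p T d' \<in> hyp_plane"
      using ge(1,2)[OF u1'] Uh(1)[OF ge(3)[OF u1']] Eh[of d'] geo_in_hyp_plane[OF ph pv(2,3)] geo_in_hyp_plane[OF ph T(2)] T(3) pp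
      by (auto simp: hyp_halfplane_def)
    ultimately have "mink (geo q (axis 1 1) u1) (geo q E d') = mink (geo p v u1) (geo p T d')"
      using cosh_hdist[OF hp(1,2)] cosh_hdist[OF hp(3,4)] by simp
    moreover have "mink (geo q (axis 1 1) u1) (geo q E d') = - cosh u1 * cosh d'"
      using qE axE mink_commute[of "axis 1 1" q] by (simp add: geo_def)
    moreover have "mink (geo p v u1) (geo p T d') = - cosh u1 * cosh d' + sinh u1 * sinh d' * mink T v"
      using pv T pp mink_commute[of v p] mink_commute[of v T] by (simp add: geo_def)
    ultimately show ?thesis using u1 d' by simp
  qed
  have expv: "v = mink v (n j) *\<^sub>R n j"
    using mink_orthonormal_expansion[of p T "n j" v] pv(1,3) T(2,3) uj j(2) Tj pp \<open>mink T v = 0\<close>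
      mink_commute[of v p] mink_commute[of v T] by simp
  have "mink v v = mink v (n j) * mink v (n j)" by (subst (2) expv) simp
  then have sq: "(mink v (n j))\<^sup>2 = 1" using pv(2) by (simp add: power2_eq_square)
  have "mink (unfold b s (c u1)) (n j) \<le> 0" using ge(4)[OF u1(3,2)] by (intro unfold_cuff_nonpos s j(1)) auto
  then have "mink (geo p v u1) (n j) \<le> 0" unfolding ge(1)[OF u1(3,2)] .
  then have "sinh u1 * mink v (n j) \<le> 0" using j(2) by (simp add: mink_geo)
  moreover have "sinh u1 > 0" using u1 by simp
  ultimately have "mink v (n j) \<le> 0" by (simp add: mult_le_0_iff)
  then have "mink v (n j) = -1" using sq by (auto simp: power2_eq_1_iff)
  then have v: "v = - n j" using expv by simp
  consider "mink p (n s) = 0" | "\<forall>x\<in>P \<inter> ball (c 0) e1. x \<in> h b ` H"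
    using ch pf unfolding chart_at_def by blast
  then show thesis
  proof cases
    case 1
    \<comment> \<open>The sign known here puts the unfolded arc on the nonnegative side, so one
      reflection is applied; along the mirror it acts trivially.\<close>
    have "fold_hex (c u) = act [s] (geo p (- n j) u)" if u: "u \<in> {0..l}" "u < e" for u
    proof -
      have "sinh u * mink (- n j) (n s) \<ge> 0"
        using cuff_mirror_nonpos[OF j(1) s] u by (intro mult_nonneg_nonneg) auto
      then have "mink (unfold b s (c u)) (n s) \<ge> 0" using ge(1)[OF u] 1 v by (simp add: mink_geo)
      then show ?thesis using fold_hex_unfold(2)[of "c u" s b] ge(1,4)[OF u] v s by simp
    qed
    then show thesis using that[OF e(1) j(1) ph j(2), of "[s]"] s by simp
  next
    case 2
    have "fold_hex (c u) = act [] (geo p (- n j) u)" if u: "u \<in> {0..l}" "u < e" for u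
      using ge(1,4)[OF u] 2 v by (auto simp: unfold_def)
    then show thesis using that[OF e(1) j(1) ph j(2), of "[]"] by simp
  qed
qed

text \<open>Connectedness of \<open>{0<..l}\<close> propagates one pair \<open>p\<close>,
  \<open>v\<close> along the arc: where two germs overlap they agree at two parameters, hence as
  geodesics, and the discrepancy is absorbed by the word.\<close>

lemma fold_hex_arc_continuation:
  assumes arc: "geodesic_arc P (l, c)"
    and start: "e > 0" "set w \<subseteq> mirrors" "\<And>u. u \<in> {0..l} \<Longrightarrow> u < e \<Longrightarrow> fold_hex (c u) = act w (geo p v u)"
  obtains e' w' where "e' > 0" "set w' \<subseteq> mirrors" "\<And>u. u \<in> {0..l} \<Longrightarrow> l - e' < u \<Longrightarrow> fold_hex (c u) = act w' (geo p v u)"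
proof -
  have l: "l > 0" using arc by (simp add: geodesic_arc_iff)
  \<comment> \<open>Left neighbourhoods only, because the word may change at \<open>t\<close>
    itself.\<close>
  define Q where "Q t \<longleftrightarrow> (\<exists>w. set w \<subseteq> mirrors \<and> (\<exists>e>0. \<forall>u\<in>{0..l}. t - e < u \<and> u \<le> t \<longrightarrow> fold_hex (c u) = act w (geo p v u)))" for t
  have "Q l"
  proof (rule connected_induction_simple[where S = "{0<..l}" and P = Q and a = "min (e / 2) l"])
    show "connected {0<..l}" by simp
    show "min (e / 2) l \<in> {0<..l}" "l \<in> {0<..l}" using l start by auto
    show "Q (min (e / 2) l)"
      unfolding Q_def using start by (intro exI[of _ w] conjI exI[of _ e]) auto
    fix t assume t: "t \<in> {0<..l}"
    then have "t \<in> {0..l}" by simp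
    from fold_hex_arc_germ[OF arc this]
    obtain d p' v' w1 w2 where d: "d > 0" "set w1 \<subseteq> mirrors" "set w2 \<subseteq> mirrors"
      and g: "\<And>u. u \<in> {0..l} \<inter> ball t d \<Longrightarrow> fold_hex (c u) = act (if u \<le> t then w1 else w2) (geo p' v' u)" by metis
    define W where "W x = (if x \<le> t then w1 else w2)" for x
    have W: "set (W x) \<subseteq> mirrors" for x using d by (simp add: W_def)
    have left: "\<exists>r>0. r < x \<and> (\<forall>u. x - r < u \<and> u \<le> x \<longrightarrow> fold_hex (c u) = act (W x) (geo p' v' u))"
      if x: "x \<in> {0<..l} \<inter> ball t d" for x
    proof -
      define r where "r = min (x / 2) (if x \<le> t then d - (t - x) else x - t)"
      have r: "r > 0" "r < x" using x by (auto simp: r_def dist_real_def)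
      have "fold_hex (c u) = act (W x) (geo p' v' u)" if u: "x - r < u" "u \<le> x" for u
      proof -
        have "u \<in> {0..l} \<inter> ball t d" "u \<le> t \<longleftrightarrow> x \<le> t"
          using u x r by (auto simp: r_def dist_real_def split: if_splits)
        then show ?thesis using g[of u] by (simp add: W_def)
      qed
      then show ?thesis using r by blast
    qed
    show "\<exists>T. openin (top_of_set {0<..l}) T \<and> t \<in> T \<and> (\<forall>x\<in>T. \<forall>y\<in>T. Q x \<longrightarrow> Q y)"
    proof (intro exI[of _ "{0<..l} \<inter> ball t d"] conjI ballI impI)
      show "openin (top_of_set {0<..l}) ({0<..l} \<inter> ball t d)" by (intro openin_open_Int) auto
      show "t \<in> {0<..l} \<inter> ball t d" using t d by simp
      fix x y assume x: "x \<in> {0<..l} \<inter> ball t d" and y: "y \<in> {0<..l} \<inter> ball t d" and "Q x"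
      then obtain w0 r0 where w0: "set w0 \<subseteq> mirrors" "r0 > 0"
        "\<forall>u\<in>{0..l}. x - r0 < u \<and> u \<le> x \<longrightarrow> fold_hex (c u) = act w0 (geo p v u)" unfolding Q_def by blast
      obtain r where r: "r > 0" "r < x" "\<forall>u. x - r < u \<and> u \<le> x \<longrightarrow> fold_hex (c u) = act (W x) (geo p' v' u)"
        using left[OF x] by blast
      define u2 where "u2 = x - min r r0 / 2"
      have u2: "x - r < u2" "x - r0 < u2" "u2 < x" "u2 \<in> {0..l}" using r w0(2) x by (auto simp: u2_def min_def)
      have eq: "geo (act w0 p) (act w0 v) u = geo (act (W x) p') (act (W x) v') u" if "u \<in> {u2, x}" for u
      proof -
        have u: "u \<in> {0..l}" "x - r0 < u \<and> u \<le> x" "x - r < u \<and> u \<le> x"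
          using that u2 x w0(2) r(1) by auto
        show ?thesis using w0(3) r(3) u unfolding act_geo[symmetric] by metis
      qed
      have pv: "act w0 p = act (W x) p'" "act w0 v = act (W x) v'"
        using geo_eqD[OF eq[of u2] eq[of x]] u2 by auto
      \<comment> \<open>The germ's own geodesic is rewritten as a word applied to the original
        \<open>p\<close> and \<open>v\<close>.\<close>
      have pv': "p' = act (rev (W x) @ w0) p" "v' = act (rev (W x) @ w0) v"
        using act_rev[OF W[of x]] pv by simp_all
      obtain r' where r': "r' > 0" "\<forall>u. y - r' < u \<and> u \<le> y \<longrightarrow> fold_hex (c u) = act (W y) (geo p' v' u)"
        using left[OF y] by blast
      have "act (W y) (geo p' v' u) = act (W y @ rev (W x) @ w0) (geo p v u)" for u
        unfolding pv' by (simp add: act_geo)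
      then show "Q y" unfolding Q_def
        using r' W w0(1) by (intro exI[of _ "W y @ rev (W x) @ w0"] conjI exI[of _ r']) auto
    qed
  qed
  then show thesis using that unfolding Q_def by (metis atLeastAtMost_iff)
qed

text \<open>The arc is followed from the start and, reversed, from the end. Near the end both
  describe one geodesic; equating velocities writes \<open>n i\<close> as a word applied to a vector
  \<open>m\<close> with \<open>mink m (n j) = - cosh l\<close>.\<close>

theorem cosh_orthogeodesic_length:
  assumes "orthogeodesic P (l, c)"
  shows "\<exists>i\<in>cuffs. \<exists>j\<in>cuffs. \<exists>w. set w \<subseteq> mirrors \<and> cosh l = - mink (n i) (act w (n j))"
proof -
  have arc: "geodesic_arc P (l, c)" and perp: "perp_to_boundary P (l, c) 0" "perp_to_boundary P (l, c) l"
    using assms by (auto simp: orthogeodesic_def)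
  have l: "l > 0" using arc by (simp add: geodesic_arc_iff)
  obtain e p w i where i: "e > 0" "i \<in> cuffs" "p \<in> hyp_plane" "mink p (n i) = 0" "set w \<subseteq> mirrors"
    and gi: "\<And>u. u \<in> {0..l} \<Longrightarrow> u < e \<Longrightarrow> fold_hex (c u) = act w (geo p (- n i) u)"
    using arc_start_on_cuff[OF arc perp(1)] by metis
  obtain e1 w1 where w1: "e1 > 0" "set w1 \<subseteq> mirrors" "\<And>u. u \<in> {0..l} \<Longrightarrow> l - e1 < u \<Longrightarrow> fold_hex (c u) = act w1 (geo p (- n i) u)"
    using fold_hex_arc_continuation[OF arc i(1,5) gi] by metis
  obtain e2 q w2 j where j: "e2 > 0" "j \<in> cuffs" "q \<in> hyp_plane" "mink q (n j) = 0" "set w2 \<subseteq> mirrors"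
    and gj: "\<And>u. u \<in> {0..l} \<Longrightarrow> u < e2 \<Longrightarrow> fold_hex (c (l - u)) = act w2 (geo q (- n j) u)"
    using arc_start_on_cuff[OF geodesic_arc_reverse[OF arc] perp_to_boundary_reverse[OF perp(2), unfolded diff_self]] by metis
  \<comment> \<open>Position and velocity, at distance \<open>l\<close>, of the perpendicular
    leaving cuff \<open>j\<close> at \<open>q\<close>.\<close>
  define q' where "q' = cosh l *\<^sub>R q - sinh l *\<^sub>R n j"
  define m where "m = sinh l *\<^sub>R q - cosh l *\<^sub>R n j"
  have flip: "geo q (- n j) (l - u) = geo q' (- m) u" for u
    unfolding q'_def m_def geo_flip by simp
  define u1 where "u1 = l - min (min e1 e2) l / 2"
  have u1: "u1 \<in> {0..l}" "l - e1 < u1" "l - u1 < e2" "u1 < l" using w1(1) j(1) l by (auto simp: u1_def min_def)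
  have eq: "geo (act w1 p) (act w1 (- n i)) u = geo (act w2 q') (act w2 (- m)) u" if "u \<in> {u1, l}" for u
  proof -
    have u: "u \<in> {0..l}" "l - e1 < u" "l - u \<in> {0..l}" "l - u < e2" using that u1 w1(1) j(1) l by auto
    have "act w1 (geo p (- n i) u) = act w2 (geo q (- n j) (l - u))"
      using w1(3)[OF u(1,2)] gj[OF u(3,4)] by simp
    then show ?thesis unfolding flip act_geo .
  qed
  have "act w1 (- n i) = act w2 (- m)" using geo_eqD(2)[OF eq[of u1] eq[of l]] u1 by auto
  then have "act w1 ((-1) *\<^sub>R n i) = act w2 ((-1) *\<^sub>R m)" by simp
  then have "act w1 (n i) = act w2 m" unfolding act_linear by simp
  then have ni: "n i = act (rev w1 @ w2) m" using act_rev[OF w1(2), of "n i"] by simp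
  have W: "set (rev w1 @ w2) \<subseteq> mirrors" using w1 j by auto
  have "mink (n i) (act (rev w1 @ w2) (n j)) = mink m (n j)"
    by (subst ni) (rule mink_act[OF W])
  also have "\<dots> = - cosh l" using j(2,4) by (simp add: m_def unit cuffs_lt_6)
  finally show ?thesis
    using i(2) j(2) W by (intro bexI[of _ i] bexI[of _ j] exI[of _ "rev w1 @ w2"] conjI) auto
qed

end

section \<open>Realising palindromes by orthogeodesics\<close>

lemma mink_orthonormal_complement:
  assumes "mink p p = -1" "mink e e = 1" "mink p e = 0"
  obtains B where "mink B B = 1" "mink p B = 0" "mink e B = 0"
proof -
  \<comment> \<open>The Lorentzian cross product of \<open>e\<close> and \<open>p\<close>.\<close>
  define B :: "real^3" where "B = vector [e$2 * p$3 - e$3 * p$2, e$3 * p$1 - e$1 * p$3, e$2 * p$1 - e$1 * p$2]"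
  have B: "B$1 = e$2 * p$3 - e$3 * p$2" "B$2 = e$3 * p$1 - e$1 * p$3" "B$3 = e$2 * p$1 - e$1 * p$2"
    by (simp_all add: B_def)
  have "mink p B = 0" "mink e B = 0" unfolding mink_def B by algebra+
  moreover have "mink B B = (mink p e)\<^sup>2 - mink e e * mink p p" unfolding mink_def B by algebra
  ultimately show thesis using assms that by simp
qed

context glued_hexagons
begin

text \<open>Supplies the half-plane chart demanded by \<open>perp_to_boundary\<close> at an interior
  point of a cuff; there the perpendicular runs along the first coordinate direction.\<close>

lemma chart_at_cuff:
  assumes j: "j \<in> cuffs" and p: "p \<in> H" "mink p (n j) = 0"
    and inner: "\<And>i. i < 6 \<Longrightarrow> i \<noteq> j \<Longrightarrow> mink p (n i) < 0"
    and e: "e > 0" "l > 0" "\<And>t. t \<in> {0..l} \<Longrightarrow> t < e \<Longrightarrow> geo p (- n j) t \<in> H \<and> c t = h b (geo p (- n j) t)"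
  shows "perp_to_boundary P (l, c) 0"
proof -
  let ?e = "n j"
  have j6: "j < 6" using j by (rule cuffs_lt_6)
  have ee: "mink ?e ?e = 1" using j6 by (rule unit)
  have ph: "p \<in> hyp_plane" and pp: "mink p p = -1" using p(1) by (auto dest: H_D simp: hyp_planeD)
  obtain B where B: "mink B B = 1" "mink p B = 0" "mink ?e B = 0"
    using mink_orthonormal_complement[OF pp ee p(2)] .
  have sym: "mink B p = 0" "mink B ?e = 0" "mink ?e p = 0" using B p(2) by (simp_all add: mink_commute)
  \<comment> \<open>The Lorentz transformation to coordinates in the frame \<open>- n j\<close>,
    \<open>B\<close>, \<open>p\<close>; it carries the cuff to first coordinate 0 and
    \<open>H\<close> to its nonnegative side. \<open>N\<close> is the inverse.\<close>
  define M :: "real^3 \<Rightarrow> real^3" where "M x = vector [- mink x ?e, mink x B, - mink x p]" for x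
  have M: "M x $ 1 = - mink x ?e" "M x $ 2 = mink x B" "M x $ 3 = - mink x p" for x by (simp_all add: M_def)
  define N :: "real^3 \<Rightarrow> real^3" where "N y = - y$1 *\<^sub>R ?e + y$2 *\<^sub>R B + y$3 *\<^sub>R p" for y
  note expansion = mink_orthonormal_expansion[OF pp B(1) ee B(2) p(2) sym(2)]
  have NM: "N (M x) = x" for x
  proof -
    have "N (M x) = - mink x p *\<^sub>R p + mink x B *\<^sub>R B + mink x ?e *\<^sub>R ?e" by (simp add: N_def M)
    also have "\<dots> = x" by (rule expansion[symmetric])
    finally show ?thesis .
  qed
  have MN: "M (N y) = y" for y
    using ee B pp p(2) sym by (intro vec3_eqI) (simp_all add: M N_def)
  have mM: "mink (M x) (M y) = mink x y" for x y
  proof -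
    have "mink x y = mink x (- mink y p *\<^sub>R p + mink y B *\<^sub>R B + mink y ?e *\<^sub>R ?e)"
      using expansion[of y] by metis
    then show ?thesis by (simp add: mink_def[of "M x"] M algebra_simps)
  qed
  \<comment> \<open>The hexagon without its sides other than \<open>j\<close>. Its image is open in
    \<open>P\<close>, being the complement of the closed other copy and of five closed
    sides.\<close>
  define A where "A = {x \<in> H. \<forall>i<6. i \<noteq> j \<longrightarrow> mink x (n i) < 0}"
  define U where "U = h b ` A"
  define \<phi> where "\<phi> q = M (fold_hex q)" for q
  have \<phi>: "\<phi> (h b x) = M x" if "x \<in> H" for x using that by (simp add: \<phi>_def)
  have AH: "A \<subseteq> H" by (auto simp: A_def)
  have mh: "M x \<in> hyp_plane" if "x \<in> hyp_plane" for x
    using that mM[of x x] mink_hyp_plane_le[OF that ph] by (simp add: hyp_plane_def M)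
  have chart: "hyp_chart P U \<phi>"
    unfolding hyp_chart_def
  proof (intro conjI ballI)
    let ?C = "h (\<not> b) ` H \<union> (\<Union>i\<in>{..<6} - {j}. h b ` hex_side n i)"
    have "closed ?C"
      by (intro closed_Un closed_UN ballI closed_h_image closed_hex_region closed_hex_side) (auto dest: side_D)
    moreover have "U = P \<inter> - ?C"
    proof (intro equalityI subsetI)
      fix q assume "q \<in> U"
      then obtain x where x: "x \<in> A" "q = h b x" by (auto simp: U_def)
      then have xH: "x \<in> H" using AH by blast
      have "q \<notin> h (\<not> b) ` H"
      proof
        assume "q \<in> h (\<not> b) ` H"
        then obtain y where "y \<in> H" "h b x = h (\<not> b) y" using x(2) by (metis imageE)
        from h_other_D(2)[OF xH this] obtain s where "s \<in> mirrors" "x \<in> hex_side n s" by blast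
        then have "s < 6" "s \<noteq> j" "mink x (n s) = 0"
          using mirror_neq_cuff[OF _ j] by (auto simp: hex_side_def mirrors_lt_6)
        then show False using x(1) by (auto simp: A_def)
      qed
      moreover have "q \<notin> h b ` hex_side n i" if "i \<in> {..<6} - {j}" for i
      proof
        assume "q \<in> h b ` hex_side n i"
        then obtain y where y: "y \<in> hex_side n i" "h b x = h b y" using x(2) by (metis imageE)
        have "x = y" using xH side_D(1)[OF y(1)] y(2) by (rule h_inj)
        then have "mink x (n i) = 0" using side_D(2)[OF y(1)] by simp
        then show False using that x(1) by (auto simp: A_def)
      qed
      moreover have "q \<in> P" using x(2) h_in_P[OF xH] by simp
      ultimately show "q \<in> P \<inter> - ?C" by simp
    next
      fix q assume q: "q \<in> P \<inter> - ?C"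
      then obtain x where x: "x \<in> H" "q = h b x" using cover[of b] by blast
      have "mink x (n i) < 0" if i: "i < 6" "i \<noteq> j" for i
      proof -
        have "mink x (n i) \<noteq> 0" using q x i by (auto simp: hex_side_def)
        then show ?thesis using H_D(2)[OF x(1) i(1)] by simp
      qed
      then show "q \<in> U" using x by (auto simp: U_def A_def)
    qed
    ultimately show "openin (top_of_set P) U" by (auto simp: openin_open)
    let ?V = "\<Inter>i\<in>{..<6} - {j}. {y. mink (N y) (n i) < 0}"
    have "open ?V" unfolding N_def by (intro open_INT ballI open_Collect_less continuous_intros) auto
    moreover have "\<phi> ` U = hyp_halfplane \<inter> ?V"
    proof (intro equalityI subsetI)
      fix y assume "y \<in> \<phi> ` U"
      then obtain x where x: "x \<in> A" "y = M x" using \<phi> AH by (auto simp: U_def)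
      then have "x \<in> H" using AH by blast
      then have "M x \<in> hyp_halfplane"
        using mh[of x] H_D(2)[OF _ j6, of x] by (simp add: hyp_halfplane_def M H_D)
      then show "y \<in> hyp_halfplane \<inter> ?V" using x by (auto simp: NM A_def)
    next
      fix y assume y: "y \<in> hyp_halfplane \<inter> ?V"
      have "N y \<in> hyp_plane"
      proof (rule hyp_planeI[OF _ _ ph])
        show "mink (N y) (N y) = -1" using mM[of "N y" "N y"] y by (simp add: MN hyp_halfplane_def hyp_planeD)
        have "mink (N y) p = - y$3" using M(3)[of "N y"] by (simp add: MN)
        then show "mink (N y) p < 0" using y by (simp add: hyp_halfplane_def hyp_planeD)
      qed
      moreover have "mink (N y) ?e \<le> 0" using M(1)[of "N y"] y by (simp add: MN hyp_halfplane_def)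
      moreover have "mink (N y) (n i) < 0" if "i < 6" "i \<noteq> j" for i using y that by auto
      ultimately have "N y \<in> A" unfolding A_def by (auto intro!: H_I) (metis less_imp_le)
      then show "y \<in> \<phi> ` U" using \<phi>[of "N y"] AH MN[of y] by (auto simp: U_def image_iff intro!: bexI[of _ "N y"])
    qed
    ultimately show "openin (top_of_set hyp_halfplane) (\<phi> ` U)" by (auto simp: openin_open)
    fix q q' assume "q \<in> U" "q' \<in> U"
    then obtain x y where "x \<in> H" "y \<in> H" "q = h b x" "q' = h b y" using AH by (auto simp: U_def)
    then show "hdist (\<phi> q) (\<phi> q') = dist q q'" using iso[of x y b] mM[of x y] by (simp add: \<phi> hdist_def)
  qed
  have Mgeo: "M (geo p (- ?e) t) = geo (axis 3 1) (axis 1 1) t" for t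
    using pp ee p(2) B sym by (intro vec3_eqI) (simp_all add: M mink_geo, simp_all add: geo_def axis_def)
  have c0: "c 0 = h b p" using e by force
  have pA: "p \<in> A" using p inner by (simp add: A_def)
  have \<phi>0: "\<phi> (c 0) = axis 3 1" using Mgeo[of 0] \<phi>[OF p(1)] c0 by simp
  have "((\<lambda>t. \<phi> (c t)) has_vector_derivative axis 1 1) (at 0 within {0..l})"
  proof (rule has_vector_derivative_transform_within)
    show "(geo (axis 3 1) (axis 1 1) has_vector_derivative axis 1 1) (at 0 within {0..l})"
      using geo_has_vector_derivative[of "axis 3 1" "axis 1 1" 0 "{0..l}"] by simp
    show "0 < e" "0 \<in> {0..l}" using e by auto
    show "geo (axis 3 1) (axis 1 1) t = \<phi> (c t)" if "t \<in> {0..l}" "dist t 0 < e" for t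
      using that e(3)[of t] \<phi> Mgeo[of t] by auto
  qed
  then show ?thesis
    unfolding perp_to_boundary_def using chart pA c0 \<phi>0
    by (auto simp: U_def mink_def axis_def intro!: exI[of _ U] exI[of _ \<phi>] exI[of _ "axis 1 1"])
qed

text \<open>The starting parameter is free, so that the induction on the word can restart at a
  mirror crossing.\<close>

definition local_isometric :: "real \<Rightarrow> real \<Rightarrow> (real \<Rightarrow> 'a) \<Rightarrow> bool" where
  "local_isometric a l c \<longleftrightarrow> (\<forall>t\<in>{a..l}. \<exists>e>0. \<forall>s\<in>{a..l} \<inter> ball t e. \<forall>s'\<in>{a..l} \<inter> ball t e. dist (c s) (c s') = \<bar>s - s'\<bar>)"

text \<open>The tiles met by a geodesic from the base tile to the tile \<open>w\<close> are the prefixes of \<open>w\<close>;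
  folding it tile by tile gives an arc in \<open>P\<close>.\<close>
lemma folded_geodesic_exists:
  assumes "distinct_adj w" "set w \<subseteq> mirrors"
    and y: "y \<in> H" "\<And>s. s \<in> mirrors \<Longrightarrow> mink y (n s) < 0"
    and "mink p p = -1" "mink v v = 1" "mink p v = 0" "a < l"
    and "geo p v a \<in> H" "w \<noteq> [] \<Longrightarrow> mink (geo p v a) (n (hd w)) < 0" "geo p v l = act w y"
    and "\<And>t u j. t \<in> {a..l} \<Longrightarrow> j \<in> cuffs \<Longrightarrow> set u \<subseteq> mirrors \<Longrightarrow> mink (geo p v t) (act u (n j)) \<le> 0"
  shows "\<exists>c b'. c ` {a..l} \<subseteq> P \<and> local_isometric a l c \<and>
    (\<exists>e>0. \<forall>t\<in>{a..l}. t < a + e \<longrightarrow> geo p v t \<in> H \<and> c t = h b (geo p v t)) \<and>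
    (\<exists>e>0. \<forall>t\<in>{a..l}. l - e < t \<longrightarrow> act (rev w) (geo p v t) \<in> H \<and> c t = h b' (act (rev w) (geo p v t)))"
  using assms(1,2,5-)
proof (induction w arbitrary: p v a b)
  case Nil
  note as = Nil.prems
  have hp: "geo p v a \<in> hyp_plane" using as(7) by (rule H_D)
  have geoH: "geo p v t \<in> H" if "t \<in> {a..l}" for t
  proof (rule H_geo_between[of p v a l t])
    show "geo p v l \<in> H" using as y by simp
    show "geo p v t \<in> hyp_plane"
      using mink_geo_geo[OF as(3-5), of t t] mink_geo_geo[OF as(3-5), of t a] cosh_real_pos
      by (intro hyp_planeI[OF _ _ hp]) auto
  qed (use as that in auto)
  have "local_isometric a l (\<lambda>t. h b (geo p v t))"
    unfolding local_isometric_def using iso[OF geoH geoH] hdist_geo_geo[OF as(3-5)]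
    by (auto intro!: exI[of _ 1])
  then show ?case using geoH h_in_P
    by (intro exI[of _ "\<lambda>t. h b (geo p v t)"] exI[of _ b]) (auto intro!: exI[of _ 1])
next
  case (Cons s w)
  note as = Cons.prems
  let ?R = "reflect (n s)" and ?g = "geo p v"
  have s: "s \<in> mirrors" "s < 6" using as(2) by (auto simp: mirrors_lt_6)
  have us: "mink (n s) (n s) = 1" using s by (simp add: unit)
  have gh: "?g t \<in> hyp_plane" for t
    using mink_geo_geo[OF as(3-5), of t t] mink_geo_geo[OF as(3-5), of t a] cosh_real_pos
    by (intro hyp_planeI[OF _ _ H_D(1)[OF as(7)]]) auto
  \<comment> \<open>The end lies beyond the mirror of the first letter and the start strictly before
    it, so a crossing time exists strictly between.\<close>
  have "mink (act (s # w) y) (n s) > 0"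
  proof -
    have "last (s # w) \<in> set (s # w)" by (rule last_in_set) simp
    then have "mink y (n (last (s # w))) < 0" using as(2) y(2) by blast
    moreover have "mink y (n s') \<le> 0" if "s' \<in> mirrors" for s' using y(2)[OF that] by simp
    ultimately show ?thesis
      using act_reduced_signs[of "s # w" y "- mink y (n (last (s # w)))"] as(1,2) by force
  qed
  then have pos: "mink (?g l) (n s) > 0" using as(9) by simp
  have neg: "mink (?g a) (n s) < 0" using as(8) by simp
  have "continuous_on {a..l} (\<lambda>t. mink (?g t) (n s))" by (intro continuous_intros)
  then obtain \<tau> where \<tau>: "a \<le> \<tau>" "\<tau> \<le> l" "mink (?g \<tau>) (n s) = 0"
    using IVT'[of "\<lambda>t. mink (?g t) (n s)" a 0 l] pos neg as(6) by auto
  then have al: "a < \<tau>" "\<tau> < l" using pos neg by (auto simp: less_le)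
  \<comment> \<open>The crossing must be on the side, not just on its line. The neighbours of a
    mirror are cuffs, and their inequalities are the last hypothesis with the empty word.\<close>
  have \<tau>H: "?g \<tau> \<in> H"
  proof (rule side_geometry(7)[OF s(2) gh \<tau>(3)])
    have "(s + 5) mod 6 \<in> cuffs" "Suc s mod 6 \<in> cuffs" using s(1) by (auto simp: mirrors_def cuffs_def)
    then show "mink (?g \<tau>) (n ((s + 5) mod 6)) \<le> 0" "mink (?g \<tau>) (n (Suc s mod 6)) \<le> 0"
      using as(10)[of \<tau> _ "[]"] \<tau> by auto
  qed
  have gH: "?g t \<in> H" if "t \<in> {a..\<tau>}" for t
    using that as(7) \<tau>H gh by (intro H_geo_between[of p v a \<tau> t]) auto
  have Rg: "geo (?R p) (?R v) t = ?R (?g t)" for t by (simp add: reflect_geo)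
  have R\<tau>: "?R (?g \<tau>) = ?g \<tau>" using \<tau>(3) by (rule reflect_perp)
  \<comment> \<open>After the crossing the picture is reflected back to the base tile: the crossing
    point is fixed, the copy changes and the first letter is dropped.\<close>
  have IH: "\<exists>c b'. c ` {\<tau>..l} \<subseteq> P \<and> local_isometric \<tau> l c \<and>
    (\<exists>e>0. \<forall>t\<in>{\<tau>..l}. t < \<tau> + e \<longrightarrow> geo (?R p) (?R v) t \<in> H \<and> c t = h (\<not> b) (geo (?R p) (?R v) t)) \<and>
    (\<exists>e>0. \<forall>t\<in>{\<tau>..l}. l - e < t \<longrightarrow> act (rev w) (geo (?R p) (?R v) t) \<in> H \<and>
       c t = h b' (act (rev w) (geo (?R p) (?R v) t)))"
  proof (rule Cons.IH)
    show "distinct_adj w" "set w \<subseteq> mirrors" using as by (auto simp: distinct_adj_Cons)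
    show "mink (?R p) (?R p) = -1" "mink (?R v) (?R v) = 1" "mink (?R p) (?R v) = 0"
      using as(3-5) by (simp_all add: mink_reflect[OF us])
    show "\<tau> < l" "geo (?R p) (?R v) \<tau> \<in> H" using al \<tau>H R\<tau> Rg by auto
    show "geo (?R p) (?R v) l = act w y" using as(9) us Rg[of l] by simp
    show "mink (geo (?R p) (?R v) \<tau>) (n (hd w)) < 0" if "w \<noteq> []"
    proof -
      have hw: "hd w \<in> mirrors" "hd w \<noteq> s" using that as(1,2) by (cases w; auto)+
      have "mink (?g \<tau>) (n (hd w)) \<noteq> 0"
        using nonadjacent_disjoint[OF gh s(2) _ _ \<tau>(3)] gram_mirrors[OF s(1) hw(1)] hw by (simp add: mirrors_lt_6)
      then show ?thesis using H_D(2)[OF \<tau>H mirrors_lt_6[OF hw(1)]] R\<tau> Rg by simp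
    qed
    show "mink (geo (?R p) (?R v) t) (act u (n j)) \<le> 0" if "t \<in> {\<tau>..l}" "j \<in> cuffs" "set u \<subseteq> mirrors" for t u j
      using as(10)[of t j "s # u"] that s(1) al Rg[of t] by (simp add: mink_reflect_left)
  qed
  obtain c' b' e1 e2 where c': "c' ` {\<tau>..l} \<subseteq> P" "local_isometric \<tau> l c'"
    and e1: "e1 > 0" "\<forall>t\<in>{\<tau>..l}. t < \<tau> + e1 \<longrightarrow> ?R (?g t) \<in> H \<and> c' t = h (\<not> b) (?R (?g t))"
    and e2: "e2 > 0" "\<forall>t\<in>{\<tau>..l}. l - e2 < t \<longrightarrow> act (rev w) (?R (?g t)) \<in> H \<and> c' t = h b' (act (rev w) (?R (?g t)))"
    using IH unfolding Rg by blast
  define c where "c t = (if t \<le> \<tau> then h b (?g t) else c' t)" for t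
  have c\<tau>: "c' \<tau> = h b (?g \<tau>)"
    using e1 al R\<tau> agree[OF s(1), of "?g \<tau>" b] \<tau>H \<tau>(3) by (auto simp: hex_side_def)
  have c_right: "c t = c' t" if "t \<ge> \<tau>" for t using that c\<tau> by (auto simp: c_def)
  obtain e0 where e0: "e0 > 0" "\<forall>x\<in>H. \<forall>y\<in>H. \<forall>b. hdist x (?g \<tau>) < e0 \<longrightarrow> hdist y (?g \<tau>) < e0 \<longrightarrow>
    dist (h b x) (h (\<not> b) y) = hdist x (?R y)"
    using dist_eq_reflect_near[OF \<tau>H s(1) \<tau>(3)] by blast
  have gd: "hdist (?g t) (?g t') = \<bar>t - t'\<bar>" for t t' using as(3-5) by (rule hdist_geo_geo)
  have "local_isometric a l c"
    unfolding local_isometric_def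
  proof
    fix t assume t: "t \<in> {a..l}"
    consider "t < \<tau>" | "t = \<tau>" | "t > \<tau>" by linarith
    then show "\<exists>e>0. \<forall>s\<in>{a..l} \<inter> ball t e. \<forall>s'\<in>{a..l} \<inter> ball t e. dist (c s) (c s') = \<bar>s - s'\<bar>"
    proof cases
      case 1
      have "dist (c x) (c x') = \<bar>x - x'\<bar>" if "x \<in> {a..l} \<inter> ball t (\<tau> - t)" "x' \<in> {a..l} \<inter> ball t (\<tau> - t)" for x x'
      proof -
        have "x \<in> {a..\<tau>}" "x' \<in> {a..\<tau>}" using that by (auto simp: dist_real_def)
        then show ?thesis using iso[OF gH gH] gd by (simp add: c_def)
      qed
      then show ?thesis using 1 by (intro exI[of _ "\<tau> - t"]) auto
    next
      case 2
      define e where "e = min e0 e1"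
      have e: "e > 0" "e \<le> e0" "e \<le> e1" using e0 e1 by (auto simp: e_def)
      \<comment> \<open>Across the mirror, distance in \<open>P\<close> is distance after
        reflection, and the second reflection cancels the first.\<close>
      have cross: "dist (c x) (c x') = \<bar>x - x'\<bar>"
        if "x \<in> {a..l} \<inter> ball t e" "x' \<in> {a..l} \<inter> ball t e" "x \<le> \<tau>" "\<tau> \<le> x'" for x x'
      proof -
        have x: "?g x \<in> H" "c x = h b (?g x)" "hdist (?g x) (?g \<tau>) < e0"
          using that e gH gd 2 by (auto simp: c_def dist_real_def)
        have x': "?R (?g x') \<in> H" "c x' = h (\<not> b) (?R (?g x'))"
          using that e e1(2) 2 c_right by (auto simp: dist_real_def)
        have "hdist (?R (?g x')) (?g \<tau>) = hdist (?R (?g x')) (?R (?g \<tau>))" using R\<tau> by simp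
        also have "\<dots> = \<bar>x' - \<tau>\<bar>" using hdist_reflect[OF us] gd by simp
        also have "\<dots> < e0" using that 2 e by (auto simp: dist_real_def)
        finally have "dist (c x) (c x') = hdist (?g x) (?R (?R (?g x')))" using e0(2) x x' by simp
        then show ?thesis using us gd by simp
      qed
      have "dist (c x) (c x') = \<bar>x - x'\<bar>" if x: "x \<in> {a..l} \<inter> ball t e" "x' \<in> {a..l} \<inter> ball t e" for x x'
      proof -
        consider "x \<le> \<tau>" "x' \<le> \<tau>" | "x \<le> \<tau>" "\<tau> \<le> x'" | "\<tau> \<le> x" "x' \<le> \<tau>" | "\<tau> \<le> x" "\<tau> \<le> x'" by linarith
        then show ?thesis
        proof cases
          case 1
          then show ?thesis using x iso[OF gH gH, of x x'] gd by (simp add: c_def)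
        next
          case 2
          then show ?thesis using cross x by blast
        next
          case 3
          then show ?thesis using cross[of x' x] x by (simp add: dist_commute abs_minus_commute)
        next
          case 4
          have "?R (?g x) \<in> H" "c x = h (\<not> b) (?R (?g x))" "?R (?g x') \<in> H" "c x' = h (\<not> b) (?R (?g x'))"
            using x e e1(2) 2 4 c_right by (auto simp: dist_real_def)
          then show ?thesis using iso[of "?R (?g x)" "?R (?g x')" "\<not> b"] hdist_reflect[OF us] gd by simp
        qed
      qed
      then show ?thesis using e(1) by blast
    next
      case 3
      then obtain e where e: "e > 0" "\<forall>s\<in>{\<tau>..l} \<inter> ball t e. \<forall>s'\<in>{\<tau>..l} \<inter> ball t e. dist (c' s) (c' s') = \<bar>s - s'\<bar>"
        using c'(2) t unfolding local_isometric_def by (meson atLeastAtMost_iff less_imp_le)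
      have "dist (c x) (c x') = \<bar>x - x'\<bar>"
        if "x \<in> {a..l} \<inter> ball t (min e (t - \<tau>))" "x' \<in> {a..l} \<inter> ball t (min e (t - \<tau>))" for x x'
      proof -
        have "x \<in> {\<tau>..l} \<inter> ball t e" "x' \<in> {\<tau>..l} \<inter> ball t e" using that by (auto simp: dist_real_def)
        then show ?thesis using e(2) c_right by simp
      qed
      then show ?thesis using e 3 by (intro exI[of _ "min e (t - \<tau>)"]) auto
    qed
  qed
  moreover have "c ` {a..l} \<subseteq> P"
    using c'(1) gH h_in_P by (auto simp: c_def)
  moreover have "\<forall>t\<in>{a..l}. t < a + (\<tau> - a) \<longrightarrow> ?g t \<in> H \<and> c t = h b (?g t)"
    using gH by (auto simp: c_def)
  moreover have "\<forall>t\<in>{a..l}. l - min e2 (l - \<tau>) < t \<longrightarrow> act (rev (s # w)) (?g t) \<in> H \<and> c t = h b' (act (rev (s # w)) (?g t))"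
    using e2(2) c_right by auto
  moreover have "\<tau> - a > 0" "min e2 (l - \<tau>) > 0" using al e2 by auto
  ultimately show ?case by blast
qed

text \<open>The arc is the folded common perpendicular of the lines of \<open>n j\<close> and
  \<open>x = act w (n j)\<close>. The palindrome is an involution exchanging the two lines, so the
  arc ends on the same cuff as it starts and both ends look alike.\<close>

theorem orthogeodesic_exists:
  assumes j: "j \<in> cuffs" and w: "w \<noteq> []" "distinct_adj w" "set w \<subseteq> mirrors" "rev w = w" "hd w = opp j"
  shows "\<exists>l c. orthogeodesic P (l, c) \<and> cosh l = - mink (n j) (act w (n j))"
proof -
  let ?e = "n j"
  define i where "i = opp j"
  have i: "i \<in> mirrors" "i < 6" using j by (auto simp: i_def mirrors_def cuffs_def)
  have j6: "j < 6" using j by (rule cuffs_lt_6)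
  have hl: "hd w = i" "last w = i" using w by (auto simp: i_def) (metis hd_rev)
  have ee: "mink ?e ?e = 1" using j6 by (rule unit)
  define \<kappa> where "\<kappa> = - mink ?e (n i)"
  define x where "x = act w ?e"
  define C where "C = - mink ?e x"
  define a where "a = mink x (n i)"
  have \<kappa>: "\<kappa> > 1" using gram_opp[OF j6] by (simp add: \<kappa>_def i_def)
  have sg: "a \<ge> \<kappa>" "\<And>s. s \<in> mirrors \<Longrightarrow> s \<noteq> i \<Longrightarrow> mink x (n s) \<le> - a"
    using act_reduced_signs[OF w(1-3), of ?e \<kappa>] cuff_mirror_nonpos[OF j] hl \<kappa>
    by (auto simp: x_def a_def \<kappa>_def)
  have xx: "mink x x = 1" using mink_act[OF w(3)] ee by (simp add: x_def)
  have wx: "act w x = ?e" using act_rev[OF w(3), of ?e] w(4) by (simp add: x_def)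
  \<comment> \<open>Dropping the first letter leaves a reduced word \<open>u\<close>, and its
    product with \<open>?e\<close> is still at most 1; undoing the reflection makes this a lower
    bound for \<open>C\<close>.\<close>
  have C1: "C \<ge> 2 * a * \<kappa> - 1"
  proof -
    obtain u where u: "w = i # u" using w(1) hl(1) by (cases w) auto
    have "mink (act u ?e) ?e \<le> mink ?e ?e"
      using w(2,3) u by (intro act_reduced_le cuff_mirror_nonpos[OF j]) (auto simp: distinct_adj_Cons)
    moreover have "act u ?e = reflect (n i) x" using u unit[OF i(2)] by (simp add: x_def)
    ultimately have "mink x ?e - 2 * a * mink (n i) ?e \<le> 1" using ee by (simp add: reflect_def a_def)
    then show ?thesis by (simp add: C_def \<kappa>_def mink_commute algebra_simps)
  qed
  have "a * \<kappa> \<ge> \<kappa> * \<kappa>" using sg(1) \<kappa> by (intro mult_right_mono) auto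
  moreover have kk: "\<kappa> * \<kappa> > 1" using \<kappa> less_1_mult by blast
  ultimately have C: "C > 1" using C1 by linarith
  \<comment> \<open>Exactly the condition that the foot \<open>p\<close> is strictly inside the
    mirror opposite to the cuff.\<close>
  have Ck: "C * \<kappa> > a"
  proof -
    have "C * \<kappa> \<ge> (2 * a * \<kappa> - 1) * \<kappa>" using C1 \<kappa> by (intro mult_right_mono) auto
    moreover have "a * (\<kappa> * \<kappa>) > a * 1" using kk sg(1) \<kappa> by (intro mult_strict_left_mono) auto
    ultimately show ?thesis using sg(1) by (simp add: algebra_simps)
  qed
  define l where "l = arcosh C"
  have l: "l > 0" "cosh l = C" using C by (simp_all add: l_def)
  define S where "S = sinh l"
  have S: "S > 0" "S * S = C * C - 1" using l sinh_square_eq[of l] by (simp_all add: S_def power2_eq_square)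
  \<comment> \<open>The foot on the line of \<open>?e\<close>: \<open>C *\<^sub>R ?e + x\<close> is
    orthogonal to \<open>?e\<close> and has square \<open>- (S * S)\<close>.\<close>
  define p where "p = (1 / S) *\<^sub>R (C *\<^sub>R ?e + x)"
  have Sp: "S *\<^sub>R p = C *\<^sub>R ?e + x" using S by (simp add: p_def)
  have ex: "mink ?e x = - C" "mink x ?e = - C" by (simp_all add: C_def mink_commute)
  have pe: "mink p ?e = 0" using ee ex by (simp add: p_def)
  have "S * S * mink p p = mink (S *\<^sub>R p) (S *\<^sub>R p)" by simp
  also have "\<dots> = - (S * S)" unfolding Sp S(2) using ee ex xx by (simp add: algebra_simps)
  finally have pp: "mink p p = -1" using S(1) mult_left_cancel[of "S * S" "mink p p" "-1"] by simp
  have pm: "mink p z = (C * mink ?e z + mink x z) / S" for z by (simp add: p_def divide_simps)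
  have inner: "mink p (n k) < 0" if k: "k < 6" "k \<noteq> j" for k
  proof -
    have "C * mink ?e (n k) + mink x (n k) < 0"
    proof (cases "k \<in> cuffs")
      case True
      then have "mink ?e (n k) < -1" using gram_cuffs[OF j] k by metis
      moreover have "mink x (n k) \<le> mink ?e (n k)"
        unfolding x_def using w(2,3) True by (intro act_reduced_le cuff_mirror_nonpos[OF j] cuff_mirror_nonpos[OF True])
      moreover have "C * mink ?e (n k) < 0" using C calculation by (intro mult_pos_neg) auto
      ultimately show ?thesis by linarith
    next
      case False
      then have km: "k \<in> mirrors" using k by (auto simp: mirrors_def cuffs_def)
      show ?thesis
      proof (cases "k = i")
        case True
        then show ?thesis using Ck by (simp add: a_def \<kappa>_def)
      next
        case False
        then have "mink x (n k) < 0" using sg(1) sg(2)[OF km] \<kappa> by fastforce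
        moreover have "C * mink ?e (n k) \<le> 0"
          using C cuff_mirror_nonpos[OF j km] by (intro mult_nonneg_nonpos) auto
        ultimately show ?thesis by linarith
      qed
    qed
    then show ?thesis using S(1) pm by (simp add: divide_neg_pos)
  qed
  have ph: "p \<in> hyp_plane"
  proof (rule hyp_planeI[OF pp])
    \<comment> \<open>Fixes the sheet. A vertex of the opposite side is off the cuff, so its product
      with \<open>?e\<close> is strictly negative.\<close>
    let ?y = "vtx i"
    show "?y \<in> hyp_plane" using i by (intro vtx)
    have "j \<noteq> i" "j \<noteq> Suc i mod 6" using j by (auto simp: i_def cuffs_def)
    then have "mink ?e ?y < 0" using vtx(4)[OF i(2) j6] by (simp add: mink_commute)
    moreover have "mink x ?y \<le> 0"
      using H_act_cuff_nonpos[OF vtx_in_H[OF i(2)] j w(3)] by (simp add: x_def mink_commute)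
    moreover have "C * mink ?e ?y < 0" using C calculation by (intro mult_pos_neg) auto
    ultimately show "mink p ?y < 0" using S(1) pm by (simp add: divide_neg_pos)
  qed
  have pH: "p \<in> H"
  proof (rule H_I[OF ph])
    fix k :: nat assume "k < 6"
    then show "mink p (n k) \<le> 0" using inner[of k] pe by (cases "k = j") auto
  qed
  let ?v = "- ?e"
  have v: "mink ?v ?v = 1" "mink p ?v = 0" using ee pe by simp_all
  have wp: "S *\<^sub>R act w p = C *\<^sub>R x + ?e"
    unfolding act_linear(2)[symmetric] Sp act_linear wx x_def[symmetric] ..
  have mx: "S *\<^sub>R p - C *\<^sub>R ?e = x" using Sp by simp
  have gl: "C *\<^sub>R p - S *\<^sub>R ?e = act w p"
  proof -
    have "S *\<^sub>R (C *\<^sub>R p - S *\<^sub>R ?e) = C *\<^sub>R (S *\<^sub>R p) - (S * S) *\<^sub>R ?e" by (simp add: algebra_simps)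
    also have "\<dots> = C *\<^sub>R x + ?e" unfolding Sp S(2) by (simp add: algebra_simps)
    finally have "S *\<^sub>R (C *\<^sub>R p - S *\<^sub>R ?e) = S *\<^sub>R act w p" using wp by simp
    then show ?thesis using S(1) by simp
  qed
  have end_geo: "geo p ?v l = act w p" using gl l by (simp add: geo_def S_def)
  \<comment> \<open>The word reverses the perpendicular, so the end of the arc, folded back, is its
    start traversed backwards.\<close>
  have flip: "act w (geo p ?v (l - t)) = geo p ?v t" for t
  proof -
    have "geo p ?v (l - t) = geo (act w p) ((-1) *\<^sub>R x) t"
      unfolding geo_flip using gl mx l by (simp add: S_def)
    then have "act w (geo p ?v (l - t)) = geo (act w (act w p)) ((-1) *\<^sub>R act w x) t"
      by (simp only: act_geo act_linear)
    also have "act w (act w p) = p" using act_rev[OF w(3), of p] w(4) by simp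
    finally show ?thesis using wx by simp
  qed
  \<comment> \<open>By convexity the two ends suffice; the far end is \<open>act w p\<close>, and
    moving the word to the other factor reduces it to \<open>p\<close>.\<close>
  have omega: "mink (geo p ?v t) (act u (n k)) \<le> 0" if "t \<in> {0..l}" "k \<in> cuffs" "set u \<subseteq> mirrors" for t u k
  proof (rule mink_le_0_between[of p ?v 0 _ l t])
    show "mink (geo p ?v 0) (act u (n k)) \<le> 0" using H_act_cuff_nonpos[OF pH that(2,3)] by simp
    have "mink (act w p) (act u (n k)) = mink p (act (w @ u) (n k))"
      using mink_act_left[OF w(3)] w(4) by simp
    also have "\<dots> \<le> 0" using that w(3) by (intro H_act_cuff_nonpos[OF pH that(2)]) auto
    finally show "mink (geo p ?v l) (act u (n k)) \<le> 0" unfolding end_geo .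
  qed (use that in auto)
  have ms: "mink p (n s) < 0" if "s \<in> mirrors" for s
    using inner[OF mirrors_lt_6[OF that]] mirror_neq_cuff[OF that j] by blast
  have "mink (geo p ?v 0) (n (hd w)) < 0" using ms[OF i(1)] hl by simp
  with folded_geodesic_exists[OF w(2,3) pH ms pp v l(1) _ _ end_geo omega, of True]
  obtain c b' e1 e2 where c: "c ` {0..l} \<subseteq> P" "local_isometric 0 l c"
    and e1: "e1 > 0" "\<forall>t\<in>{0..l}. t < 0 + e1 \<longrightarrow> geo p ?v t \<in> H \<and> c t = h True (geo p ?v t)"
    and e2: "e2 > 0" "\<forall>t\<in>{0..l}. l - e2 < t \<longrightarrow> act (rev w) (geo p ?v t) \<in> H \<and> c t = h b' (act (rev w) (geo p ?v t))"
    using pH by auto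
  have "geodesic_arc P (l, c)"
    using l(1) c unfolding geodesic_arc_iff local_isometric_def by blast
  moreover have "perp_to_boundary P (l, c) 0"
    using e1 by (intro chart_at_cuff[OF j pH pe inner e1(1) l(1)]) auto
  moreover have "perp_to_boundary P (l, \<lambda>t. c (l - t)) 0"
  proof (rule chart_at_cuff[OF j pH pe inner e2(1) l(1)])
    fix t assume t: "t \<in> {0..l}" "t < e2"
    then have "l - t \<in> {0..l}" "l - e2 < l - t" by auto
    then show "geo p ?v t \<in> H \<and> c (l - t) = h b' (geo p ?v t)"
      using e2(2) flip[of t] w(4) by metis
  qed auto
  then have "perp_to_boundary P (l, c) l"
    using perp_to_boundary_reverse[of P l "\<lambda>t. c (l - t)" 0] by simp
  ultimately have "orthogeodesic P (l, c)" by (simp add: orthogeodesic_def)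
  then show ?thesis using l(2) C_def x_def by blast
qed

end

section \<open>Arithmetic of the cosh-lengths\<close>

text \<open>In lowest terms, every power of the denominator of \<open>\<tau>\<close> divides the
  fixed integer \<open>M\<close>, which is impossible for a denominator of at least 2.\<close>

lemma Ints_if_bounded_denominator:
  fixes \<tau> :: real
  assumes N: "N \<in> \<int>" "N \<noteq> 0" and pow: "\<And>k. \<tau> ^ k * N \<in> \<int>"
  shows "\<tau> \<in> \<int>"
proof -
  obtain M where M: "N = of_int M" using N by (auto elim: Ints_cases)
  have M0: "M \<noteq> 0" using N M by simp
  obtain K where "\<tau> ^ 1 * N = of_int K" using pow by (blast elim: Ints_cases)
  then have "\<tau> = of_int K / of_int M" using M M0 by (simp add: field_simps)
  then have "\<tau> \<in> \<rat>" by simp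
  then obtain m n :: int where mn: "n > 0" "coprime m n" "\<tau> = of_int m / of_int n"
    by (auto elim: Rats_cases')
  have dvd: "n ^ k dvd M" for k
  proof -
    obtain L where "\<tau> ^ k * N = of_int L" using pow by (blast elim: Ints_cases)
    then have "of_int (m ^ k * M) = (of_int (L * n ^ k) :: real)"
      using mn by (simp add: M power_divide field_simps)
    then have "m ^ k * M = L * n ^ k" by (simp only: of_int_eq_iff)
    then have "n ^ k dvd m ^ k * M" by simp
    moreover have "coprime (n ^ k) (m ^ k)" using mn(2) by (simp add: coprime_commute)
    ultimately show ?thesis by (simp add: coprime_dvd_mult_right_iff)
  qed
  have "n = 1"
  proof (rule ccontr)
    assume "n \<noteq> 1"
    then have n: "n \<ge> 2" using mn(1) by simp
    have "(2::int) ^ nat \<bar>M\<bar> \<le> n ^ nat \<bar>M\<bar>" using n by (intro power_mono) auto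
    also have "\<dots> \<le> \<bar>M\<bar>" using dvd M0 by (meson dvd_imp_le_int dvd_trans zdvd_imp_le dvd_abs_iff zero_less_abs_iff)
    also have "\<dots> < 2 ^ nat \<bar>M\<bar>"
      using less_exp[of "nat \<bar>M\<bar>"] by (metis abs_ge_zero nat_0_le of_nat_less_iff of_nat_numeral of_nat_power)
    finally show False by simp
  qed
  then show ?thesis using mn by simp
qed

text \<open>Multiplying by \<open>\<tau>\<close> turns an integral combination of the
  \<open>d m\<close> into another one, so all powers times \<open>d 0\<close> are integers. The
  first relation is the recurrence continued by the value \<open>- d 0\<close> at index -1.\<close>

lemma Ints_if_recurrence_integral:
  fixes \<tau> :: real and d :: "nat \<Rightarrow> real"
  assumes int: "\<And>m. d m \<in> \<int>" and "d 0 \<noteq> 0"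
    and rec: "\<tau> * d 0 = d 1 - d 0" "\<And>m. \<tau> * d (Suc m) = d (Suc (Suc m)) + d m"
  shows "\<tau> \<in> \<int>"
proof (rule Ints_if_bounded_denominator[of "d 0"])
  have "\<tau> ^ k * d m \<in> \<int>" for k m
  proof (induction k arbitrary: m)
    case (Suc k)
    show ?case
    proof (cases m)
      case 0
      have "\<tau> ^ Suc k * d 0 = \<tau> ^ k * (\<tau> * d 0)" by (simp add: mult_ac)
      also have "\<dots> = \<tau> ^ k * d 1 - \<tau> ^ k * d 0" unfolding rec by (simp add: algebra_simps)
      finally show ?thesis using Suc.IH 0 by simp
    next
      case (Suc m')
      have "\<tau> ^ Suc k * d m = \<tau> ^ k * (\<tau> * d (Suc m'))" by (simp add: mult_ac Suc)
      also have "\<dots> = \<tau> ^ k * d (Suc (Suc m')) + \<tau> ^ k * d m'" unfolding rec by (simp add: algebra_simps)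
      finally show ?thesis using Suc.IH by simp
    qed
  qed (use int in simp)
  then show "\<tau> ^ k * d 0 \<in> \<int>" for k by blast
qed (use assms in auto)

lemma perm_123:
  assumes "{i, j, k} = {1, 2, 3::nat}"
  shows "(i, j, k) \<in> {(1,2,3), (1,3,2), (2,1,3), (2,3,1), (3,1,2), (3,2,1)}"
proof -
  have "i \<in> {1, 2, 3}" "j \<in> {1, 2, 3}" "k \<in> {1, 2, 3}" unfolding assms[symmetric] by simp_all
  then have "i = 1 \<or> i = 2 \<or> i = 3" "j = 1 \<or> j = 2 \<or> j = 3" "k = 1 \<or> k = 2 \<or> k = 3" by simp_all
  moreover have "1 \<in> {i, j, k} \<and> 2 \<in> {i, j, k} \<and> 3 \<in> {i, j, k}" unfolding assms by simp
  ultimately show ?thesis by (elim disjE; simp)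
qed

definition integral_triples :: "(real \<times> real \<times> real) set" where
  "integral_triples = {(2,2,2), (2,2,5), (2,2,17), (3,3,3), (3,3,7), (3,3,19), (5,5,11)}"

text \<open>Three of the divisibilities in (iii) already leave only the seven triples. The bound 19
  comes from the next lemma and is attained by (3,3,19).\<close>

lemma divisibility_check:
  "\<forall>A\<in>set [2..19]. \<forall>B\<in>set [A..19]. \<forall>C\<in>set [B..19::int].
     (C * C - 1) dvd 2 * (A * A + B * B + C * C + 2 * A * B * C - 1) \<and>
     (B * B - 1) * (C * C - 1) dvd 4 * ((B * C + A) * (B * C + A)) \<and>
     (B * B - 1) * (A * A - 1) dvd 4 * ((B * A + C) * (B * A + C)) \<longrightarrow>
     (A, B, C) \<in> set [(2,2,2), (2,2,5), (2,2,17), (3,3,3), (3,3,7), (3,3,19), (5,5,11)]"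
  by code_simp

lemma divisibility_bound:
  fixes A B C m m' :: int
  assumes le: "2 \<le> A" "A \<le> B" "B \<le> C"
    and 1: "2 * (A * A + B * B + C * C + 2 * A * B * C - 1) = m * (C * C - 1)"
    and 2: "4 * ((B * C + A) * (B * C + A)) = m' * ((B * B - 1) * (C * C - 1))"
  shows "C \<le> 19"
proof (cases "B \<ge> 3")
  case False
  then have AB: "A = 2" "B = 2" using le by auto
  have C: "C * C \<ge> 2 * 2" using le by (intro mult_mono) auto
  have "m * (C * C - 1) > 2 * (C * C - 1)" unfolding 1[symmetric] AB using le by simp
  then have "m > 2" using C by (elim mult_right_less_imp_less) simp
  then have "m * (C * C - 1) \<ge> 3 * (C * C - 1)" using C by (intro mult_right_mono) auto
  \<comment> \<open>With \<open>A = B = 2\<close> the inequality for \<open>m = 3\<close> becomes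
    \<open>C * C - 16 * C - 17 \<le> 0\<close>, which factors.\<close>
  then have "(C - 17) * (C + 1) \<le> 0" unfolding 1[symmetric] AB by (simp add: algebra_simps)
  then show ?thesis using le by (simp add: mult_le_0_iff)
next
  case True
  let ?b = "B * B" and ?c = "C * C"
  have b: "?b \<ge> 3 * 3" using True by (intro mult_mono) auto
  have c: "?c \<ge> 2 * 2" using le by (intro mult_mono) auto
  have p: "(?b - 1) * (?c - 1) > 0" using b c by (intro mult_pos_pos) auto
  have "(B * C + A) * (B * C + A) > (B * C) * (B * C)" using le by (intro mult_strict_mono') auto
  then have "m' * ((?b - 1) * (?c - 1)) > 4 * ((?b - 1) * (?c - 1))"
    unfolding 2[symmetric] using b c by (simp add: algebra_simps)
  then have "m' > 4" using p by (elim mult_right_less_imp_less) simp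
  then have "5 * ((?b - 1) * (?c - 1)) \<le> 4 * ((B * C + A) * (B * C + A))"
    unfolding 2 using p by (intro mult_right_mono) auto
  also have "\<dots> \<le> 4 * ((B * C + B) * (B * C + B))" using le by (intro mult_left_mono mult_mono) auto
  finally have "(C + 1) * (5 * ((?b - 1) * (C - 1))) \<le> (C + 1) * (4 * (?b * (C + 1)))"
    by (simp add: algebra_simps)
  then have "5 * ((?b - 1) * (C - 1)) \<le> 4 * (?b * (C + 1))"
    by (rule mult_left_le_imp_le) (use le in simp)
  then have "9 * (5 * ((?b - 1) * (C - 1))) \<le> 9 * (4 * (?b * (C + 1)))" by (rule mult_left_mono) simp
  \<comment> \<open>From \<open>B \<ge> 3\<close> one has \<open>9 * (?b - 1) \<ge> 8 * ?b\<close>;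
    this removes \<open>B\<close> and leaves \<open>40 * (C - 1) \<le> 36 * (C + 1)\<close>, that is
    \<open>C \<le> 19\<close>.\<close>
  moreover have "8 * ?b * (C - 1) \<le> 9 * (?b - 1) * (C - 1)" using b le by (intro mult_right_mono) auto
  ultimately have "?b * (40 * (C - 1)) \<le> ?b * (36 * (C + 1))" by (simp add: algebra_simps)
  then have "40 * (C - 1) \<le> 36 * (C + 1)" by (rule mult_left_le_imp_le) (use b in simp)
  then show ?thesis by simp
qed

lemma integral_triples_iff:
  fixes a :: "nat \<Rightarrow> real"
  assumes gt: "a 1 > 1" and le: "a 1 \<le> a 2" "a 2 \<le> a 3"
  shows "(a 1, a 2, a 3) \<in> integral_triples \<longleftrightarrow>
            (\<forall>i j k. {i, j, k} = {1, 2, 3} \<longrightarrow>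
               {a i,
                2 * ((a 1)\<^sup>2 + (a 2)\<^sup>2 + (a 3)\<^sup>2 + 2 * a 1 * a 2 * a 3 - 1) / ((a i)\<^sup>2 - 1),
                4 * (a i * a j + a k)\<^sup>2 / (((a i)\<^sup>2 - 1) * ((a j)\<^sup>2 - 1))} \<subseteq> \<nat>)" (is "_ \<longleftrightarrow> ?R")
proof
  assume "(a 1, a 2, a 3) \<in> integral_triples"
  then have v: "a 1 = 2 \<and> a 2 = 2 \<and> a 3 = 2 \<or> a 1 = 2 \<and> a 2 = 2 \<and> a 3 = 5 \<or> a 1 = 2 \<and> a 2 = 2 \<and> a 3 = 17
    \<or> a 1 = 3 \<and> a 2 = 3 \<and> a 3 = 3 \<or> a 1 = 3 \<and> a 2 = 3 \<and> a 3 = 7 \<or> a 1 = 3 \<and> a 2 = 3 \<and> a 3 = 19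
    \<or> a 1 = 5 \<and> a 2 = 5 \<and> a 3 = 11"
    by (auto simp: integral_triples_def)
  show ?R
  proof (intro allI impI)
    fix i j k :: nat assume "{i, j, k} = {1, 2, 3}"
    from perm_123[OF this] v show "{a i,
                2 * ((a 1)\<^sup>2 + (a 2)\<^sup>2 + (a 3)\<^sup>2 + 2 * a 1 * a 2 * a 3 - 1) / ((a i)\<^sup>2 - 1),
                4 * (a i * a j + a k)\<^sup>2 / (((a i)\<^sup>2 - 1) * ((a j)\<^sup>2 - 1))} \<subseteq> \<nat>"
      by (elim insertE emptyE Pair_inject disjE conjE) (simp_all add: power2_eq_square)
  qed
next
  assume R: ?R
  have R': "a i \<in> \<nat>"
    "2 * ((a 1)\<^sup>2 + (a 2)\<^sup>2 + (a 3)\<^sup>2 + 2 * a 1 * a 2 * a 3 - 1) / ((a i)\<^sup>2 - 1) \<in> \<nat>"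
    "4 * (a i * a j + a k)\<^sup>2 / (((a i)\<^sup>2 - 1) * ((a j)\<^sup>2 - 1)) \<in> \<nat>"
    if "{i, j, k} = {1, 2, 3}" for i j k using R[rule_format, OF that] by blast+
  have p1: "{1, 2, 3} = {1, 2, 3::nat}" and p2: "{2, 3, 1} = {1, 2, 3::nat}" and p3: "{3, 1, 2} = {1, 2, 3::nat}"
    and p4: "{2, 1, 3} = {1, 2, 3::nat}" by auto
  obtain x where x: "a 1 = of_nat x" using R'(1)[OF p1] by (rule Nats_cases)
  obtain y where y: "a 2 = of_nat y" using R'(1)[OF p2] by (rule Nats_cases)
  obtain z where z: "a 3 = of_nat z" using R'(1)[OF p3] by (rule Nats_cases)
  define A B C where "A = int x" and "B = int y" and "C = int z"
  have a: "a 1 = of_int A" "a 2 = of_int B" "a 3 = of_int C" by (simp_all only: A_def B_def C_def x y z of_int_of_nat_eq)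
  have le': "2 \<le> A" "A \<le> B" "B \<le> C" using gt le unfolding a by simp_all
  have ge4: "A * A \<ge> 2 * 2" "B * B \<ge> 2 * 2" "C * C \<ge> 2 * 2" 
    using mult_mono[of 2 A 2 A] mult_mono[of 2 B 2 B] mult_mono[of 2 C 2 C] le' by simp_all
  then have ne: "A * A - 1 \<noteq> 0" "B * B - 1 \<noteq> 0" "C * C - 1 \<noteq> 0" by auto
  have *: "\<exists>m. X = m * Y" if XY: "real_of_int X / real_of_int Y \<in> \<nat>" "Y \<noteq> 0" for X Y :: int
  proof -
    obtain m :: nat where "real_of_int X / real_of_int Y = of_nat m" using XY(1) by (rule Nats_cases)
    then have "real_of_int X = real_of_int (int m * Y)" using XY(2) by (simp add: field_simps)
    then show ?thesis by (metis of_int_eq_iff)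
  qed
  have "real_of_int (2 * (A * A + B * B + C * C + 2 * A * B * C - 1)) / real_of_int (C * C - 1) \<in> \<nat>"
    using R'(2)[OF p3] unfolding a by (simp add: power2_eq_square)
  then obtain m where m: "2 * (A * A + B * B + C * C + 2 * A * B * C - 1) = m * (C * C - 1)" using * ne by blast
  have "real_of_int (4 * ((B * C + A) * (B * C + A))) / real_of_int ((B * B - 1) * (C * C - 1)) \<in> \<nat>"
    using R'(3)[OF p2] unfolding a by (simp add: power2_eq_square)
  then obtain m' where m': "4 * ((B * C + A) * (B * C + A)) = m' * ((B * B - 1) * (C * C - 1))"
    using *[of "4 * ((B * C + A) * (B * C + A))" "(B * B - 1) * (C * C - 1)"] ne by fastforce
  have "real_of_int (4 * ((B * A + C) * (B * A + C))) / real_of_int ((B * B - 1) * (A * A - 1)) \<in> \<nat>"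
    using R'(3)[OF p4] unfolding a by (simp add: power2_eq_square)
  then obtain m'' where m'': "4 * ((B * A + C) * (B * A + C)) = m'' * ((B * B - 1) * (A * A - 1))"
    using *[of "4 * ((B * A + C) * (B * A + C))" "(B * B - 1) * (A * A - 1)"] ne by fastforce
  have "C \<le> 19" using divisibility_bound[OF le' m m'] .
  then have "A \<le> 19" "B \<le> 19" using le' by linarith+
  with le' \<open>C \<le> 19\<close> have "A \<in> set [2..19]" "B \<in> set [A..19]" "C \<in> set [B..19]"
    by (simp_all only: set_upto atLeastAtMost_iff simp_thms)
  from divisibility_check[rule_format, OF this]
  have "(A, B, C) \<in> set [(2,2,2), (2,2,5), (2,2,17), (3,3,3), (3,3,7), (3,3,19), (5,5,11)]"
    using m m' m'' by (metis dvd_triv_right)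
  then show "(a 1, a 2, a 3) \<in> integral_triples" unfolding a by (auto simp: integral_triples_def)
qed

section \<open>The Gram matrix in terms of the lengths of the mirror sides\<close>

context hexagon
begin

definition side_cosh :: "nat \<Rightarrow> real" where
  "side_cosh s = - mink (n ((s + 5) mod 6)) (n (Suc s mod 6))"

text \<open>Index bookkeeping: the neighbours of mirror \<open>i\<close> are the cuffs opposite to
  the other two mirrors.\<close>

lemma mirror_triple:
  assumes "i \<in> mirrors" "k \<in> mirrors" "l \<in> mirrors" "i \<noteq> k" "k \<noteq> l" "i \<noteq> l"
  shows "mink (n (opp k)) (n (opp l)) = - side_cosh i" "opp i \<in> cuffs"
    "opp i \<noteq> opp k" "opp k \<noteq> opp i" "mink (n (opp i)) (n k) = 0" "mink (n k) (n (opp i)) = 0" "opp (opp i) = i"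
proof -
  have c: "(i, k, l) \<in> {(0,2,4), (0,4,2), (2,0,4), (2,4,0), (4,0,2), (4,2,0)}"
    using assms by (auto simp: mirrors_def)
  then show "mink (n (opp k)) (n (opp l)) = - side_cosh i"
    using mink_commute[of "n 1" "n 5"] mink_commute[of "n 1" "n 3"] mink_commute[of "n 3" "n 5"]
    by (elim insertE emptyE Pair_inject) (simp_all add: side_cosh_def)
  show oc: "opp i \<in> cuffs" "opp i \<noteq> opp k" "opp k \<noteq> opp i" "opp (opp i) = i" using c by (auto simp: cuffs_def)
  show "mink (n k) (n (opp i)) = 0" using gram_adjacent[OF assms(2) oc(1)] oc(3) by metis
  then show "mink (n (opp i)) (n k) = 0" by (simp add: mink_commute)
qed

lemma side_cosh_gt_1: "s \<in> mirrors \<Longrightarrow> side_cosh s > 1"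
  using side_geometry(1,2)[of s] cosh_real_strict_mono[of 0 "side_len s"] by (simp add: side_cosh_def mirrors_lt_6)

context
  fixes i k l :: nat
  assumes m: "i \<in> mirrors" "k \<in> mirrors" "l \<in> mirrors" "i \<noteq> k" "k \<noteq> l" "i \<noteq> l"
begin

text \<open>A mirror and its two neighbouring cuffs form the chain required by
  \<open>mink_perp_pair_expansion\<close>; the third cuff is expanded in their normals.\<close>

lemma cuff_expansion:
  "n (opp i) = mink (n (opp i)) (n i) *\<^sub>R n i
    + ((side_cosh k + side_cosh i * side_cosh l) / ((side_cosh i)\<^sup>2 - 1)) *\<^sub>R n (opp l)
    + ((side_cosh l + side_cosh i * side_cosh k) / ((side_cosh i)\<^sup>2 - 1)) *\<^sub>R n (opp k)"
proof -
  have c: "opp k \<in> cuffs" "opp l \<in> cuffs" using mirror_triple(2) m by metis+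
  have g: "mink (n (opp k)) (n (opp l)) = - side_cosh i" "mink (n (opp i)) (n (opp l)) = - side_cosh k"
    "mink (n (opp i)) (n (opp k)) = - side_cosh l"
    using mirror_triple(1)[of i k l] mirror_triple(1)[of k i l] mirror_triple(1)[of l i k] m by auto
  have u: "mink (n (opp k)) (n (opp k)) = 1" "mink (n i) (n i) = 1" "mink (n (opp l)) (n (opp l)) = 1"
    using c m by (auto intro!: unit simp: cuffs_lt_6 mirrors_lt_6)
  have o: "mink (n (opp k)) (n i) = 0" "mink (n i) (n (opp l)) = 0"
    using mirror_triple(5)[of k i l] mirror_triple(6)[of l i k] m by auto
  have d: "(- x - w * y) / r = - ((x + w * y) / r)" for x y w r :: real
    by (simp add: divide_simps)
  show ?thesis
    using mink_perp_pair_expansion[OF u o g(1) side_cosh_gt_1[OF m(1)], of "n (opp i)"]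
    unfolding g by (simp add: d)
qed

lemma side_cosh_sq: "(side_cosh i)\<^sup>2 - 1 > 0"
  using side_cosh_gt_1[OF m(1)] by (simp add: one_less_power)

text \<open>Obtained by pairing the expansion with the cuff normal itself. Twice this square is the
  second quantity in (iii).\<close>

lemma cuff_mirror_product_sq:
  "(mink (n (opp i)) (n i))\<^sup>2 * ((side_cosh i)\<^sup>2 - 1)
    = (side_cosh i)\<^sup>2 + (side_cosh k)\<^sup>2 + (side_cosh l)\<^sup>2 + 2 * side_cosh i * side_cosh k * side_cosh l - 1"
proof -
  let ?X = "n (opp i)" and ?D = "(side_cosh i)\<^sup>2 - 1"
  have "mink ?X ?X = 1" using mirror_triple(2)[OF m] by (simp add: unit cuffs_lt_6)
  have g: "mink ?X (n (opp l)) = - side_cosh k" "mink ?X (n (opp k)) = - side_cosh l"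
    using mirror_triple(1)[of k i l] mirror_triple(1)[of l i k] m by auto
  have "1 = mink ?X ?X" using \<open>mink ?X ?X = 1\<close> by simp
  also have "\<dots> = mink ?X (mink ?X (n i) *\<^sub>R n i
    + ((side_cosh k + side_cosh i * side_cosh l) / ?D) *\<^sub>R n (opp l)
    + ((side_cosh l + side_cosh i * side_cosh k) / ?D) *\<^sub>R n (opp k))"
    using cuff_expansion by (rule arg_cong)
  also have "\<dots> = (mink ?X (n i))\<^sup>2 - (side_cosh k * (side_cosh k + side_cosh i * side_cosh l)
     + side_cosh l * (side_cosh l + side_cosh i * side_cosh k)) / ?D"
    by (simp add: g power2_eq_square add_divide_distrib algebra_simps)
  finally have "?D * 1 = ?D * (mink ?X (n i))\<^sup>2 - (side_cosh k * (side_cosh k + side_cosh i * side_cosh l)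
     + side_cosh l * (side_cosh l + side_cosh i * side_cosh k))"
    using side_cosh_sq by (simp add: field_simps)
  then show ?thesis by (simp add: algebra_simps power2_eq_square)
qed

text \<open>Eliminating the mirror normal expresses the reflection in cuff normals alone, with
  coefficients rational in the cosh-lengths; this makes a lattice argument possible.\<close>

lemma reflect_cuff:
  "reflect (n i) (n (opp i)) = - n (opp i)
    + (2 * (side_cosh k + side_cosh i * side_cosh l) / ((side_cosh i)\<^sup>2 - 1)) *\<^sub>R n (opp l)
    + (2 * (side_cosh l + side_cosh i * side_cosh k) / ((side_cosh i)\<^sup>2 - 1)) *\<^sub>R n (opp k)"
proof -
  have "2 *\<^sub>R n (opp i) = (2 * mink (n (opp i)) (n i)) *\<^sub>R n i
    + (2 * (side_cosh k + side_cosh i * side_cosh l) / ((side_cosh i)\<^sup>2 - 1)) *\<^sub>R n (opp l)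
    + (2 * (side_cosh l + side_cosh i * side_cosh k) / ((side_cosh i)\<^sup>2 - 1)) *\<^sub>R n (opp k)"
    by (subst (1) cuff_expansion) (simp add: scaleR_add_right)
  then show ?thesis by (simp add: reflect_def scaleR_2 algebra_simps)
qed

end

text \<open>Pairing the expansion of a cuff with a mirror orthogonal to it gives a linear relation
  for the product of two mirror normals; after squaring, \<open>cuff_mirror_product_sq\<close>
  removes the remaining unknowns. Four times the square is the third quantity in (iii).\<close>

lemma mirror_product_sq:
  assumes m: "i \<in> mirrors" "k \<in> mirrors" "l \<in> mirrors" "i \<noteq> k" "k \<noteq> l" "i \<noteq> l"
  shows "(mink (n i) (n k))\<^sup>2 * (((side_cosh i)\<^sup>2 - 1) * ((side_cosh k)\<^sup>2 - 1)) = (side_cosh i * side_cosh k + side_cosh l)\<^sup>2"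
proof -
  let ?a = "side_cosh i" and ?b = "side_cosh k" and ?c = "side_cosh l"
  let ?X = "n (opp i)" and ?D = "?a\<^sup>2 - 1" and ?E = "?b\<^sup>2 - 1"
  have D: "?D > 0" and E: "?E > 0" using side_cosh_sq[OF m] side_cosh_sq[of k i l] m by auto
  have z: "mink ?X (n k) = 0" "mink (n (opp l)) (n k) = 0"
    using mirror_triple(5)[of i k l] mirror_triple(5)[of l k i] m by auto
  define G where "G = ?a\<^sup>2 + ?b\<^sup>2 + ?c\<^sup>2 + 2 * ?a * ?b * ?c - 1"
  define \<kappa> \<mu> g where "\<kappa> = mink ?X (n i)" and "\<mu> = mink (n (opp k)) (n k)" and "g = mink (n i) (n k)"
  have \<kappa>: "\<kappa>\<^sup>2 * ?D = G" using cuff_mirror_product_sq[OF m] by (simp add: \<kappa>_def G_def)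
  have \<mu>: "\<mu>\<^sup>2 * ?E = G" using cuff_mirror_product_sq[of k i l] m by (simp add: \<mu>_def G_def algebra_simps)
  have "0 = mink ?X (n k)" using z by simp
  also have "\<dots> = mink (mink ?X (n i) *\<^sub>R n i
    + ((?b + ?a * ?c) / ?D) *\<^sub>R n (opp l) + ((?c + ?a * ?b) / ?D) *\<^sub>R n (opp k)) (n k)"
    using cuff_expansion[OF m] by (rule arg_cong)
  also have "\<dots> = \<kappa> * g + ((?c + ?a * ?b) / ?D) * \<mu>" by (simp add: z \<kappa>_def \<mu>_def g_def)
  finally have "?D * (\<kappa> * g + ((?c + ?a * ?b) / ?D) * \<mu>) = 0" by simp
  moreover have "?D * (\<kappa> * g + ((?c + ?a * ?b) / ?D) * \<mu>) = ?D * (\<kappa> * g) + (?c + ?a * ?b) * \<mu>"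
    using D by (simp add: distrib_left)
  ultimately have "?D * (\<kappa> * g) = - (?c + ?a * ?b) * \<mu>" by (simp only: minus_mult_left[symmetric] eq_neg_iff_add_eq_0)
  then have "(?D * (\<kappa> * g))\<^sup>2 = (- (?c + ?a * ?b) * \<mu>)\<^sup>2" by simp
  then have "?D * (\<kappa>\<^sup>2 * ?D) * g\<^sup>2 * ?E = (?c + ?a * ?b)\<^sup>2 * (\<mu>\<^sup>2 * ?E)" by (simp add: power_mult_distrib power2_eq_square algebra_simps)
  then have "G * (?D * ?E * g\<^sup>2) = G * (?c + ?a * ?b)\<^sup>2" unfolding \<kappa> \<mu> by (simp add: algebra_simps)
  moreover have "G > 0"
  proof -
    have "\<kappa>\<^sup>2 > 0" using gram_opp[OF mirrors_lt_6[OF m(1)]] by (simp add: \<kappa>_def mink_commute)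
    then show ?thesis using D \<kappa> by (metis mult_pos_pos)
  qed
  ultimately have "?D * ?E * g\<^sup>2 = (?c + ?a * ?b)\<^sup>2" by (metis mult_left_cancel less_irrefl)
  then show ?thesis by (simp add: g_def[symmetric] mult_ac add_ac)
qed

text \<open>The orbit of the boundary normals stays in the lattice spanned by \<open>n 1\<close>, \<open>n 3\<close> and \<open>(n 3 + n 5) / m\<close>.\<close>
lemma cuff_orbit_integral:
  fixes m :: real
  defines "a \<equiv> side_cosh 0" and "b \<equiv> side_cosh 2" and "c \<equiv> side_cosh 4"
  assumes m: "m > 0" "m \<in> \<int>" and abc: "a \<in> \<int>" "b \<in> \<int>" "c \<in> \<int>" "(a + b) / m \<in> \<int>" "(1 - c) / m \<in> \<int>"
    and r0: "2 * (b + a * c) / (a\<^sup>2 - 1) / m \<in> \<int>" "2 * (c + a * b) / (a\<^sup>2 - 1) \<in> \<int>" "(2 * (c + a * b) / (a\<^sup>2 - 1) + 2) / m \<in> \<int>"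
    and r2: "2 * (a + b * c) / (b\<^sup>2 - 1) / m \<in> \<int>" "(2 * (c + a * b) / (b\<^sup>2 - 1) + 2) / m \<in> \<int>"
    and r4: "2 * (b + a * c) / (c\<^sup>2 - 1) - 2 * (a + b * c) / (c\<^sup>2 - 1) \<in> \<int>" "m * (2 * (a + b * c) / (c\<^sup>2 - 1)) \<in> \<int>"
    and ij: "i \<in> cuffs" "j \<in> cuffs" and w: "set w \<subseteq> mirrors"
  shows "mink (n i) (act w (n j)) \<in> \<int>"
proof -
  \<comment> \<open>For \<open>m = 1\<close> this gives the span of the cuff normals; a larger
    \<open>m\<close> refines it so that reflection in mirror 4 preserves it.\<close>
  define g where "g = (1 / m) *\<^sub>R (n 3 + n 5)"
  have n5: "n 5 = m *\<^sub>R g - n 3" using m by (simp add: g_def)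
  define L where "L = {x. \<exists>X\<in>\<int>. \<exists>Y\<in>\<int>. \<exists>Z\<in>\<int>. x = X *\<^sub>R n 1 + Y *\<^sub>R n 3 + Z *\<^sub>R g}"
  have L_I: "X \<in> \<int> \<Longrightarrow> Y \<in> \<int> \<Longrightarrow> Z \<in> \<int> \<Longrightarrow> X *\<^sub>R n 1 + Y *\<^sub>R n 3 + Z *\<^sub>R g \<in> L" for X Y Z
    by (auto simp: L_def)
  have L_add: "x + y \<in> L" if xL: "x \<in> L" and yL: "y \<in> L" for x y
  proof -
    obtain X Y Z where x: "X \<in> \<int>" "Y \<in> \<int>" "Z \<in> \<int>" "x = X *\<^sub>R n 1 + Y *\<^sub>R n 3 + Z *\<^sub>R g"
      using xL unfolding L_def by blast
    obtain X' Y' Z' where y: "X' \<in> \<int>" "Y' \<in> \<int>" "Z' \<in> \<int>" "y = X' *\<^sub>R n 1 + Y' *\<^sub>R n 3 + Z' *\<^sub>R g"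
      using yL unfolding L_def by blast
    note * = x y
    have eq: "x + y = (X + X') *\<^sub>R n 1 + (Y + Y') *\<^sub>R n 3 + (Z + Z') *\<^sub>R g" using * by (simp add: algebra_simps)
    show ?thesis unfolding eq using * by (intro L_I Ints_add)
  qed
  have L_scale: "r *\<^sub>R x \<in> L" if xL: "x \<in> L" and r: "r \<in> \<int>" for x r
  proof -
    obtain X Y Z where *: "X \<in> \<int>" "Y \<in> \<int>" "Z \<in> \<int>" "x = X *\<^sub>R n 1 + Y *\<^sub>R n 3 + Z *\<^sub>R g"
      using xL unfolding L_def by blast
    have eq: "r *\<^sub>R x = (r * X) *\<^sub>R n 1 + (r * Y) *\<^sub>R n 3 + (r * Z) *\<^sub>R g" using * by (simp add: algebra_simps)
    show ?thesis unfolding eq using * r by (intro L_I Ints_mult)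
  qed
  have gen: "n 1 \<in> L" "n 3 \<in> L" "g \<in> L" using L_I[of 1 0 0] L_I[of 0 1 0] L_I[of 0 0 1] by auto
  have n5L: "n 5 \<in> L" using L_I[of 0 "-1" m] m n5 by simp
  have cL: "n j \<in> L" if "j \<in> cuffs" for j using that gen n5L by (auto simp: cuffs_def)
  have fixed: "reflect (n s) (n j) = n j" if "s \<in> mirrors" "j \<in> cuffs" "j \<noteq> opp s" for s j
    using gram_adjacent[OF that] by (intro reflect_perp) (simp add: mink_commute)
  have f0: "reflect (n 0) (n 1) = n 1" "reflect (n 0) (n 5) = n 5" and f2: "reflect (n 2) (n 1) = n 1" "reflect (n 2) (n 3) = n 3"
    and f4: "reflect (n 4) (n 3) = n 3" "reflect (n 4) (n 5) = n 5"
    by (rule fixed; simp add: mirrors_def cuffs_def)+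
  define p q where "p = 2 * (b + a * c) / (a\<^sup>2 - 1)" and "q = 2 * (c + a * b) / (a\<^sup>2 - 1)"
  define p' q' where "p' = 2 * (a + b * c) / (b\<^sup>2 - 1)" and "q' = 2 * (c + a * b) / (b\<^sup>2 - 1)"
  define p'' q'' where "p'' = 2 * (b + a * c) / (c\<^sup>2 - 1)" and "q'' = 2 * (a + b * c) / (c\<^sup>2 - 1)"
  have R0: "reflect (n 0) (n 3) = - n 3 + p *\<^sub>R n 1 + q *\<^sub>R n 5"
    using reflect_cuff[of 0 2 4] by (simp add: mirrors_def p_def q_def a_def b_def c_def)
  have R2: "reflect (n 2) (n 5) = - n 5 + p' *\<^sub>R n 1 + q' *\<^sub>R n 3"
    using reflect_cuff[of 2 0 4] by (simp add: mirrors_def p'_def q'_def a_def b_def c_def mult_ac)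
  have R4: "reflect (n 4) (n 1) = - n 1 + p'' *\<^sub>R n 3 + q'' *\<^sub>R n 5"
    using reflect_cuff[of 4 2 0] by (simp add: mirrors_def p''_def q''_def a_def b_def c_def mult_ac)
  have Rg: "reflect (n s) g = (1 / m) *\<^sub>R (reflect (n s) (n 3) + reflect (n s) (n 5))" for s
    by (simp add: g_def reflect_linear)
  have "m * (p / m) \<in> \<int>" using r0(1) m(2) unfolding p_def[symmetric] by (rule Ints_mult[rotated])
  then have pI: "p \<in> \<int>" using m by simp
  have qI: "q \<in> \<int>" using r0(2) by (simp add: q_def)
  have gens: "reflect (n s) x \<in> L" if "s \<in> mirrors" "x \<in> {n 1, n 3, g}" for s x
  proof -
    have "reflect (n 0) (n 3) \<in> L" unfolding R0
      using L_add[OF L_add[OF L_scale[OF gen(2), of "-1"] L_scale[OF gen(1) pI]] L_scale[OF n5L qI]] by simp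
    moreover have "reflect (n 0) g \<in> L"
    proof -
      have eq: "reflect (n 0) g = (p / m) *\<^sub>R n 1 + (- ((q + 2) / m)) *\<^sub>R n 3 + (q + 1) *\<^sub>R g"
        unfolding Rg R0 f0 unfolding n5 using m(1) by (simp add: vec_eq_iff field_simps)
      show ?thesis using r0 qI unfolding eq p_def[symmetric] q_def[symmetric]
        by (intro L_I Ints_minus Ints_add Ints_1)
    qed
    moreover have "reflect (n 2) g \<in> L"
    proof -
      have eq: "reflect (n 2) g = (p' / m) *\<^sub>R n 1 + ((q' + 2) / m) *\<^sub>R n 3 + (- 1) *\<^sub>R g"
        unfolding Rg R2 f2 unfolding n5 using m(1) by (simp add: vec_eq_iff field_simps)
      show ?thesis using r2 unfolding eq p'_def[symmetric] q'_def[symmetric] by (intro L_I Ints_minus Ints_1)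
    qed
    moreover have "reflect (n 4) (n 1) \<in> L"
    proof -
      \<comment> \<open>The coefficients \<open>p''\<close> and \<open>q''\<close> may be fractions;
        in the refined basis only \<open>p'' - q''\<close> and \<open>m * q''\<close> have to be
        integers.\<close>
      have eq: "reflect (n 4) (n 1) = (- 1) *\<^sub>R n 1 + (p'' - q'') *\<^sub>R n 3 + (m * q'') *\<^sub>R g"
        unfolding R4 unfolding n5 by (simp add: algebra_simps)
      show ?thesis using r4 unfolding eq p''_def[symmetric] q''_def[symmetric] by (intro L_I Ints_minus Ints_1)
    qed
    moreover have "reflect (n 4) g \<in> L" unfolding Rg f4 using gen by (simp add: g_def)
    ultimately show ?thesis using that gen f0 f2 f4 by (auto simp: mirrors_def)
  qed
  have RL: "reflect (n s) x \<in> L" if s: "s \<in> mirrors" and xL: "x \<in> L" for s x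
  proof -
    obtain X Y Z where *: "X \<in> \<int>" "Y \<in> \<int>" "Z \<in> \<int>" "x = X *\<^sub>R n 1 + Y *\<^sub>R n 3 + Z *\<^sub>R g"
      using xL unfolding L_def by blast
    show ?thesis unfolding *(4) reflect_linear
      using gens[OF s] * by (intro L_add L_scale) auto
  qed
  have "act w (n j) \<in> L" using w by (induction w) (use cL[OF ij(2)] RL in auto)
  then obtain X Y Z where *: "X \<in> \<int>" "Y \<in> \<int>" "Z \<in> \<int>" "act w (n j) = X *\<^sub>R n 1 + Y *\<^sub>R n 3 + Z *\<^sub>R g"
    unfolding L_def by blast
  have G: "mink (n 1) (n 1) = 1" "mink (n 3) (n 3) = 1" "mink (n 5) (n 5) = 1"
    "mink (n 1) (n 3) = - b" "mink (n 3) (n 1) = - b" "mink (n 5) (n 3) = - c" "mink (n 3) (n 5) = - c"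
    "mink (n 1) (n 5) = - a" "mink (n 5) (n 1) = - a"
    using unit mink_commute[of "n 1" "n 3"] mink_commute[of "n 3" "n 5"] mink_commute[of "n 1" "n 5"]
    by (simp_all add: a_def b_def c_def side_cosh_def)
  have gi: "mink (n 1) g = - ((a + b) / m)" "mink (n 3) g = (1 - c) / m" "mink (n 5) g = (1 - c) / m"
    unfolding g_def mink_scaleR mink_add G using m(1) by (simp_all add: divide_simps)
  have ints: "mink (n 1) (n 1) \<in> \<int>" "mink (n 1) (n 3) \<in> \<int>" "mink (n 1) g \<in> \<int>"
    "mink (n 3) (n 1) \<in> \<int>" "mink (n 3) (n 3) \<in> \<int>" "mink (n 3) g \<in> \<int>"
    "mink (n 5) (n 1) \<in> \<int>" "mink (n 5) (n 3) \<in> \<int>" "mink (n 5) g \<in> \<int>"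
    unfolding G gi using abc by (auto simp del: minus_divide_left)
  then have "mink (n i) (n 1) \<in> \<int> \<and> mink (n i) (n 3) \<in> \<int> \<and> mink (n i) g \<in> \<int>"
    using ij(1) unfolding cuffs_def by (elim insertE emptyE) (simp_all only: simp_thms)
  then show ?thesis unfolding *(4) using *(1-3) by simp
qed

end

section \<open>The standard orthobasis\<close>

text \<open>An arc and a side are known to agree only as sets. A continuous injection of intervals
  is monotone, and an increasing local isometry differs from the identity by a constant.\<close>

lemma locally_isometric_bijection_real:
  fixes g :: "real \<Rightarrow> real"
  assumes l: "l > 0" and L: "L > 0" and im: "g ` {0..l} = {0..L}" and inj: "inj_on g {0..l}"
    and loc: "\<And>t. t \<in> {0..l} \<Longrightarrow> \<exists>e>0. \<forall>s s'. s \<in> {0..l} \<inter> ball t e \<longrightarrow> s' \<in> {0..l} \<inter> ball t e \<longrightarrow> \<bar>g s - g s'\<bar> = \<bar>s - s'\<bar>"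
  shows "L = l \<and> (g 0 = 0 \<and> g l = L \<or> g 0 = L \<and> g l = 0)"
proof -
  have mono_case: "k l - k 0 = l \<and> k 0 = 0 \<and> k l = L"
    if k: "strict_mono_on {0..l} k" "k ` {0..l} = {0..L}"
      and loc: "\<And>t. t \<in> {0..l} \<Longrightarrow> \<exists>e>0. \<forall>s s'. s \<in> {0..l} \<inter> ball t e \<longrightarrow> s' \<in> {0..l} \<inter> ball t e \<longrightarrow> \<bar>k s - k s'\<bar> = \<bar>s - s'\<bar>"
    for k :: "real \<Rightarrow> real"
  proof -
    have mono: "k s \<le> k t" if "s \<in> {0..l}" "t \<in> {0..l}" "s \<le> t" for s t
      using strict_mono_onD[OF k(1) that(1,2)] that(3) by (cases "s = t") auto
    have ends: "0 \<in> {0..l}" "l \<in> {0..l}" using l by auto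
    have bnd: "k t \<in> {0..L}" if "t \<in> {0..l}" for t using k(2) that by blast
    have "0 \<in> k ` {0..l}" "L \<in> k ` {0..l}" using k(2) L by auto
    then obtain t0 t1 where t: "t0 \<in> {0..l}" "k t0 = 0" "t1 \<in> {0..l}" "k t1 = L" by (metis imageE)
    have "k 0 \<le> 0" "L \<le> k l" using mono[OF ends(1) t(1)] mono[OF t(3) ends(2)] t by auto
    then have kk: "k 0 = 0" "k l = L" using bnd[OF ends(1)] bnd[OF ends(2)] by auto
    \<comment> \<open>The difference is locally constant, so its derivative vanishes and it is
      constant on the interval.\<close>
    have "((\<lambda>t. k t - t) has_derivative (\<lambda>h. 0)) (at x within {0..l})" if x: "x \<in> {0..l}" for x
    proof -
      obtain e where e: "e > 0" "\<forall>s s'. s \<in> {0..l} \<inter> ball x e \<longrightarrow> s' \<in> {0..l} \<inter> ball x e \<longrightarrow> \<bar>k s - k s'\<bar> = \<bar>s - s'\<bar>"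
        using loc[OF x] by blast
      have eq: "k x - x = k y - y" if y: "y \<in> {0..l}" "dist y x < e" for y
      proof -
        have "\<bar>k x - k y\<bar> = \<bar>x - y\<bar>" using e x y by (auto simp: dist_commute)
        then show ?thesis using mono[OF x y(1)] mono[OF y(1) x] by linarith
      qed
      show ?thesis by (rule has_derivative_transform_within[OF has_derivative_const e(1) x eq])
    qed
    then obtain c where "\<And>x. x \<in> {0..l} \<Longrightarrow> k x - x = c"
      using has_derivative_zero_constant[of "{0..l}" "\<lambda>t. k t - t"] by auto
    from this[OF ends(1)] this[OF ends(2)] kk show ?thesis by simp
  qed
  have "continuous_on {0..l} g"
    unfolding continuous_on_iff
  proof (intro ballI allI impI)
    fix t r :: real assume t: "t \<in> {0..l}" and r: "r > 0"
    obtain e where e: "e > 0" "\<forall>s s'. s \<in> {0..l} \<inter> ball t e \<longrightarrow> s' \<in> {0..l} \<inter> ball t e \<longrightarrow> \<bar>g s - g s'\<bar> = \<bar>s - s'\<bar>"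
      using loc[OF t] by blast
    have "dist (g s) (g t) < r" if "s \<in> {0..l}" "dist s t < min e r" for s
      using e(2)[rule_format, of s t] that t e(1) by (auto simp: dist_real_def abs_minus_commute)
    then show "\<exists>d>0. \<forall>s\<in>{0..l}. dist s t < d \<longrightarrow> dist (g s) (g t) < r" using e(1) r by (intro exI[of _ "min e r"]) auto
  qed
  then consider "strict_mono_on {0..l} g" | "strict_antimono_on {0..l} g"
    using injective_eq_monotone_map[of "{0..l}" g] inj by (auto simp: is_interval_cc)
  then show ?thesis
  proof cases
    case 1
    then show ?thesis using mono_case[OF 1 im loc] by auto
  next
    case 2
    have "strict_mono_on {0..l} (\<lambda>t. L - g t)"
      using 2 by (auto simp: monotone_on_def)
    moreover have "(\<lambda>t. L - g t) ` {0..l} = {0..L}"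
    proof -
      have "(\<lambda>t. L - g t) ` {0..l} = (\<lambda>x. L - x) ` (g ` {0..l})" by (simp add: image_image)
      also have "\<dots> = {0..L}" unfolding im by (auto simp: image_iff intro!: bexI[of _ "L - _"])
      finally show ?thesis .
    qed
    moreover have "\<exists>e>0. \<forall>s s'. s \<in> {0..l} \<inter> ball t e \<longrightarrow> s' \<in> {0..l} \<inter> ball t e \<longrightarrow> \<bar>(L - g s) - (L - g s')\<bar> = \<bar>s - s'\<bar>"
      if "t \<in> {0..l}" for t
      using loc[OF that] by (simp add: abs_minus_commute)
    ultimately have "L - g l - (L - g 0) = l \<and> L - g 0 = 0 \<and> L - g l = L" by (rule mono_case)
    then show ?thesis by auto
  qed
qed

context hexagon
begin

lemma side_in_H: "hex_side n i \<subseteq> H"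
  by (auto simp: hex_side_def)

lemma side_path_in_side: "i < 6 \<Longrightarrow> s \<in> {0..side_len i} \<Longrightarrow> side_path i s \<in> hex_side n i"
  using side_geometry(3) by auto

text \<open>\<open>g\<close> reads the arc in the arc-length parameter of the side and is a locally
  isometric bijection of intervals, so the lengths agree and the ends match in one of two
  orders.\<close>

lemma arc_along_side:
  fixes f :: "real^3 \<Rightarrow> 'a::metric_space"
  assumes i: "i < 6" and f: "\<And>x y. x \<in> H \<Longrightarrow> y \<in> H \<Longrightarrow> dist (f x) (f y) = hdist x y"
    and arc: "geodesic_arc P (l, c)" and inj: "inj_on c {0..l}" and im: "f ` hex_side n i = c ` {0..l}"
  shows "l = side_len i"
    "c 0 = f (vtx ((i + 5) mod 6)) \<and> c l = f (vtx i) \<or> c 0 = f (vtx i) \<and> c l = f (vtx ((i + 5) mod 6))"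
proof -
  let ?L = "side_len i"
  define F where "F s = f (side_path i s)" for s
  have Fd: "dist (F s) (F t) = \<bar>s - t\<bar>" if "s \<in> {0..?L}" "t \<in> {0..?L}" for s t
    using side_path_in_side[OF i that(1)] side_path_in_side[OF i that(2)] side_in_H f side_geometry(6)[OF i] unfolding F_def by (metis subsetD)
  have Fim: "F ` {0..?L} = c ` {0..l}"
    unfolding im[symmetric] side_geometry(3)[OF i] F_def by (simp add: image_image)
  have "\<exists>s. s \<in> {0..?L} \<and> F s = c t" if "t \<in> {0..l}" for t
    using that Fim by (metis imageE imageI)
  then obtain g where g: "\<And>t. t \<in> {0..l} \<Longrightarrow> g t \<in> {0..?L} \<and> F (g t) = c t" by metis
  have gd: "\<bar>g s - g t\<bar> = dist (c s) (c t)" if "s \<in> {0..l}" "t \<in> {0..l}" for s t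
    using Fd[of "g s" "g t"] g[OF that(1)] g[OF that(2)] by simp
  have gim: "g ` {0..l} = {0..?L}"
  proof
    show "g ` {0..l} \<subseteq> {0..?L}" using g by blast
    show "{0..?L} \<subseteq> g ` {0..l}"
    proof
      fix s assume s: "s \<in> {0..?L}"
      then obtain t where t: "t \<in> {0..l}" "F s = c t" using Fim by (metis imageE imageI)
      then have "dist (F s) (F (g t)) = 0" using g by simp
      then have "s = g t" using Fd[OF s, of "g t"] g[OF t(1)] by simp
      then show "s \<in> g ` {0..l}" using t by blast
    qed
  qed
  have ginj: "inj_on g {0..l}"
  proof (rule inj_onI)
    fix s t assume st: "s \<in> {0..l}" "t \<in> {0..l}" "g s = g t"
    then have "c s = c t" using gd[OF st(1,2)] by simp
    then show "s = t" using inj_onD[OF inj] st by blast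
  qed
  have l0: "l > 0" using arc by (simp add: geodesic_arc_iff)
  have loc: "\<exists>e>0. \<forall>s s'. s \<in> {0..l} \<inter> ball t e \<longrightarrow> s' \<in> {0..l} \<inter> ball t e \<longrightarrow> \<bar>g s - g s'\<bar> = \<bar>s - s'\<bar>"
    if "t \<in> {0..l}" for t
    using geodesic_arc_local[OF arc that] gd by (metis IntD1)
  have R: "?L = l \<and> (g 0 = 0 \<and> g l = ?L \<or> g 0 = ?L \<and> g l = 0)"
    using l0 side_geometry(1)[OF i] gim ginj loc by (rule locally_isometric_bijection_real)
  then show "l = ?L" by simp
  have "F 0 = f (vtx ((i + 5) mod 6))" "F ?L = f (vtx i)" using side_geometry(4,5)[OF i] by (simp_all add: F_def)
  moreover have "c 0 = F (g 0)" "c l = F (g l)" using g l0 by auto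
  ultimately show "c 0 = f (vtx ((i + 5) mod 6)) \<and> c l = f (vtx i) \<or> c 0 = f (vtx i) \<and> c l = f (vtx ((i + 5) mod 6))"
    using R by metis
qed

text \<open>A point of a segment is determined by its distance from one end.\<close>

lemma isometries_agree_on_side:
  fixes f f' :: "real^3 \<Rightarrow> 'a::metric_space"
  assumes i: "i < 6" and f: "\<And>x y. x \<in> H \<Longrightarrow> y \<in> H \<Longrightarrow> dist (f x) (f y) = hdist x y"
    and f': "\<And>x y. x \<in> H \<Longrightarrow> y \<in> H \<Longrightarrow> dist (f' x) (f' y) = hdist x y"
    and im: "f ` hex_side n i = f' ` hex_side n i"
    and v: "f (vtx ((i + 5) mod 6)) = f' (vtx ((i + 5) mod 6))" and x: "x \<in> hex_side n i"
  shows "f x = f' x"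
proof -
  obtain y where y: "y \<in> hex_side n i" "f x = f' y" using im x by (metis imageE imageI)
  obtain s where s: "s \<in> {0..side_len i}" "x = side_path i s" using x side_geometry(3)[OF i] by auto
  obtain t where t: "t \<in> {0..side_len i}" "y = side_path i t" using y side_geometry(3)[OF i] by auto
  let ?v = "vtx ((i + 5) mod 6)"
  have vH: "?v \<in> H" by (rule vtx_in_H) simp
  have "hdist ?v x = hdist ?v y" using f[OF vH, of x] f'[OF vH, of y] x y v side_in_H by (metis subsetD)
  moreover have "hdist ?v x = s" "hdist ?v y = t"
    using side_geometry(6)[OF i, of 0] s t unfolding side_geometry(4)[OF i, symmetric] by auto
  ultimately show ?thesis using s t y by simp
qed

lemma connected_side_image:
  fixes f :: "real^3 \<Rightarrow> 'a::metric_space"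
  assumes i: "i < 6" and f: "\<And>x y. x \<in> H \<Longrightarrow> y \<in> H \<Longrightarrow> dist (f x) (f y) = hdist x y"
  shows "connected (f ` hex_side n i)"
proof -
  have "continuous_on {0..side_len i} (\<lambda>s. f (side_path i s))"
    unfolding continuous_on_iff
  proof (intro ballI allI impI)
    fix t r :: real assume t: "t \<in> {0..side_len i}" and r: "r > 0"
    have "dist (f (side_path i s)) (f (side_path i t)) = \<bar>s - t\<bar>" if "s \<in> {0..side_len i}" for s
      using side_path_in_side[OF i that] side_path_in_side[OF i t] side_in_H f side_geometry(6)[OF i] by (metis subsetD)
    then show "\<exists>d>0. \<forall>s\<in>{0..side_len i}. dist s t < d \<longrightarrow> dist (f (side_path i s)) (f (side_path i t)) < r"
      using r by (intro exI[of _ r]) (auto simp: dist_real_def)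
  qed
  then have "connected ((\<lambda>s. f (side_path i s)) ` {0..side_len i})" by (rule connected_continuous_image) simp
  then show ?thesis unfolding side_geometry(3)[OF i] by (simp add: image_image)
qed

lemma vtx_in_sides:
  assumes "i < 6"
  shows "vtx i \<in> hex_side n i" "vtx i \<in> hex_side n (Suc i mod 6)"
  using vtx(2,3)[OF assms] vtx_in_H[OF assms] by (auto simp: hex_side_def)

text \<open>Labels the vertices by the boundary components, so that both hexagons induce the same labelling.\<close>
lemma vertices_in_components:
  fixes f :: "real^3 \<Rightarrow> 'a::metric_space"
  assumes f: "\<And>x y. x \<in> H \<Longrightarrow> y \<in> H \<Longrightarrow> dist (f x) (f y) = hdist x y"
    and bd: "\<And>i. i \<in> {1, 3, 5} \<Longrightarrow> f ` hex_side n i \<subseteq> hyp_boundary P"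
    and B: "{B1, B2, B3} = components (hyp_boundary P)" "B1 \<noteq> B2" "B2 \<noteq> B3" "B1 \<noteq> B3"
    and e0: "f (vtx 5) \<in> B1 \<and> f (vtx 0) \<in> B2 \<or> f (vtx 5) \<in> B2 \<and> f (vtx 0) \<in> B1"
    and e2: "f (vtx 1) \<in> B2 \<and> f (vtx 2) \<in> B3 \<or> f (vtx 1) \<in> B3 \<and> f (vtx 2) \<in> B2"
    and e4: "f (vtx 3) \<in> B3 \<and> f (vtx 4) \<in> B1 \<or> f (vtx 3) \<in> B1 \<and> f (vtx 4) \<in> B3"
  shows "f (vtx 5) \<in> B1" "f (vtx 1) \<in> B2" "f (vtx 3) \<in> B3"
proof -
  have dis: "B1 \<inter> B2 = {}" "B2 \<inter> B3 = {}" "B1 \<inter> B3 = {}"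
    using B components_nonoverlap[of _ "hyp_boundary P"] by (metis insertCI)+
  have same: "\<exists>C\<in>{B1, B2, B3}. f ` hex_side n i \<subseteq> C" if i: "i \<in> {1, 3, 5}" for i
  proof -
    have i6: "i < 6" using i by auto
    have "hyp_boundary P \<noteq> {}" using bd[OF i] vtx_in_sides(1)[OF i6] by blast
    then show ?thesis
      unfolding B(1) using exists_component_superset[OF bd[OF i] _ connected_side_image[OF i6 f]] by blast
  qed
  have side: "vtx 0 \<in> hex_side n 1" "vtx 1 \<in> hex_side n 1" "vtx 2 \<in> hex_side n 3" "vtx 3 \<in> hex_side n 3"
    "vtx 4 \<in> hex_side n 5" "vtx 5 \<in> hex_side n 5"
    using vtx_in_sides(2)[of 0] vtx_in_sides(1)[of 1] vtx_in_sides(2)[of 2] vtx_in_sides(1)[of 3]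
      vtx_in_sides(2)[of 4] vtx_in_sides(1)[of 5] by auto
  obtain C1 where C1: "C1 \<in> {B1, B2, B3}" "f (vtx 0) \<in> C1" "f (vtx 1) \<in> C1" using same[of 1] side(1,2) by blast
  obtain C3 where C3: "C3 \<in> {B1, B2, B3}" "f (vtx 2) \<in> C3" "f (vtx 3) \<in> C3" using same[of 3] side(3,4) by blast
  obtain C5 where C5: "C5 \<in> {B1, B2, B3}" "f (vtx 4) \<in> C5" "f (vtx 5) \<in> C5" using same[of 5] side(5,6) by blast
  \<comment> \<open>Cuff 1 meets the ends of both the first and the second arc, and
    \<open>B2\<close> is the only component common to the two; likewise for the other cuffs.\<close>
  have "C1 = B2" using C1 e0 e2 dis by blast
  moreover have "C3 = B3" using C3 e2 e4 dis by blast
  moreover have "C5 = B1" using C5 e0 e4 dis by blast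
  ultimately show "f (vtx 5) \<in> B1" "f (vtx 1) \<in> B2" "f (vtx 3) \<in> B3" using C1 C3 C5 by auto
qed

end

text \<open>The two copies share the image of each arc, but a priori one could traverse it in the
  opposite direction. The boundary components at the vertices exclude this flip.\<close>

lemma glued_hexagons_of_orthobasis:
  fixes P :: "'a::metric_space set"
  assumes pants: "hyperbolic_pants P" and ob: "standard_orthobasis P \<alpha> \<beta> \<gamma>"
  obtains n h where "glued_hexagons n P h"
    "cosh (arc_length \<alpha>) = hexagon.side_cosh n 0" "cosh (arc_length \<beta>) = hexagon.side_cosh n 2"
    "cosh (arc_length \<gamma>) = hexagon.side_cosh n 4"
proof -
  obtain l1 c1 l2 c2 l3 c3 where eq: "\<alpha> = (l1, c1)" "\<beta> = (l2, c2)" "\<gamma> = (l3, c3)" by (metis surj_pair)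
  have arcs: "geodesic_arc P (l1, c1)" "geodesic_arc P (l2, c2)" "geodesic_arc P (l3, c3)"
    "inj_on c1 {0..l1}" "inj_on c2 {0..l2}" "inj_on c3 {0..l3}"
    using ob unfolding standard_orthobasis_def eq by (auto simp: orthogeodesic_def simple_arc_def)
  obtain B1 B2 B3 where B: "{B1, B2, B3} = components (hyp_boundary P)" "B1 \<noteq> B2" "B2 \<noteq> B3" "B1 \<noteq> B3"
    and J: "joins \<alpha> B1 B2" "joins \<beta> B2 B3" "joins \<gamma> B3 B1"
    using ob[unfolded standard_orthobasis_def] by (elim conjE exE)
  have J: "c1 0 \<in> B1 \<and> c1 l1 \<in> B2 \<or> c1 0 \<in> B2 \<and> c1 l1 \<in> B1" "c2 0 \<in> B2 \<and> c2 l2 \<in> B3 \<or> c2 0 \<in> B3 \<and> c2 l2 \<in> B2"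
    "c3 0 \<in> B3 \<and> c3 l3 \<in> B1 \<or> c3 0 \<in> B1 \<and> c3 l3 \<in> B3"
    using J by (simp_all add: joins_def eq)
  have dis: "B1 \<inter> B2 = {}" "B2 \<inter> B3 = {}" "B1 \<inter> B3 = {}"
    using B components_nonoverlap[of _ "hyp_boundary P"] by (metis insertCI)+
  obtain n f f' where hex: "right_angled_hexagon n"
    and un: "f ` hex_region n \<union> f' ` hex_region n = P"
    and int: "f ` hex_region n \<inter> f' ` hex_region n = arc_image \<alpha> \<union> arc_image \<beta> \<union> arc_image \<gamma>"
    and ff: "\<forall>h\<in>{f, f'}.
           (\<forall>x\<in>hex_region n. \<forall>y\<in>hex_region n. dist (h x) (h y) = hdist x y) \<and>
           h ` hex_side n 0 = arc_image \<alpha> \<and>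
           h ` hex_side n 2 = arc_image \<beta> \<and>
           h ` hex_side n 4 = arc_image \<gamma> \<and>
           (\<forall>i\<in>{1, 3, 5}. h ` hex_side n i \<subseteq> hyp_boundary P)"
    using ob[unfolded standard_orthobasis_def cut_into_hexagons_def] by (elim conjE exE)
  interpret hexagon n by standard (rule hex)
  have h: "\<And>x y. x \<in> H \<Longrightarrow> y \<in> H \<Longrightarrow> dist (h x) (h y) = hdist x y"
    "h ` hex_side n 0 = c1 ` {0..l1}" "h ` hex_side n 2 = c2 ` {0..l2}" "h ` hex_side n 4 = c3 ` {0..l3}"
    "\<And>i. i \<in> {1, 3, 5} \<Longrightarrow> h ` hex_side n i \<subseteq> hyp_boundary P" if "h \<in> {f, f'}" for h
    using bspec[OF ff that] unfolding arc_image_def eq by auto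
  have ends: "c1 0 = h (vtx 5) \<and> c1 l1 = h (vtx 0) \<or> c1 0 = h (vtx 0) \<and> c1 l1 = h (vtx 5)"
    "c2 0 = h (vtx 1) \<and> c2 l2 = h (vtx 2) \<or> c2 0 = h (vtx 2) \<and> c2 l2 = h (vtx 1)"
    "c3 0 = h (vtx 3) \<and> c3 l3 = h (vtx 4) \<or> c3 0 = h (vtx 4) \<and> c3 l3 = h (vtx 3)" if "h \<in> {f, f'}" for h
    using arc_along_side(2)[OF _ h(1)[OF that] arcs(1,4) h(2)[OF that]]
      arc_along_side(2)[OF _ h(1)[OF that] arcs(2,5) h(3)[OF that]]
      arc_along_side(2)[OF _ h(1)[OF that] arcs(3,6) h(4)[OF that]] by simp_all
  have in_B: "h (vtx 5) \<in> B1 \<and> h (vtx 1) \<in> B2 \<and> h (vtx 3) \<in> B3" if hf: "h \<in> {f, f'}" for h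
  proof -
    have "h (vtx 5) \<in> B1 \<and> h (vtx 0) \<in> B2 \<or> h (vtx 5) \<in> B2 \<and> h (vtx 0) \<in> B1"
      "h (vtx 1) \<in> B2 \<and> h (vtx 2) \<in> B3 \<or> h (vtx 1) \<in> B3 \<and> h (vtx 2) \<in> B2"
      "h (vtx 3) \<in> B3 \<and> h (vtx 4) \<in> B1 \<or> h (vtx 3) \<in> B1 \<and> h (vtx 4) \<in> B3"
      using ends[OF hf] J by auto
    from vertices_in_components[OF h(1)[OF hf] h(5)[OF hf] B this] show ?thesis by blast
  qed
  have F: "f \<in> {f, f'}" and F': "f' \<in> {f, f'}" by auto
  \<comment> \<open>Each arc has one end on each of two disjoint components, so naming the component
    names the end.\<close>
  have v: "f (vtx 5) = f' (vtx 5)" "f (vtx 1) = f' (vtx 1)" "f (vtx 3) = f' (vtx 3)"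
  proof -
    show "f (vtx 5) = f' (vtx 5)" using ends(1)[OF F] ends(1)[OF F'] in_B[OF F] in_B[OF F'] J(1) dis(1) by auto
    show "f (vtx 1) = f' (vtx 1)" using ends(2)[OF F] ends(2)[OF F'] in_B[OF F] in_B[OF F'] J(2) dis(2) by auto
    show "f (vtx 3) = f' (vtx 3)" using ends(3)[OF F] ends(3)[OF F'] in_B[OF F] in_B[OF F'] J(3) dis(3) by auto
  qed
  have agree: "f x = f' x" if "s \<in> mirrors" "x \<in> hex_side n s" for s x
  proof -
    have "s = 0 \<or> s = 2 \<or> s = 4" using that(1) by (simp add: mirrors_def)
    then have "f ` hex_side n s = f' ` hex_side n s \<and> f (vtx ((s + 5) mod 6)) = f' (vtx ((s + 5) mod 6))"
      using h(2-4)[OF F] h(2-4)[OF F'] v by (elim disjE) simp_all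
    then show ?thesis
      using isometries_agree_on_side[OF mirrors_lt_6[OF that(1)] h(1)[OF F] h(1)[OF F'] _ _ that(2)] by blast
  qed
  let ?h = "\<lambda>b. if b then f else f'"
  have hb: "?h b \<in> {f, f'}" for b by simp
  have "glued_hexagons n P ?h"
  proof
    show "geodesic_metric P" using pants by (simp add: hyperbolic_pants_def hyperbolic_surface_def)
    show "?h b ` H \<union> ?h (\<not> b) ` H = P" for b using un by (cases b) auto
    show "?h b ` H \<inter> ?h (\<not> b) ` H \<subseteq> ?h b ` (\<Union>s\<in>mirrors. hex_side n s)" for b
    proof -
      have "?h b ` H \<inter> ?h (\<not> b) ` H = c1 ` {0..l1} \<union> c2 ` {0..l2} \<union> c3 ` {0..l3}"
        using int unfolding arc_image_def eq by (cases b) auto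
      also have "\<dots> = ?h b ` hex_side n 0 \<union> ?h b ` hex_side n 2 \<union> ?h b ` hex_side n 4"
        unfolding h(2-4)[OF hb] ..
      finally show ?thesis by (auto simp: mirrors_def)
    qed
    show "dist (?h b x) (?h b y) = hdist x y" if "x \<in> H" "y \<in> H" for x y b by (rule h(1)[OF hb that])
    show "?h b x = ?h (\<not> b) x" if "s \<in> mirrors" "x \<in> hex_side n s" for s x b
      using agree[OF that] by (cases b) auto
  qed
  moreover have "cosh (side_len s) = side_cosh s" if "s \<in> mirrors" for s
    using side_geometry(2)[OF mirrors_lt_6[OF that]] by (simp add: side_cosh_def)
  moreover have "l1 = side_len 0" "l2 = side_len 2" "l3 = side_len 4"
    using arc_along_side(1)[OF _ h(1)[OF F] arcs(1,4) h(2)[OF F]] arc_along_side(1)[OF _ h(1)[OF F] arcs(2,5) h(3)[OF F]]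
      arc_along_side(1)[OF _ h(1)[OF F] arcs(3,6) h(4)[OF F]] by auto
  ultimately show thesis using that by (auto simp: eq mirrors_def)
qed

section \<open>From ortho-integrality to condition (iii)\<close>

context glued_hexagons
begin

lemma ortho_integral_act:
  assumes "ortho_integral P" "j \<in> cuffs" "w \<noteq> []" "distinct_adj w" "set w \<subseteq> mirrors" "rev w = w" "hd w = opp j"
  shows "mink (n j) (act w (n j)) \<in> \<int>"
proof -
  obtain l c where "orthogeodesic P (l, c)" "cosh l = - mink (n j) (act w (n j))"
    using orthogeodesic_exists[OF assms(2-)] by blast
  then have "- mink (n j) (act w (n j)) \<in> \<int>" using assms(1) unfolding ortho_integral_def by fastforce
  then show ?thesis by simp
qed

lemma mirror_opp: "i \<in> mirrors \<Longrightarrow> opp i \<in> cuffs \<and> opp (opp i) = i"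
  by (auto simp: mirrors_def cuffs_def)

text \<open>The one-letter palindrome gives the product
  \<open>1 - 2 * (mink (n (opp i)) (n i))\<^sup>2\<close>.\<close>

lemma ortho_integral_cuff_mirror:
  assumes oi: "ortho_integral P" and i: "i \<in> mirrors"
  shows "2 * (mink (n (opp i)) (n i))\<^sup>2 \<in> \<int>"
proof -
  have o: "opp i \<in> cuffs" "opp (opp i) = i" using mirror_opp[OF i] by auto
  have "mink (n (opp i)) (act [i] (n (opp i))) \<in> \<int>"
    using i o by (intro ortho_integral_act[OF oi]) auto
  moreover have "mink (n (opp i)) (act [i] (n (opp i))) = 1 - 2 * (mink (n (opp i)) (n i))\<^sup>2"
    using unit[OF cuffs_lt_6[OF o(1)]] by (simp add: reflect_def power2_eq_square)
  ultimately have "1 - (1 - 2 * (mink (n (opp i)) (n i))\<^sup>2) \<in> \<int>" by (metis Ints_1 Ints_diff)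
  then show ?thesis by simp
qed

text \<open>The orthogeodesics winding around the boundary component adjacent to both mirrors give an
  integer sequence satisfying a linear recurrence with the trace of the product of the two
  reflections as coefficient.\<close>
lemma ortho_integral_mirrors:
  assumes oi: "ortho_integral P" and i: "i \<in> mirrors" and k: "k \<in> mirrors" and ik: "i \<noteq> k"
  shows "4 * (mink (n i) (n k))\<^sup>2 \<in> \<int>"
proof -
  define e where "e = n (opp i)"
  have o: "opp i \<in> cuffs" "opp (opp i) = i" using mirror_opp[OF i] by auto
  have ee: "mink e e = 1" using o by (simp add: e_def unit cuffs_lt_6)
  have ui: "mink (n i) (n i) = 1" "mink (n k) (n k) = 1" using i k by (simp_all add: unit mirrors_lt_6)
  have ek: "mink e (n k) = 0" using gram_adjacent[OF k o(1)] mirror_opp[OF k] ik o by (metis e_def mink_commute)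
  define g \<kappa> where "g = mink (n i) (n k)" and "\<kappa> = - mink e (n i)"
  have gc: "mink (n k) (n i) = g" by (simp add: g_def mink_commute)
  have \<kappa>: "\<kappa> \<noteq> 0" using gram_opp[OF mirrors_lt_6[OF i]] by (simp add: \<kappa>_def e_def mink_commute)
  define W where "W m = concat (replicate m [i, k])" for m
  define X where "X m = act (W m) e" for m
  have W_Suc: "W (Suc m) = i # k # W m" for m by (simp add: W_def)
  have W_Suc': "W (Suc m) = W m @ [i, k]" for m
  proof -
    have "replicate (Suc m) [i, k] = replicate m [i, k] @ [[i, k]]" by (simp add: replicate_append_same)
    then show ?thesis by (simp only: W_def concat_append) simp
  qed
  have X_Suc: "X (Suc m) = reflect (n i) (reflect (n k) (X m))" for m
    by (simp only: X_def W_Suc act_simps)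
  \<comment> \<open>The last letter \<open>k\<close> fixes \<open>e\<close>, so a power of the
    product of the two reflections acts on \<open>e\<close> like an odd alternating word, which is a
    palindrome.\<close>
  have X_Suc': "X (Suc m) = act (W m @ [i]) e" for m
    using reflect_perp[OF ek] by (simp only: X_def W_Suc' act_simps)
  have palin: "rev (W m @ [i]) = W m @ [i]" for m
  proof (induction m)
    case (Suc m)
    have "rev (W (Suc m) @ [i]) = rev (W m @ [i]) @ [k, i]" by (simp add: W_Suc)
    also have "\<dots> = W (Suc m) @ [i]" unfolding Suc by (simp add: W_Suc')
    finally show ?case .
  qed (simp add: W_def)
  have hd: "hd (W m @ [i]) = i" for m by (cases m) (simp_all add: W_def)
  have dis: "distinct_adj (W m @ [i])" for m
  proof (induction m)
    case (Suc m)
    then show ?case using ik hd[of m] by (simp add: W_Suc distinct_adj_Cons)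
  qed (simp add: W_def)
  have setW: "set (W m) \<subseteq> mirrors" for m using i k by (auto simp: W_def)
  define u \<alpha> \<beta> where "u m = mink e (X m)" and "\<alpha> m = mink (X m) (n i)" and "\<beta> m = mink (X m) (n k)" for m
  have "u m \<in> \<int>" for m
  proof (cases m)
    case 0
    then show ?thesis using ee by (simp add: u_def X_def W_def)
  next
    case (Suc m')
    have "mink e (act (W m' @ [i]) e) \<in> \<int>"
      unfolding e_def using i o(2) setW[of m'] hd[of m'] dis[of m'] palin[of m']
      by (intro ortho_integral_act[OF oi o(1)]) auto
    then show ?thesis by (simp add: u_def Suc X_Suc' del: act_simps)
  qed
  \<comment> \<open>The product of the two reflections fixes the vectors orthogonal to both mirror
    normals; differences remove this component and leave a recurrence of order two.\<close>
  moreover define d where "d m = u (Suc m) - u m" for m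
  ultimately have d_int: "d m \<in> \<int>" for m by simp
  have rec: "\<alpha> (Suc m) = - \<alpha> m + 2 * g * \<beta> m" "\<beta> (Suc m) = - \<beta> m - 2 * g * \<alpha> m + 4 * g * g * \<beta> m" for m
    by (simp_all add: \<alpha>_def \<beta>_def X_Suc reflect_def ui gc g_def[symmetric] algebra_simps)
  have d: "d m = - 2 * \<kappa> * \<alpha> (Suc m)" for m
    unfolding d_def rec
    by (simp add: u_def \<alpha>_def \<beta>_def X_Suc reflect_def ek gc \<kappa>_def algebra_simps)
  have 0: "\<alpha> 0 = - \<kappa>" "\<beta> 0 = 0" using ek by (simp_all add: \<alpha>_def \<beta>_def X_def W_def \<kappa>_def)
  \<comment> \<open>The trace on the plane spanned by the two mirror normals, read off from
    \<open>rec\<close>; the determinant there is 1.\<close>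
  define \<tau> where "\<tau> = 4 * g * g - 2"
  have "\<tau> \<in> \<int>"
  proof (rule Ints_if_recurrence_integral[of d, OF d_int])
    show "d 0 \<noteq> 0" using \<kappa> by (simp add: d rec 0)
    show "\<tau> * d 0 = d 1 - d 0" by (simp add: d rec 0 \<tau>_def algebra_simps)
    show "\<tau> * d (Suc m) = d (Suc (Suc m)) + d m" for m
      by (simp add: d rec[of "Suc (Suc m)"] rec[of "Suc m"] \<tau>_def algebra_simps)
  qed
  then have "\<tau> + 2 \<in> \<int>" by simp
  then show ?thesis by (simp add: \<tau>_def g_def power2_eq_square mult.assoc)
qed

end

lemma Ints_nonneg_imp_Nats: "x \<in> \<int> \<Longrightarrow> x \<ge> 0 \<Longrightarrow> x \<in> (\<nat> :: real set)"
  by (simp add: Nats_altdef2)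

theorem theorem4p1:
  fixes P :: "'a::metric_space set"
    and \<alpha> \<beta> \<gamma> :: "'a arc"
    and a :: "nat \<Rightarrow> real"
  assumes "hyperbolic_pants P"
    and "standard_orthobasis P \<alpha> \<beta> \<gamma>"
    and "a 1 = cosh (arc_length \<alpha>)"
    and "a 2 = cosh (arc_length \<beta>)"
    and "a 3 = cosh (arc_length \<gamma>)"
    and "a 1 \<le> a 2" and "a 2 \<le> a 3"
  shows "(ortho_integral P \<longleftrightarrow>
            (a 1, a 2, a 3) \<in> {(2,2,2), (2,2,5), (2,2,17), (3,3,3), (3,3,7), (3,3,19), (5,5,11)}) \<and>
         ((a 1, a 2, a 3) \<in> {(2,2,2), (2,2,5), (2,2,17), (3,3,3), (3,3,7), (3,3,19), (5,5,11)} \<longleftrightarrow>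
            (\<forall>i j k. {i, j, k} = {1, 2, 3} \<longrightarrow>
               {a i,
                2 * ((a 1)\<^sup>2 + (a 2)\<^sup>2 + (a 3)\<^sup>2 + 2 * a 1 * a 2 * a 3 - 1) / ((a i)\<^sup>2 - 1),
                4 * (a i * a j + a k)\<^sup>2 / (((a i)\<^sup>2 - 1) * ((a j)\<^sup>2 - 1))} \<subseteq> \<nat>))"
proof -
  obtain n h where glued: "glued_hexagons n P h" and len: "cosh (arc_length \<alpha>) = hexagon.side_cosh n 0"
    "cosh (arc_length \<beta>) = hexagon.side_cosh n 2" "cosh (arc_length \<gamma>) = hexagon.side_cosh n 4"
    using glued_hexagons_of_orthobasis[OF assms(1,2)] by metis
  interpret glued_hexagons n P h by (rule glued)
  \<comment> \<open>Sends the indices 1, 2, 3 of the orthobasis to the mirrors 0, 2, 4.\<close>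
  define \<sigma> :: "nat \<Rightarrow> nat" where "\<sigma> i = 2 * (i - 1)" for i
  have a: "a 1 = side_cosh 0" "a 2 = side_cosh 2" "a 3 = side_cosh 4" using assms len by simp_all
  have a': "a i = side_cosh (\<sigma> i)" "\<sigma> i \<in> mirrors" if "i \<in> {1, 2, 3}" for i
    using that a by (auto simp: \<sigma>_def mirrors_def)
  have gt: "a i > 1" if "i \<in> {1, 2, 3}" for i using side_cosh_gt_1 a'[OF that] by simp
  have gt1: "a 1 > 1" by (rule gt) simp
  have oi_imp: "{a i,
                2 * ((a 1)\<^sup>2 + (a 2)\<^sup>2 + (a 3)\<^sup>2 + 2 * a 1 * a 2 * a 3 - 1) / ((a i)\<^sup>2 - 1),
                4 * (a i * a j + a k)\<^sup>2 / (((a i)\<^sup>2 - 1) * ((a j)\<^sup>2 - 1))} \<subseteq> \<nat>"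
    if oi: "ortho_integral P" and ijk: "{i, j, k} = {1, 2, 3}" for i j k
  proof -
    have mem: "i \<in> {1, 2, 3}" "j \<in> {1, 2, 3}" "k \<in> {1, 2, 3}" unfolding ijk[symmetric] by auto
    have m: "\<sigma> i \<in> mirrors" "\<sigma> j \<in> mirrors" "\<sigma> k \<in> mirrors" using a' mem by blast+
    have ne: "\<sigma> i \<noteq> \<sigma> j" "\<sigma> j \<noteq> \<sigma> k" "\<sigma> i \<noteq> \<sigma> k" using perm_123[OF ijk] by (auto simp: \<sigma>_def)
    \<comment> \<open>The arcs of the orthobasis are themselves orthogeodesics.\<close>
    have arcs: "cosh (arc_length \<eta>) \<in> \<int>" if "\<eta> \<in> {\<alpha>, \<beta>, \<gamma>}" for \<eta>
      using oi[unfolded ortho_integral_def] conjunct1[OF assms(2)[unfolded standard_orthobasis_def]] that by blast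
    have "a i \<in> \<int>" using mem(1) assms(3-5) arcs[of \<alpha>] arcs[of \<beta>] arcs[of \<gamma>] by auto
    then have 1: "a i \<in> \<nat>" using gt[OF mem(1)] by (intro Ints_nonneg_imp_Nats) auto
    let ?D = "(a i)\<^sup>2 - 1" and ?E = "(a j)\<^sup>2 - 1"
    have DE: "?D > 0" "?E > 0" using side_cosh_sq[OF m ne] side_cosh_sq[of "\<sigma> j" "\<sigma> i" "\<sigma> k"] m ne a' mem by auto
    have "(a 1)\<^sup>2 + (a 2)\<^sup>2 + (a 3)\<^sup>2 + 2 * a 1 * a 2 * a 3 - 1 = (a i)\<^sup>2 + (a j)\<^sup>2 + (a k)\<^sup>2 + 2 * a i * a j * a k - 1"
      using perm_123[OF ijk] by auto
    also have "\<dots> = (mink (n (opp (\<sigma> i))) (n (\<sigma> i)))\<^sup>2 * ?D"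
      using cuff_mirror_product_sq[OF m ne] a' mem by simp
    finally have "2 * ((a 1)\<^sup>2 + (a 2)\<^sup>2 + (a 3)\<^sup>2 + 2 * a 1 * a 2 * a 3 - 1) / ?D = 2 * (mink (n (opp (\<sigma> i))) (n (\<sigma> i)))\<^sup>2"
      using DE by simp
    then have 2: "2 * ((a 1)\<^sup>2 + (a 2)\<^sup>2 + (a 3)\<^sup>2 + 2 * a 1 * a 2 * a 3 - 1) / ?D \<in> \<nat>"
      using ortho_integral_cuff_mirror[OF oi m(1)] by (simp add: Ints_nonneg_imp_Nats)
    have "(a i * a j + a k)\<^sup>2 = (mink (n (\<sigma> i)) (n (\<sigma> j)))\<^sup>2 * (?D * ?E)"
      using mirror_product_sq[OF m ne] a' mem by simp
    then have "4 * (a i * a j + a k)\<^sup>2 / (?D * ?E) = 4 * (mink (n (\<sigma> i)) (n (\<sigma> j)))\<^sup>2"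
      using DE by simp
    then have 3: "4 * (a i * a j + a k)\<^sup>2 / (?D * ?E) \<in> \<nat>"
      using ortho_integral_mirrors[OF oi m(1,2) ne(1)] by (simp add: Ints_nonneg_imp_Nats)
    show ?thesis using 1 2 3 by blast
  qed
  have imp_oi: "ortho_integral P"
    if "(a 1, a 2, a 3) \<in> {(2,2,2), (2,2,5), (2,2,17), (3,3,3), (3,3,7), (3,3,19), (5,5,11)}"
  proof -
    have v: "(side_cosh 0, side_cosh 2, side_cosh 4) \<in> {(2,2,2), (2,2,5), (2,2,17), (3,3,3), (3,3,7), (3,3,19), (5,5,11)}"
      using that a by simp
    have I: "mink (n i) (act w (n j)) \<in> \<int>" if ij: "i \<in> cuffs" "j \<in> cuffs" "set w \<subseteq> mirrors" for i j w
    proof -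
      \<comment> \<open>Reflection in mirror 4 has the coefficient 1/4 for (2,2,17) and 1/3 for
        (3,3,19); for the other five triples all coefficients are integers.\<close>
      define m :: real where "m = (if side_cosh 4 = 17 then 4 else if side_cosh 4 = 19 then 3 else 1)"
      show ?thesis
        using v ij by (intro cuff_orbit_integral[of m])
          (elim insertE emptyE Pair_inject; simp add: m_def power2_eq_square)+
    qed
    show ?thesis unfolding ortho_integral_def
    proof (intro allI impI)
      fix \<eta> :: "'a arc" assume "orthogeodesic P \<eta>"
      then obtain i j w where "i \<in> cuffs" "j \<in> cuffs" "set w \<subseteq> mirrors" "cosh (arc_length \<eta>) = - mink (n i) (act w (n j))"
        using cosh_orthogeodesic_length[of "fst \<eta>" "snd \<eta>"] by auto
      then show "cosh (arc_length \<eta>) \<in> \<int>" using I by simp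
    qed
  qed
  note triples = integral_triples_iff[OF gt1 assms(6,7), unfolded integral_triples_def]
  show ?thesis
  proof (intro conjI iffI)
    assume "ortho_integral P"
    then have "\<forall>i j k. {i, j, k} = {1, 2, 3} \<longrightarrow>
               {a i,
                2 * ((a 1)\<^sup>2 + (a 2)\<^sup>2 + (a 3)\<^sup>2 + 2 * a 1 * a 2 * a 3 - 1) / ((a i)\<^sup>2 - 1),
                4 * (a i * a j + a k)\<^sup>2 / (((a i)\<^sup>2 - 1) * ((a j)\<^sup>2 - 1))} \<subseteq> \<nat>"
      by (intro allI impI oi_imp)
    then show "(a 1, a 2, a 3) \<in> {(2,2,2), (2,2,5), (2,2,17), (3,3,3), (3,3,7), (3,3,19), (5,5,11)}"
      by (rule iffD2[OF triples])
  qed (rule imp_oi, assumption, erule iffD1[OF triples], erule iffD2[OF triples])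
qed

end
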